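(* There exists no quasi abelian solvmanifold with an invariant locally conformally parallel and non-parallel $\mathrm{Spin}(7)$ structure.
   Context: A Lie algebra is quasi abelian if it contains a codimension $1$ abelian ideal. A solvmanifold is a compact quotient $G/\Gamma$, where $G$ is a simply connected solvable Lie group and $\Gamma$ is a discrete lattice; it is quasi abelian if the Lie algebra of $G$ is quasi abelian. Here $\dim G=8$. A $\mathrm{Spin}(7)$ structure on an $8$-manifold is given by a $4$-form $\Omega$ which at each point is, in some frame, the form $e^{0123}-e^{0145}-e^{0167}-e^{0246}+e^{0257}-e^{0347}-e^{0356}+e^{4567}-e^{2367}-e^{2345}-e^{1357}+e^{1346}-e^{1256}-e^{1247}$ (with $e^{ijkl}=e^i\wedge e^j\wedge e^k\wedge e^l$); it induces the metric and orientation for which such frames are orthonormal and positively oriented. An invariant structure on $G/\Gamma$ is one induced from a left-invariant structure on $G$. The structure is parallel if $*d\Omega=0$ and locally conformally parallel if $*d\Omega\in\Lambda^3_8=\{i(X)\Omega\}$ at every point. *)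

theory Defs
  imports
    "HOL-Analysis.Analysis"
    "HOL-Algebra.Solvable_Groups"
    "HOL-Library.Function_Algebras"
begin

section \<open>Pointwise vector space structure on functions\<close>

instantiation "fun" :: (type, real_vector) real_vector
begin

definition scaleR_fun :: "real \<Rightarrow> ('a \<Rightarrow> 'b) \<Rightarrow> 'a \<Rightarrow> 'b" where
  "scaleR_fun r f = (\<lambda>x. r *\<^sub>R f x)"

instance
  by standard (simp_all add: scaleR_fun_def plus_fun_def scaleR_add_right scaleR_add_left)

end


section \<open>Smooth manifolds\<close>

text \<open>The set \<open>S\<close> is always open in what follows.  In finite dimension, continuity of
  \<open>x \<mapsto> D f x v\<close> for each fixed \<open>v\<close> is continuity of the derivative.\<close>

primrec C_on :: "nat \<Rightarrow> 'a::euclidean_space set \<Rightarrow> ('a \<Rightarrow> 'b::real_normed_vector) \<Rightarrow> bool" where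
  "C_on 0 S f \<longleftrightarrow> continuous_on S f"
| "C_on (Suc k) S f \<longleftrightarrow>
     (\<forall>x\<in>S. f differentiable (at x)) \<and> (\<forall>v. C_on k S (\<lambda>x. frechet_derivative f (at x) v))"

definition smooth_on :: "'a::euclidean_space set \<Rightarrow> ('a \<Rightarrow> 'b::real_normed_vector) \<Rightarrow> bool" where
  "smooth_on S f \<longleftrightarrow> (\<forall>k. C_on k S f)"

text \<open>A chart is a pair of its domain and its coordinate map.\<close>

type_synonym ('m, 'e) chart = "'m set \<times> ('m \<Rightarrow> 'e)"

definition cdom :: "('m, 'e) chart \<Rightarrow> 'm set" where
  "cdom c = fst c"

definition coord :: "('m, 'e) chart \<Rightarrow> 'm \<Rightarrow> 'e" where
  "coord c = snd c"

definition crange :: "('m, 'e) chart \<Rightarrow> 'e set" where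
  "crange c = coord c ` cdom c"

definition local_rep ::
  "('m, 'e) chart \<Rightarrow> ('n, 'f) chart \<Rightarrow> ('m \<Rightarrow> 'n) \<Rightarrow> 'e \<Rightarrow> 'f" where
  "local_rep c d F = coord d \<circ> F \<circ> inv_into (cdom c) (coord c)"

definition is_chart :: "'m topology \<Rightarrow> ('m, 'e::euclidean_space) chart \<Rightarrow> bool" where
  "is_chart T c \<longleftrightarrow> openin T (cdom c) \<and> open (crange c) \<and>
     homeomorphic_map (subtopology T (cdom c)) (top_of_set (crange c)) (coord c)"

definition smooth_manifold :: "'m topology \<Rightarrow> ('m, 'e::euclidean_space) chart set \<Rightarrow> bool" where
  "smooth_manifold T A \<longleftrightarrow>
     Hausdorff_space T \<and> second_countable T \<and>
     (\<forall>c\<in>A. is_chart T c) \<and> (\<Union>c\<in>A. cdom c) = topspace T \<and>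
     (\<forall>c\<in>A. \<forall>d\<in>A. smooth_on (coord c ` (cdom c \<inter> cdom d)) (local_rep c d (\<lambda>p. p)))"

definition smooth_map ::
  "'m topology \<Rightarrow> ('m, 'e::euclidean_space) chart set \<Rightarrow>
   'n topology \<Rightarrow> ('n, 'f::euclidean_space) chart set \<Rightarrow> ('m \<Rightarrow> 'n) \<Rightarrow> bool" where
  "smooth_map S A T B F \<longleftrightarrow> continuous_map S T F \<and>
     (\<forall>c\<in>A. \<forall>d\<in>B. smooth_on (coord c ` {p \<in> cdom c. F p \<in> cdom d}) (local_rep c d F))"

definition prod_atlas ::
  "('m, 'e) chart set \<Rightarrow> ('n, 'f) chart set \<Rightarrow> ('m \<times> 'n, 'e \<times> 'f) chart set" where
  "prod_atlas A B = {(cdom c \<times> cdom d, map_prod (coord c) (coord d)) | c d. c \<in> A \<and> d \<in> B}"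


section \<open>Vector fields and differential forms\<close>

text \<open>Vector fields and forms are given by their coordinate representations in all charts of an
  atlas: \<open>X c x\<close> and \<open>\<omega> c x\<close> are the representations in the chart \<open>c\<close>
  at the point with coordinates \<open>x\<close>.  A vector field is \<open>0\<close> where it carries no information,
  so that vector fields form a real vector space.\<close>

type_synonym ('m, 'e) vfield = "('m, 'e) chart \<Rightarrow> 'e \<Rightarrow> 'e"
type_synonym ('m, 'e) form = "('m, 'e) chart \<Rightarrow> 'e \<Rightarrow> 'e list \<Rightarrow> real"

definition related_by ::
  "('m, 'e::euclidean_space) chart set \<Rightarrow> ('n, 'f::euclidean_space) chart set \<Rightarrow>
   ('m \<Rightarrow> 'n) \<Rightarrow> ('m, 'e) vfield \<Rightarrow> ('n, 'f) vfield \<Rightarrow> bool" where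
  "related_by A B F X Y \<longleftrightarrow>
     (\<forall>c\<in>A. \<forall>d\<in>B. \<forall>p\<in>cdom c. F p \<in> cdom d \<longrightarrow>
        Y d (coord d (F p)) =
          frechet_derivative (local_rep c d F) (at (coord c p)) (X c (coord c p)))"

definition vector_field ::
  "('m, 'e::euclidean_space) chart set \<Rightarrow> ('m, 'e) vfield \<Rightarrow> bool" where
  "vector_field A X \<longleftrightarrow>
     (\<forall>c\<in>A. smooth_on (crange c) (X c)) \<and>
     related_by A A (\<lambda>p. p) X X \<and>
     (\<forall>c x. c \<notin> A \<or> x \<notin> crange c \<longrightarrow> X c x = 0)"

definition lie_bracket ::
  "('m, 'e::euclidean_space) chart set \<Rightarrow> ('m, 'e) vfield \<Rightarrow> ('m, 'e) vfield \<Rightarrow> ('m, 'e) vfield"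
  where
  "lie_bracket A X Y = (\<lambda>c x.
     if c \<in> A \<and> x \<in> crange c
     then frechet_derivative (Y c) (at x) (X c x) - frechet_derivative (X c) (at x) (Y c x)
     else 0)"

definition alternating_form :: "nat \<Rightarrow> ('e::real_vector list \<Rightarrow> real) \<Rightarrow> bool" where
  "alternating_form k \<alpha> \<longleftrightarrow>
     (\<forall>vs. length vs \<noteq> k \<longrightarrow> \<alpha> vs = 0) \<and>
     (\<forall>vs i. length vs = k \<and> i < k \<longrightarrow> linear (\<lambda>v. \<alpha> (vs[i := v]))) \<and>
     (\<forall>vs i j. length vs = k \<and> i < j \<and> j < k \<and> vs ! i = vs ! j \<longrightarrow> \<alpha> vs = 0)"

text \<open>\<open>is_pullback A B F \<eta> \<omega>\<close> says \<open>\<eta> = F\<^sup>* \<omega>\<close>.\<close>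

definition is_pullback ::
  "('m, 'e::euclidean_space) chart set \<Rightarrow> ('n, 'f::euclidean_space) chart set \<Rightarrow>
   ('m \<Rightarrow> 'n) \<Rightarrow> ('m, 'e) form \<Rightarrow> ('n, 'f) form \<Rightarrow> bool" where
  "is_pullback A B F \<eta> \<omega> \<longleftrightarrow>
     (\<forall>c\<in>A. \<forall>d\<in>B. \<forall>p\<in>cdom c. F p \<in> cdom d \<longrightarrow>
        (\<forall>vs. \<eta> c (coord c p) vs =
           \<omega> d (coord d (F p)) (map (frechet_derivative (local_rep c d F) (at (coord c p))) vs)))"

definition differential_form ::
  "nat \<Rightarrow> ('m, 'e::euclidean_space) chart set \<Rightarrow> ('m, 'e) form \<Rightarrow> bool" where
  "differential_form k A \<omega> \<longleftrightarrow>
     (\<forall>c\<in>A. (\<forall>x\<in>crange c. alternating_form k (\<omega> c x)) \<and>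
             (\<forall>vs. smooth_on (crange c) (\<lambda>x. \<omega> c x vs))) \<and>
     is_pullback A A (\<lambda>p. p) \<omega> \<omega>"

definition ext_deriv :: "('m, 'e::euclidean_space) form \<Rightarrow> ('m, 'e) form" where
  "ext_deriv \<omega> c x vs =
     (\<Sum>i<length vs. (- 1) ^ i *
        frechet_derivative (\<lambda>y. \<omega> c y (take i vs @ drop (Suc i) vs)) (at x) (vs ! i))"


section \<open>Quotients\<close>

definition quotient_topology :: "'m topology \<Rightarrow> ('m \<Rightarrow> 'q) \<Rightarrow> 'q topology" where
  "quotient_topology T f =
     topology (\<lambda>V. V \<subseteq> f ` topspace T \<and> openin T {p \<in> topspace T. f p \<in> V})"

lemma istopology_quotient:
  "istopology (\<lambda>V. V \<subseteq> f ` topspace T \<and> openin T {p \<in> topspace T. f p \<in> V})"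
proof -
  have "{p \<in> topspace T. f p \<in> V \<inter> W} =
        {p \<in> topspace T. f p \<in> V} \<inter> {p \<in> topspace T. f p \<in> W}" for V W
    by auto
  moreover have "{p \<in> topspace T. f p \<in> \<Union>\<K>} = (\<Union>V\<in>\<K>. {p \<in> topspace T. f p \<in> V})" for \<K>
    by auto
  ultimately show ?thesis
    unfolding istopology_def by (auto simp: openin_Int intro!: openin_Union)
qed

lemma openin_quotient_topology:
  "openin (quotient_topology T f) V \<longleftrightarrow>
     V \<subseteq> f ` topspace T \<and> openin T {p \<in> topspace T. f p \<in> V}"
  unfolding quotient_topology_def topology_inverse'[OF istopology_quotient] ..

lemma topspace_quotient_topology: "topspace (quotient_topology T f) = f ` topspace T"
proof -
  have *: "{p \<in> topspace T. f p \<in> f ` topspace T} = topspace T"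
    by auto
  have "openin (quotient_topology T f) (f ` topspace T)"
    unfolding openin_quotient_topology * by simp
  then show ?thesis
    by (meson openin_quotient_topology openin_subset openin_topspace subset_antisym)
qed

lemma quotient_map_quotient_topology: "quotient_map T (quotient_topology T f) f"
  unfolding quotient_map_def topspace_quotient_topology
  by (auto simp: openin_quotient_topology)

text \<open>Charts of the quotient are the charts of the total space restricted to open sets on which
  the projection is injective; for a covering projection, this is the atlas for which it is a
  local diffeomorphism.\<close>

definition quotient_atlas ::
  "'m topology \<Rightarrow> ('m, 'e) chart set \<Rightarrow> ('m \<Rightarrow> 'q) \<Rightarrow> ('q, 'e) chart set" where
  "quotient_atlas T A f =
     {(f ` U, coord c \<circ> inv_into U f) | U c. c \<in> A \<and> openin T U \<and> U \<subseteq> cdom c \<and> inj_on f U}"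


section \<open>Lie groups and their Lie algebras\<close>

definition lie_group ::
  "('g, 'b) monoid_scheme \<Rightarrow> 'g topology \<Rightarrow> ('g, 'e::euclidean_space) chart set \<Rightarrow> bool" where
  "lie_group G T A \<longleftrightarrow>
     group G \<and> topspace T = carrier G \<and> smooth_manifold T A \<and>
     smooth_map (prod_topology T T) (prod_atlas A A) T A (\<lambda>(x, y). x \<otimes>\<^bsub>G\<^esub> y) \<and>
     smooth_map T A T A (\<lambda>x. inv\<^bsub>G\<^esub> x)"

definition simply_connected_space :: "'a topology \<Rightarrow> bool" where
  "simply_connected_space T \<longleftrightarrow>
     path_connected_space T \<and>
     (\<forall>\<gamma>. pathin T \<gamma> \<and> \<gamma> 0 = \<gamma> 1 \<longrightarrow>
        homotopic_with (\<lambda>h. h 0 = \<gamma> 0 \<and> h 1 = \<gamma> 0) (top_of_set {0..1}) T \<gamma> (\<lambda>_. \<gamma> 0))"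

definition lie_algebra ::
  "('g, 'b) monoid_scheme \<Rightarrow> ('g, 'e::euclidean_space) chart set \<Rightarrow> ('g, 'e) vfield set" where
  "lie_algebra G A =
     {X. vector_field A X \<and> (\<forall>g\<in>carrier G. related_by A A (\<lambda>h. g \<otimes>\<^bsub>G\<^esub> h) X X)}"

definition quasi_abelian :: "'v::real_vector set \<Rightarrow> ('v \<Rightarrow> 'v \<Rightarrow> 'v) \<Rightarrow> bool" where
  "quasi_abelian L br \<longleftrightarrow>
     (\<exists>I. I \<subseteq> L \<and> subspace I \<and> dim I + 1 = dim L \<and>
          (\<forall>X\<in>L. \<forall>Y\<in>I. br X Y \<in> I) \<and> (\<forall>X\<in>I. \<forall>Y\<in>I. br X Y = 0))"

text \<open>The quotient is the space of cosets \<open>\<Gamma> g\<close>: these are the quotients to which left-invariant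
  tensors on \<open>G\<close> descend.\<close>

definition coset_proj :: "('g, 'b) monoid_scheme \<Rightarrow> 'g set \<Rightarrow> 'g \<Rightarrow> 'g set" where
  "coset_proj G \<Gamma> g = \<Gamma> #>\<^bsub>G\<^esub> g"

abbreviation coset_topology ::
  "('g, 'b) monoid_scheme \<Rightarrow> 'g topology \<Rightarrow> 'g set \<Rightarrow> 'g set topology" where
  "coset_topology G T \<Gamma> \<equiv> quotient_topology T (coset_proj G \<Gamma>)"

abbreviation coset_atlas ::
  "('g, 'b) monoid_scheme \<Rightarrow> 'g topology \<Rightarrow> ('g, 'e) chart set \<Rightarrow> 'g set \<Rightarrow> ('g set, 'e) chart set"
  where
  "coset_atlas G T A \<Gamma> \<equiv> quotient_atlas T A (coset_proj G \<Gamma>)"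

definition solvmanifold ::
  "('g, 'b) monoid_scheme \<Rightarrow> 'g topology \<Rightarrow> ('g, 'e::euclidean_space) chart set \<Rightarrow> 'g set \<Rightarrow> bool"
  where
  "solvmanifold G T A \<Gamma> \<longleftrightarrow>
     lie_group G T A \<and> simply_connected_space T \<and> solvable G \<and>
     subgroup \<Gamma> G \<and> subtopology T \<Gamma> = discrete_topology \<Gamma> \<and>
     compact_space (coset_topology G T \<Gamma>)"

definition quasi_abelian_solvmanifold ::
  "('g, 'b) monoid_scheme \<Rightarrow> 'g topology \<Rightarrow> ('g, 'e::euclidean_space) chart set \<Rightarrow> 'g set \<Rightarrow> bool"
  where
  "quasi_abelian_solvmanifold G T A \<Gamma> \<longleftrightarrow>
     solvmanifold G T A \<Gamma> \<and> quasi_abelian (lie_algebra G A) (lie_bracket A)"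


section \<open>Spin(7) structures\<close>

text \<open>\<open>ewedge [i\<^sub>1, \<dots>, i\<^sub>k]\<close> is the wedge product of the dual standard basis covectors
  with indices \<open>i\<^sub>1, \<dots>, i\<^sub>k\<close>, normalized by \<open>(e\<^sup>1 \<and> \<dots> \<and> e\<^sup>k) (e\<^sub>1, \<dots>, e\<^sub>k) = 1\<close>.  The type
  \<open>8\<close> of integers modulo 8 has the elements 0, ..., 7.\<close>

definition ewedge :: "8 list \<Rightarrow> (real ^ 8) list \<Rightarrow> real" where
  "ewedge is vs =
     (if length vs = length is
      then \<Sum>\<sigma> | \<sigma> permutes {..<length is}.
             of_int (sign \<sigma>) * (\<Prod>a<length is. (vs ! \<sigma> a) $ (is ! a))
      else 0)"

definition spin7_form :: "(real ^ 8) list \<Rightarrow> real" where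
  "spin7_form vs =
     ewedge [0,1,2,3] vs - ewedge [0,1,4,5] vs - ewedge [0,1,6,7] vs - ewedge [0,2,4,6] vs
   + ewedge [0,2,5,7] vs - ewedge [0,3,4,7] vs - ewedge [0,3,5,6] vs + ewedge [4,5,6,7] vs
   - ewedge [2,3,6,7] vs - ewedge [2,3,4,5] vs - ewedge [1,3,5,7] vs + ewedge [1,3,4,6] vs
   - ewedge [1,2,5,6] vs - ewedge [1,2,4,7] vs"

text \<open>A frame \<open>f\<^sub>0, \<dots>, f\<^sub>7\<close> is encoded as the linear isomorphism \<open>L\<close> with \<open>L e\<^sub>i = f\<^sub>i\<close>.\<close>

definition spin7_frame :: "((real ^ 8) list \<Rightarrow> real) \<Rightarrow> (real ^ 8 \<Rightarrow> real ^ 8) \<Rightarrow> bool" where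
  "spin7_frame \<Omega> L \<longleftrightarrow> linear L \<and> bij L \<and> (\<forall>vs. length vs = 4 \<longrightarrow> \<Omega> (map L vs) = spin7_form vs)"

definition spin7_structure ::
  "('m, real ^ 8) chart set \<Rightarrow> ('m, real ^ 8) form \<Rightarrow> bool" where
  "spin7_structure A \<Omega> \<longleftrightarrow>
     differential_form 4 A \<Omega> \<and> (\<forall>c\<in>A. \<forall>x\<in>crange c. \<exists>L. spin7_frame (\<Omega> c x) L)"

text \<open>The Hodge star of a \<open>k\<close>-form for the standard metric and orientation, i.e.
  \<open>(\<star>\<alpha>)\<^bsub>J\<^esub> = (1/k!) \<Sum>\<^bsub>I\<^esub> \<alpha>\<^bsub>I\<^esub> vol\<^bsub>I J\<^esub>\<close>.\<close>

definition hodge_std :: "nat \<Rightarrow> ((real ^ 8) list \<Rightarrow> real) \<Rightarrow> (real ^ 8) list \<Rightarrow> real" where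
  "hodge_std k \<alpha> ws =
     (\<Sum>is | length is = k. let es = map (\<lambda>i. axis i 1) is in
        \<alpha> es * ewedge [0,1,2,3,4,5,6,7] (es @ ws)) / fact k"

text \<open>The Hodge star for the metric and orientation that \<open>\<Omega>\<close> induces, computed in a frame
  adapted to \<open>\<Omega>\<close>.  The choice is irrelevant, as two such frames differ by an element of
  Spin(7), which is contained in SO(8).\<close>

definition spin7_hodge ::
  "((real ^ 8) list \<Rightarrow> real) \<Rightarrow> nat \<Rightarrow> ((real ^ 8) list \<Rightarrow> real) \<Rightarrow> (real ^ 8) list \<Rightarrow> real" where
  "spin7_hodge \<Omega> k \<alpha> ws =
     (let L = (SOME L. spin7_frame \<Omega> L)
      in hodge_std k (\<lambda>vs. \<alpha> (map L vs)) (map (inv_into UNIV L) ws))"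

definition parallel_spin7 :: "('m, real ^ 8) chart set \<Rightarrow> ('m, real ^ 8) form \<Rightarrow> bool" where
  "parallel_spin7 A \<Omega> \<longleftrightarrow>
     (\<forall>c\<in>A. \<forall>x\<in>crange c. spin7_hodge (\<Omega> c x) 5 (ext_deriv \<Omega> c x) = (\<lambda>ws. 0))"

definition lcp_spin7 :: "('m, real ^ 8) chart set \<Rightarrow> ('m, real ^ 8) form \<Rightarrow> bool" where
  "lcp_spin7 A \<Omega> \<longleftrightarrow>
     (\<forall>c\<in>A. \<forall>x\<in>crange c. \<exists>v.
        spin7_hodge (\<Omega> c x) 5 (ext_deriv \<Omega> c x) = (\<lambda>ws. \<Omega> c x (v # ws)))"

text \<open>A structure on the quotient is invariant if its pullback to \<open>G\<close> is left-invariant.\<close>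

definition invariant_spin7 ::
  "('g, 'b) monoid_scheme \<Rightarrow> 'g topology \<Rightarrow> ('g, real ^ 8) chart set \<Rightarrow> 'g set \<Rightarrow>
   ('g set, real ^ 8) form \<Rightarrow> bool" where
  "invariant_spin7 G T A \<Gamma> \<Omega> \<longleftrightarrow>
     spin7_structure (coset_atlas G T A \<Gamma>) \<Omega> \<and>
     (\<exists>\<omega>. spin7_structure A \<omega> \<and>
          (\<forall>g\<in>carrier G. is_pullback A A (\<lambda>h. g \<otimes>\<^bsub>G\<^esub> h) \<omega> \<omega>) \<and>
          is_pullback A (coset_atlas G T A \<Gamma>) (coset_proj G \<Gamma>) \<omega> \<Omega>)"

end

theory Submission
  imports Defs "HOL-Combinatorics.Multiset_Permutations"
begin

text \<open>Let \<open>I\<close> be the abelian ideal of codimension one, \<open>\<nu>\<close> its unit normal, and \<open>D = ad \<nu>\<close>.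
  Then \<open>[u, w] = \<nu>(u) D w - \<nu>(w) D u\<close>, so a left-invariant \<open>\<Omega>\<close> satisfies
  \<open>d\<Omega> = - \<nu> \<and> (D \<cdot> \<Omega>)\<close>.  Being locally conformally parallel means \<open>d\<Omega> = \<theta> \<and> \<Omega>\<close>.
  Wedging with \<open>\<nu>\<close> and using that \<open>\<Omega> \<and> _\<close> is injective on 2-forms gives \<open>\<theta> = c \<nu>\<close>; contracting
  with \<open>\<nu> \<and> \<Omega>\<close> then gives \<open>7 c = - 4 tr D\<close>.  Finally \<open>tr D = 0\<close>, because a group with a
  cocompact discrete subgroup is unimodular: right translation by \<open>g\<close> scales the left Haar measure
  by a factor \<open>\<Delta>(g)\<close>, but maps a fundamental domain of finite positive measure to another one.\<close>

section \<open>Alternating forms on the standard frame\<close>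

text \<open>The Cayley form is a Steiner system: its 14 blocks of four indices contain each of the
  56 triples exactly once. In an adapted frame the condition on \<star>d\<Omega> is therefore 56
  scalar equations, each naming a single coordinate of the vector t with d\<Omega> = t \<and>
  \<Omega>; a coordinate occurs seven times because an index lies in seven blocks. The 4 is the
  degree: if D is r times the identity on the 7-dimensional ideal, then tr D = 7r and c = -4r.
  Injectivity on 2-forms needs no representation theory, as it splits into seven 4 by 4 systems. The
  obstacle is tr D = 0. The group is given only by charts, so its Haar measure is built from a
  density in one chart at the identity and carried around by translations; the factor under right
  translation is |det Ad(g^-1)|. That this factor is 1 becomes a statement on a trace by comparing
  the determinants of left and right translations near the identity and differentiating, so no
  exponential map occurs. It suffices that t vanishes: then \<star>d\<Omega> = i(t)\<Omega> = 0,
  against non-parallelism.\<close>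

lemma UNIV_8: "(UNIV :: 8 set) = {0,1,2,3,4,5,6,7}"
proof -
  have "card {0::8,1,2,3,4,5,6,7} = CARD(8)" by simp
  then show ?thesis by (metis card_subset_eq finite subset_UNIV)
qed

text \<open>Only the sign change under exchange of two neighbours is kept, without multilinearity:
  moving and sorting of arguments use nothing else, and it is easy to check for explicit
  formulas.\<close>

definition adjacent_alternating :: "nat \<Rightarrow> ('a list \<Rightarrow> real) \<Rightarrow> bool" where
  "adjacent_alternating n \<beta> \<longleftrightarrow>
     (\<forall>xs a b ys. length xs + length ys + 2 = n \<longrightarrow> \<beta> (xs @ a # b # ys) = - \<beta> (xs @ b # a # ys))"

lemma adjacent_alternatingD:
  "adjacent_alternating n \<beta> \<Longrightarrow> length xs + length ys + 2 = n \<Longrightarrow>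
     \<beta> (xs @ a # b # ys) = - \<beta> (xs @ b # a # ys)"
  unfolding adjacent_alternating_def by blast

text \<open>Reindexing the determinant sum by \<sigma> \<mapsto> \<tau> \<circ> \<sigma> multiplies
  every sign by that of \<tau>, whose square is 1.\<close>

lemma ewedge_permute_list:
  assumes "\<tau> permutes {..<length is}" "length vs = length is"
  shows "ewedge is (permute_list \<tau> vs) = of_int (sign \<tau>) * ewedge is vs"
proof -
  let ?n = "length is"
  have fin: "finite {..<?n}" by simp
  have "ewedge is (permute_list \<tau> vs) =
     (\<Sum>\<sigma> | \<sigma> permutes {..<?n}. of_int (sign \<sigma>) * (\<Prod>a<?n. (vs ! \<tau> (\<sigma> a)) $ (is ! a)))"
  proof -
    have "permute_list \<tau> vs ! \<sigma> a = vs ! \<tau> (\<sigma> a)" if "\<sigma> permutes {..<?n}" "a < ?n" for \<sigma> a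
    proof -
      have "\<sigma> a < length vs" using that assms(2) by (metis lessThan_iff permutes_in_image)
      then show ?thesis using assms by (simp add: permute_list_nth)
    qed
    then show ?thesis using assms unfolding ewedge_def by simp
  qed
  also have "\<dots> = (\<Sum>\<sigma> | \<sigma> permutes {..<?n}.
      of_int (sign \<tau>) * (of_int (sign (\<tau> \<circ> \<sigma>)) * (\<Prod>a<?n. (vs ! (\<tau> \<circ> \<sigma>) a) $ (is ! a))))"
  proof (rule sum.cong[OF refl])
    fix \<sigma> assume "\<sigma> \<in> {\<sigma>. \<sigma> permutes {..<?n}}"
    then have "permutation \<sigma>" "permutation \<tau>"
      using assms by (auto simp: permutation_permutes)
    then have "sign (\<tau> \<circ> \<sigma>) = sign \<tau> * sign \<sigma>" by (rule sign_compose[rotated])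
    then have "sign \<sigma> = sign \<tau> * sign (\<tau> \<circ> \<sigma>)"
      by (simp add: mult.assoc[symmetric])
    then show "of_int (sign \<sigma>) * (\<Prod>a<?n. (vs ! \<tau> (\<sigma> a)) $ (is ! a)) =
      of_int (sign \<tau>) * (of_int (sign (\<tau> \<circ> \<sigma>)) * (\<Prod>a<?n. (vs ! (\<tau> \<circ> \<sigma>) a) $ (is ! a)))"
      by simp
  qed
  also have "\<dots> = of_int (sign \<tau>) * (\<Sum>\<sigma> | \<sigma> permutes {..<?n}.
      of_int (sign (\<tau> \<circ> \<sigma>)) * (\<Prod>a<?n. (vs ! (\<tau> \<circ> \<sigma>) a) $ (is ! a)))"
    by (simp add: sum_distrib_left)
  also have "(\<Sum>\<sigma> | \<sigma> permutes {..<?n}.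
      of_int (sign (\<tau> \<circ> \<sigma>)) * (\<Prod>a<?n. (vs ! (\<tau> \<circ> \<sigma>) a) $ (is ! a))) = ewedge is vs"
    using assms unfolding ewedge_def
    by (simp add: setum_permutations_compose_left[OF assms(1),
          where f = "\<lambda>\<sigma>. of_int (sign \<sigma>) * (\<Prod>a<?n. (vs ! \<sigma> a) $ (is ! a))"])
  finally show ?thesis .
qed

lemma ewedge_alternating:
  assumes "n = length is" shows "adjacent_alternating n (ewedge is)"
  unfolding adjacent_alternating_def
proof (intro allI impI)
  fix xs ys :: "(real^8) list" and a b :: "real^8"
  assume len: "length xs + length ys + 2 = n"
  let ?k = "length xs"
  let ?t = "Transposition.transpose ?k (Suc ?k)"
  have p: "?t permutes {..<length is}"
    using len assms by (intro permutes_swap_id) auto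
  have "permute_list ?t (xs @ b # a # ys) = xs @ a # b # ys"
  proof (rule nth_equalityI)
    fix i assume i: "i < length (permute_list ?t (xs @ b # a # ys))"
    have p': "?t permutes {..<length (xs @ b # a # ys)}" using p len assms by simp
    have "permute_list ?t (xs @ b # a # ys) ! i = (xs @ b # a # ys) ! ?t i"
      using i p' by (simp add: permute_list_nth)
    also have "\<dots> = (xs @ a # b # ys) ! i"
      by (auto simp: Transposition.transpose_def nth_append nth_Cons split: nat.splits)
    finally show "permute_list ?t (xs @ b # a # ys) ! i = (xs @ a # b # ys) ! i" .
  qed simp
  then show "ewedge is (xs @ a # b # ys) = - ewedge is (xs @ b # a # ys)"
    using ewedge_permute_list[OF p, of "xs @ b # a # ys"] len assms by (simp add: sign_swap_id)
qed

text \<open>A permutation other than the identity moves some position and, the indices being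
  distinct, meets a zero coordinate there; only the summand of the identity survives.\<close>

lemma ewedge_self:
  assumes "distinct is" shows "ewedge is (map (\<lambda>i. axis i 1) is) = 1"
proof -
  let ?n = "length is"
  let ?g = "\<lambda>\<sigma>. of_int (sign \<sigma>) * (\<Prod>a<?n. (map (\<lambda>i. axis i 1) is ! \<sigma> a) $ (is ! a)) :: real"
  have z: "?g \<sigma> = 0" if s: "\<sigma> permutes {..<?n}" "\<sigma> \<noteq> id" for \<sigma>
  proof -
    obtain a where a: "\<sigma> a \<noteq> a" using s(2) by (auto simp: fun_eq_iff)
    then have an: "a < ?n" using s(1) by (metis lessThan_iff permutes_not_in)
    then have sn: "\<sigma> a < ?n" using s(1) by (metis lessThan_iff permutes_in_image)
    have "is ! \<sigma> a \<noteq> is ! a" using a an sn assms by (simp add: nth_eq_iff_index_eq)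
    then have "(map (\<lambda>i. axis i 1) is ! \<sigma> a) $ (is ! a) = (0::real)"
      using sn by (simp add: axis_def)
    then have "(\<Prod>a<?n. (map (\<lambda>i. axis i 1) is ! \<sigma> a) $ (is ! a)) = (0::real)"
      using an by (intro prod_zero) auto
    then show ?thesis by simp
  qed
  have "ewedge is (map (\<lambda>i. axis i 1) is) = (\<Sum>\<sigma>\<in>{\<sigma>. \<sigma> permutes {..<?n}}. ?g \<sigma>)"
    by (simp add: ewedge_def)
  also have "\<dots> = (\<Sum>\<sigma>\<in>{id}. ?g \<sigma>)"
  proof (rule sum.mono_neutral_right)
    show "\<forall>\<sigma>\<in>{\<sigma>. \<sigma> permutes {..<?n}} - {id}. ?g \<sigma> = 0" using z by blast
  qed (simp_all add: finite_permutations permutes_id)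
  also have "\<dots> = 1" by simp
  finally show ?thesis .
qed

text \<open>Exchanging two equal entries fixes the list but changes the sign of the value. A list of
  the wrong length gives 0 by convention.\<close>

lemma ewedge_axis_not_distinct:
  assumes "\<not> distinct js"
  shows "ewedge is (map (\<lambda>i. axis i 1) js) = 0"
proof (cases "length js = length is")
  case True
  obtain i j where ij: "i < length js" "j < length js" "i \<noteq> j" "js ! i = js ! j"
    using assms by (auto simp: distinct_conv_nth)
  let ?t = "Transposition.transpose i j"
  have p: "?t permutes {..<length is}" using ij True by (intro permutes_swap_id) auto
  have "permute_list ?t (map (\<lambda>i. axis i 1) js) = map (\<lambda>i. axis i (1::real)) js"
    using ij p True by (intro nth_equalityI) (auto simp: permute_list_nth Transposition.transpose_def)
  then have "ewedge is (map (\<lambda>i. axis i 1) js) = - ewedge is (map (\<lambda>i. axis i 1) js)"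
    using ewedge_permute_list[OF p, of "map (\<lambda>i. axis i 1) js"] True ij by (simp add: sign_swap_id)
  then show ?thesis by simp
qed (simp add: ewedge_def)

text \<open>Cofactor expansion of a 4 by 4 determinant along \<open>v\<close>. It replaces the sum
  over permutations by a polynomial in coordinates, so that values of \<open>spin7_form\<close> on
  basis vectors can be computed.\<close>

lemma ewedge4:
  "ewedge [i,j,k,l] [v,w,x,y] =
     v$i * (w$j * (x$k * y$l - x$l * y$k) - w$k * (x$j * y$l - x$l * y$j) + w$l * (x$j * y$k - x$k * y$j))
   - v$j * (w$i * (x$k * y$l - x$l * y$k) - w$k * (x$i * y$l - x$l * y$i) + w$l * (x$i * y$k - x$k * y$i))
   + v$k * (w$i * (x$j * y$l - x$l * y$j) - w$j * (x$i * y$l - x$l * y$i) + w$l * (x$i * y$j - x$j * y$i))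
   - v$l * (w$i * (x$j * y$k - x$k * y$j) - w$j * (x$i * y$k - x$k * y$i) + w$k * (x$i * y$j - x$j * y$i))"
proof -
  have s: "{..<4::nat} = {0,1,2,3}" by auto
  have f: "finite {1::nat,2,3}" "0 \<notin> {1::nat,2,3}" "finite {2::nat,3}" "1 \<notin> {2::nat,3}"
    "finite {3::nat}" "2 \<notin> {3::nat}" by auto
  have l: "length [v,w,x,y] = length [i,j,k,l]" "length [i,j,k,l] = 4" by simp_all
  have *: "ewedge [i,j,k,l] [v,w,x,y] = (\<Sum>\<sigma> | \<sigma> permutes {0,1,2,3}.
        of_int (sign \<sigma>) * ([v,w,x,y] ! \<sigma> 0 $ i * [v,w,x,y] ! \<sigma> 1 $ j * [v,w,x,y] ! \<sigma> 2 $ k * [v,w,x,y] ! \<sigma> 3 $ l))"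
    unfolding ewedge_def if_P[OF l(1)] l(2) s by (simp add: mult.assoc)
  show ?thesis
    unfolding * sum_over_permutations_insert[OF f(1,2)] sum_over_permutations_insert[OF f(3,4)]
      sum_over_permutations_insert[OF f(5,6)] permutes_sing
    by (simp add: sign_swap_id sign_compose permutation_compose permutation_swap_id
        Transposition.transpose_def) algebra
qed

text \<open>By induction on \<open>xs\<close>: its head is carried to the front of \<open>ys\<close>
  by neighbour swaps and then joins the fixed prefix \<open>zs\<close>. The intended
  \<open>f\<close> is a product of two alternating functions, whose signs cancel.\<close>

lemma adjacent_swap_invariant:
  assumes "\<And>xs a b ys. length xs + length ys + 2 = n \<Longrightarrow> f (xs @ a # b # ys) = f (xs @ b # a # ys)"
    and "mset xs = mset ys" "length zs + length xs = n"
  shows "f (zs @ xs) = f (zs @ ys)"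
  using assms(2,3)
proof (induction xs arbitrary: ys zs)
  case Nil
  then show ?case by simp
next
  case (Cons x xs)
  have "x \<in> set ys" using Cons.prems(1) by (metis list.set_intros(1) set_mset_mset)
  then obtain ps qs where ys: "ys = ps @ x # qs" by (meson split_list)
  have m: "mset xs = mset (ps @ qs)" using Cons.prems(1) ys by simp
  have mv: "f (as @ ps @ x # qs) = f (as @ x # ps @ qs)" if "length as + length ps + 1 + length qs = n" for as
    using that
  proof (induction ps arbitrary: as)
    case (Cons p ps)
    have "f (as @ p # ps @ x # qs) = f ((as @ [p]) @ ps @ x # qs)" by simp
    also have "\<dots> = f ((as @ [p]) @ x # ps @ qs)" using Cons.prems by (intro Cons.IH) simp
    also have "\<dots> = f (as @ p # x # (ps @ qs))" by simp
    also have "\<dots> = f (as @ x # p # (ps @ qs))" using Cons.prems by (intro assms(1)) simp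
    finally show ?case by simp
  qed simp
  have "f (zs @ x # xs) = f ((zs @ [x]) @ xs)" by simp
  also have "\<dots> = f ((zs @ [x]) @ ps @ qs)" using Cons.prems m by (intro Cons.IH) auto
  also have "\<dots> = f (zs @ ys)"
    using mv[of zs] Cons.prems ys mset_eq_length[OF Cons.prems(1)] by simp
  finally show ?case by simp
qed

text \<open>A summand vanishes unless its indices are an ordering of the complement of
  \<open>K\<close>, because otherwise the volume form sees a repeated index. The k! orderings of
  \<open>J\<close> contribute equally, both factors changing sign together, and this cancels the
  \<open>fact k\<close> of the definition.\<close>

lemma hodge_std_axis:
  assumes alt: "adjacent_alternating k \<alpha>"
    and J: "length J = k" "distinct J" and K: "length K = 8 - k" "set J \<inter> set K = {}" "distinct K" "k \<le> 8"
  shows "hodge_std k \<alpha> (map (\<lambda>i. axis i 1) K) =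
     \<alpha> (map (\<lambda>i. axis i 1) J) * ewedge [0,1,2,3,4,5,6,7] (map (\<lambda>i. axis i 1) (J @ K))"
proof -
  let ?e = "map (\<lambda>i. axis i 1) :: 8 list \<Rightarrow> (real^8) list"
  let ?w = "ewedge [0,1,2,3,4,5,6,7]"
  let ?f = "\<lambda>is. \<alpha> (?e is) * ?w (?e is @ ?e K)"
  have walt: "adjacent_alternating 8 ?w" by (rule ewedge_alternating) simp
  have UK: "- set K = set J"
  proof -
    have "card (set J \<union> set K) = card (UNIV :: 8 set)"
      using J K by (simp add: card_Un_disjoint distinct_card)
    then have "set J \<union> set K = UNIV" by (metis card_subset_eq finite subset_UNIV)
    then show ?thesis using K(2) by auto
  qed
  have z: "?f is = 0" if "length is = k" "is \<notin> permutations_of_set (set J)" for "is"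
  proof -
    have "\<not> distinct (is @ K)"
    proof
      assume d: "distinct (is @ K)"
      then have "set is \<subseteq> set J" using UK by auto
      then have "set is = set J" using d that J
        by (metis card_subset_eq distinct_append distinct_card List.finite_set)
      then show False using that d by (auto simp: permutations_of_set_def)
    qed
    from ewedge_axis_not_distinct[OF this] show ?thesis by simp
  qed
  have e: "?f is = ?f J" if "is \<in> permutations_of_set (set J)" for "is"
  proof -
    have d: "distinct is" "set is = set J" using that by (auto simp: permutations_of_set_def)
    have m: "mset is = mset J" using d J by (metis set_eq_iff_mset_eq_distinct)
    have "?f ([] @ is) = ?f ([] @ J)"
    proof (rule adjacent_swap_invariant[where n = k])
      fix xs ys :: "8 list" and a b assume l: "length xs + length ys + 2 = k"
      have "\<alpha> (?e xs @ axis a 1 # axis b 1 # ?e ys) = - \<alpha> (?e xs @ axis b 1 # axis a 1 # ?e ys)"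
        using l by (intro adjacent_alternatingD[OF alt]) simp
      moreover have "?w (?e xs @ axis a 1 # axis b 1 # (?e ys @ ?e K)) =
          - ?w (?e xs @ axis b 1 # axis a 1 # (?e ys @ ?e K))"
        using l K by (intro adjacent_alternatingD[OF walt]) simp
      ultimately show "?f (xs @ a # b # ys) = ?f (xs @ b # a # ys)" by simp
    qed (use m J in \<open>auto dest: mset_eq_length\<close>)
    then show ?thesis by simp
  qed
  have fin: "finite {is :: 8 list. length is = k}"
    using finite_lists_length_eq[of "UNIV :: 8 set" k] by simp
  have "(\<Sum>is | length is = k. ?f is) = (\<Sum>is\<in>permutations_of_set (set J). ?f is)"
  proof (rule sum.mono_neutral_right[OF fin])
    show "permutations_of_set (set J) \<subseteq> {is. length is = k}"
      using J by (auto simp: permutations_of_set_def distinct_card[symmetric])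
    show "\<forall>i\<in>{is. length is = k} - permutations_of_set (set J). ?f i = 0"
      using z by blast
  qed
  also have "\<dots> = (\<Sum>is\<in>permutations_of_set (set J). ?f J)" using e by (intro sum.cong) auto
  also have "\<dots> = fact k * ?f J" using J by (simp add: distinct_card)
  finally show ?thesis by (simp add: hodge_std_def Let_def)
qed

section \<open>Signs of permutations by insertion sort\<close>

primrec inversions :: "nat list \<Rightarrow> nat" where
  "inversions [] = 0"
| "inversions (x # xs) = length (filter (\<lambda>y. y < x) xs) + inversions xs"

text \<open>Insertion moves \<open>x\<close> past exactly the entries smaller than it, each passage
  costing one sign. The map \<open>h\<close> lets keys be sorted while \<beta> sees their
  images.\<close>

lemma alternating_insort:
  assumes "adjacent_alternating n \<beta>" "length zs + length xs + 1 = n" "sorted xs"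
  shows "\<beta> (map h (zs @ x # xs)) = (-1) ^ length (filter (\<lambda>y. y < x) xs) * \<beta> (map h (zs @ insort x xs))"
  using assms(2,3)
proof (induction xs arbitrary: zs)
  case (Cons y ys)
  show ?case
  proof (cases "x \<le> y")
    case True
    then have "filter (\<lambda>z. z < x) (y # ys) = []" using Cons.prems by (auto simp: filter_empty_conv)
    then show ?thesis using True by simp
  next
    case False
    have "\<beta> (map h (zs @ x # y # ys)) = - \<beta> (map h (zs @ y # x # ys))"
      using adjacent_alternatingD[OF assms(1), of "map h zs" "map h ys" "h x" "h y"] Cons.prems by simp
    also have "\<beta> (map h (zs @ y # x # ys)) = \<beta> (map h ((zs @ [y]) @ x # ys))" by simp
    also have "\<dots> = (-1) ^ length (filter (\<lambda>y. y < x) ys) * \<beta> (map h ((zs @ [y]) @ insort x ys))"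
      using Cons.prems by (intro Cons.IH) auto
    finally show ?thesis using False by simp
  qed
qed simp

lemma alternating_sort:
  assumes "adjacent_alternating n \<beta>" "length zs + length xs = n"
  shows "\<beta> (map h (zs @ xs)) = (-1) ^ inversions xs * \<beta> (map h (zs @ sort xs))"
  using assms(2)
proof (induction xs arbitrary: zs)
  case (Cons x xs)
  have "\<beta> (map h (zs @ x # xs)) = \<beta> (map h ((zs @ [x]) @ xs))" by simp
  also have "\<dots> = (-1) ^ inversions xs * \<beta> (map h ((zs @ [x]) @ sort xs))"
    using Cons.prems by (intro Cons.IH) auto
  also have "\<beta> (map h ((zs @ [x]) @ sort xs)) = \<beta> (map h (zs @ x # sort xs))" by simp
  also have "\<dots> = (-1) ^ length (filter (\<lambda>y. y < x) (sort xs)) * \<beta> (map h (zs @ insort x (sort xs)))"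
    using Cons.prems by (intro alternating_insort[OF assms(1)]) auto
  also have "length (filter (\<lambda>y. y < x) (sort xs)) = length (filter (\<lambda>y. y < x) xs)"
    by (metis mset_filter mset_sort size_mset)
  finally show ?case by (simp add: power_add)
qed simp

text \<open>The indices are natural numbers so that \<open>sort\<close> and
  \<open>inversions\<close> can be evaluated on literals; \<open>of_nat\<close> carries the result
  to the index type \<open>8\<close>.\<close>

lemma ewedge_8_sort:
  assumes "sort ns = [0,1,2,3,4,5,6,7]" "length ns = 8"
  shows "ewedge [0,1,2,3,4,5,6,7] (map (\<lambda>i. axis i 1) (map of_nat ns)) = (-1) ^ inversions ns"
proof -
  have "ewedge [0,1,2,3,4,5,6,7] (map (\<lambda>i. axis (of_nat i) 1) ([] @ ns)) = (-1) ^ inversions ns *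
      ewedge [0,1,2,3,4,5,6,7] (map (\<lambda>i. axis (of_nat i) 1) ([] @ sort ns))"
    using assms by (intro alternating_sort[where n = 8] ewedge_alternating) auto
  also have "map (\<lambda>i. axis (of_nat i) 1) ([] @ sort ns) =
      (map (\<lambda>i. axis i 1) [0,1,2,3,4,5,6,7] :: (real^8) list)"
    by (simp add: assms)
  also have "ewedge [0,1,2,3,4,5,6,7] \<dots> = 1" by (rule ewedge_self) simp
  finally show ?thesis by (simp add: o_def)
qed

section \<open>The equations in an adapted frame\<close>

lemma distinct_8: "distinct [0::8,1,2,3,4,5,6,7]" by simp
lemma sum_8: "sum f (UNIV :: 8 set) = f 0 + (f 1 + (f 2 + (f 3 + (f 4 + (f 5 + (f 6 + (f 7 :: 'a :: comm_monoid_add)))))))"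
proof -
  have "sum f (UNIV :: 8 set) = sum f (set [0,1,2,3,4,5,6,7])" unfolding UNIV_8 by simp
  also have "\<dots> = sum_list (map f [0,1,2,3,4,5,6,7])" by (rule sum.distinct_set_conv_list[OF distinct_8])
  finally show ?thesis by (simp only: list.map sum_list.Cons sum_list.Nil add_0_right)
qed

abbreviation ax :: "8 \<Rightarrow> real^8" where "ax i \<equiv> axis i 1"

lemma axis_8:
  "ax 0 $ 0 = 1" "ax 0 $ 1 = 0" "ax 0 $ 2 = 0" "ax 0 $ 3 = 0" "ax 0 $ 4 = 0" "ax 0 $ 5 = 0" "ax 0 $ 6 = 0" "ax 0 $ 7 = 0"
  "ax 1 $ 0 = 0" "ax 1 $ 1 = 1" "ax 1 $ 2 = 0" "ax 1 $ 3 = 0" "ax 1 $ 4 = 0" "ax 1 $ 5 = 0" "ax 1 $ 6 = 0" "ax 1 $ 7 = 0"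
  "ax 2 $ 0 = 0" "ax 2 $ 1 = 0" "ax 2 $ 2 = 1" "ax 2 $ 3 = 0" "ax 2 $ 4 = 0" "ax 2 $ 5 = 0" "ax 2 $ 6 = 0" "ax 2 $ 7 = 0"
  "ax 3 $ 0 = 0" "ax 3 $ 1 = 0" "ax 3 $ 2 = 0" "ax 3 $ 3 = 1" "ax 3 $ 4 = 0" "ax 3 $ 5 = 0" "ax 3 $ 6 = 0" "ax 3 $ 7 = 0"
  "ax 4 $ 0 = 0" "ax 4 $ 1 = 0" "ax 4 $ 2 = 0" "ax 4 $ 3 = 0" "ax 4 $ 4 = 1" "ax 4 $ 5 = 0" "ax 4 $ 6 = 0" "ax 4 $ 7 = 0"
  "ax 5 $ 0 = 0" "ax 5 $ 1 = 0" "ax 5 $ 2 = 0" "ax 5 $ 3 = 0" "ax 5 $ 4 = 0" "ax 5 $ 5 = 1" "ax 5 $ 6 = 0" "ax 5 $ 7 = 0"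
  "ax 6 $ 0 = 0" "ax 6 $ 1 = 0" "ax 6 $ 2 = 0" "ax 6 $ 3 = 0" "ax 6 $ 4 = 0" "ax 6 $ 5 = 0" "ax 6 $ 6 = 1" "ax 6 $ 7 = 0"
  "ax 7 $ 0 = 0" "ax 7 $ 1 = 0" "ax 7 $ 2 = 0" "ax 7 $ 3 = 0" "ax 7 $ 4 = 0" "ax 7 $ 5 = 0" "ax 7 $ 6 = 0" "ax 7 $ 7 = 1"
  by (simp_all add: axis_def)

text \<open>The 14 blocks of the form, with four triples each, contain every one of the 56 triples
  of indices once. So fixing three basis vectors leaves a single coordinate of \<open>v\<close>, up
  to sign.\<close>

lemma spin7_form_axis:
  fixes v :: "real^8"
  shows
    "spin7_form [v, ax 0, ax 1, ax 2] = - v $ 3"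
    "spin7_form [v, ax 0, ax 1, ax 3] = v $ 2"
    "spin7_form [v, ax 0, ax 1, ax 4] = v $ 5"
    "spin7_form [v, ax 0, ax 1, ax 5] = - v $ 4"
    "spin7_form [v, ax 0, ax 1, ax 6] = v $ 7"
    "spin7_form [v, ax 0, ax 1, ax 7] = - v $ 6"
    "spin7_form [v, ax 0, ax 2, ax 3] = - v $ 1"
    "spin7_form [v, ax 0, ax 2, ax 4] = v $ 6"
    "spin7_form [v, ax 0, ax 2, ax 5] = - v $ 7"
    "spin7_form [v, ax 0, ax 2, ax 6] = - v $ 4"
    "spin7_form [v, ax 0, ax 2, ax 7] = v $ 5"
    "spin7_form [v, ax 0, ax 3, ax 4] = v $ 7"
    "spin7_form [v, ax 0, ax 3, ax 5] = v $ 6"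
    "spin7_form [v, ax 0, ax 3, ax 6] = - v $ 5"
    "spin7_form [v, ax 0, ax 3, ax 7] = - v $ 4"
    "spin7_form [v, ax 0, ax 4, ax 5] = v $ 1"
    "spin7_form [v, ax 0, ax 4, ax 6] = v $ 2"
    "spin7_form [v, ax 0, ax 4, ax 7] = v $ 3"
    "spin7_form [v, ax 0, ax 5, ax 6] = v $ 3"
    "spin7_form [v, ax 0, ax 5, ax 7] = - v $ 2"
    "spin7_form [v, ax 0, ax 6, ax 7] = v $ 1"
    "spin7_form [v, ax 1, ax 2, ax 3] = v $ 0"
    "spin7_form [v, ax 1, ax 2, ax 4] = v $ 7"
    "spin7_form [v, ax 1, ax 2, ax 5] = v $ 6"
    "spin7_form [v, ax 1, ax 2, ax 6] = - v $ 5"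
    "spin7_form [v, ax 1, ax 2, ax 7] = - v $ 4"
    "spin7_form [v, ax 1, ax 3, ax 4] = - v $ 6"
    "spin7_form [v, ax 1, ax 3, ax 5] = v $ 7"
    "spin7_form [v, ax 1, ax 3, ax 6] = v $ 4"
    "spin7_form [v, ax 1, ax 3, ax 7] = - v $ 5"
    "spin7_form [v, ax 1, ax 4, ax 5] = - v $ 0"
    "spin7_form [v, ax 1, ax 4, ax 6] = - v $ 3"
    "spin7_form [v, ax 1, ax 4, ax 7] = v $ 2"
    "spin7_form [v, ax 1, ax 5, ax 6] = v $ 2"
    "spin7_form [v, ax 1, ax 5, ax 7] = v $ 3"
    "spin7_form [v, ax 1, ax 6, ax 7] = - v $ 0"
    "spin7_form [v, ax 2, ax 3, ax 4] = v $ 5"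
    "spin7_form [v, ax 2, ax 3, ax 5] = - v $ 4"
    "spin7_form [v, ax 2, ax 3, ax 6] = v $ 7"
    "spin7_form [v, ax 2, ax 3, ax 7] = - v $ 6"
    "spin7_form [v, ax 2, ax 4, ax 5] = v $ 3"
    "spin7_form [v, ax 2, ax 4, ax 6] = - v $ 0"
    "spin7_form [v, ax 2, ax 4, ax 7] = - v $ 1"
    "spin7_form [v, ax 2, ax 5, ax 6] = - v $ 1"
    "spin7_form [v, ax 2, ax 5, ax 7] = v $ 0"
    "spin7_form [v, ax 2, ax 6, ax 7] = v $ 3"
    "spin7_form [v, ax 3, ax 4, ax 5] = - v $ 2"
    "spin7_form [v, ax 3, ax 4, ax 6] = v $ 1"
    "spin7_form [v, ax 3, ax 4, ax 7] = - v $ 0"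
    "spin7_form [v, ax 3, ax 5, ax 6] = - v $ 0"
    "spin7_form [v, ax 3, ax 5, ax 7] = - v $ 1"
    "spin7_form [v, ax 3, ax 6, ax 7] = - v $ 2"
    "spin7_form [v, ax 4, ax 5, ax 6] = - v $ 7"
    "spin7_form [v, ax 4, ax 5, ax 7] = v $ 6"
    "spin7_form [v, ax 4, ax 6, ax 7] = - v $ 5"
    "spin7_form [v, ax 5, ax 6, ax 7] = v $ 4"
  by (simp_all add: spin7_form_def ewedge4 axis_8)

lemma spin7_form_alternating: "adjacent_alternating 4 spin7_form"
  unfolding adjacent_alternating_def
proof (intro allI impI)
  fix xs ys :: "(real^8) list" and a b :: "real^8"
  assume l: "length xs + length ys + 2 = 4"
  have *: "ewedge [i,j,k,l] (xs @ a # b # ys) = - ewedge [i,j,k,l] (xs @ b # a # ys)" for i j k l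
    using l by (intro adjacent_alternatingD[OF ewedge_alternating]) auto
  show "spin7_form (xs @ a # b # ys) = - spin7_form (xs @ b # a # ys)"
    unfolding spin7_form_def using
      *[of 0 1 2 3] *[of 0 1 4 5] *[of 0 1 6 7] *[of 0 2 4 6] *[of 0 2 5 7]
      *[of 0 3 4 7] *[of 0 3 5 6] *[of 4 5 6 7] *[of 2 3 6 7] *[of 2 3 4 5]
      *[of 1 3 5 7] *[of 1 3 4 6] *[of 1 2 5 6] *[of 1 2 4 7] by linarith
qed

section \<open>Endomorphisms acting on the Cayley form\<close>

lemma spin7_form_swap:
  "spin7_form [b,a,c,d] = - spin7_form [a,b,c,d]"
  "spin7_form [a,c,b,d] = - spin7_form [a,b,c,d]"
  "spin7_form [a,b,d,c] = - spin7_form [a,b,c,d]"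
  using adjacent_alternatingD[OF spin7_form_alternating, of "[]" "[c,d]" b a]
    adjacent_alternatingD[OF spin7_form_alternating, of "[a]" "[d]" c b]
    adjacent_alternatingD[OF spin7_form_alternating, of "[a,b]" "[]" d c] by simp_all

text \<open>The derivation extension of \<open>D\<close> to 4-forms, evaluated on four vectors. It
  is D \<cdot> \<Omega> of the overview; with its plus signs it is minus the natural action of an
  endomorphism on forms.\<close>

definition derivation4 :: "('v \<Rightarrow> 'v) \<Rightarrow> ('v list \<Rightarrow> real) \<Rightarrow> 'v \<Rightarrow> 'v \<Rightarrow> 'v \<Rightarrow> 'v \<Rightarrow> real" where
  "derivation4 D \<omega> a b c d = \<omega> [D a,b,c,d] + \<omega> [a,D b,c,d] + \<omega> [a,b,D c,d] + \<omega> [a,b,c,D d]"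

text \<open>Each argument hit by \<open>D\<close> is brought to the first slot, the one for which
  \<open>spin7_form_axis\<close> is tabulated.\<close>

lemma derivation4_spin7_form:
  "derivation4 D spin7_form a b c d = spin7_form [D a,b,c,d] - spin7_form [D b,a,c,d]
     + spin7_form [D c,a,b,d] - spin7_form [D d,a,b,c]"
  unfolding derivation4_def
  using spin7_form_swap(1)[of "D b" a c d] spin7_form_swap(1)[of "D c" a b d]
    spin7_form_swap(2)[of a "D c" b d] spin7_form_swap(1)[of "D d" a b c]
    spin7_form_swap(2)[of a "D d" b c] spin7_form_swap(3)[of a b "D d" c]
  by simp

lemma derivation4_spin7_form_swap:
  "derivation4 D spin7_form b a c d = - derivation4 D spin7_form a b c d"
  "derivation4 D spin7_form a c b d = - derivation4 D spin7_form a b c d"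
  "derivation4 D spin7_form a b d c = - derivation4 D spin7_form a b c d"
proof -
  show "derivation4 D spin7_form b a c d = - derivation4 D spin7_form a b c d"
    unfolding derivation4_def
    using spin7_form_swap(1)[of "D a" b c d] spin7_form_swap(1)[of a "D b" c d]
      spin7_form_swap(1)[of a b "D c" d] spin7_form_swap(1)[of a b c "D d"] by simp
  show "derivation4 D spin7_form a c b d = - derivation4 D spin7_form a b c d"
    unfolding derivation4_def
    using spin7_form_swap(2)[of "D a" b c d] spin7_form_swap(2)[of a "D b" c d]
      spin7_form_swap(2)[of a b "D c" d] spin7_form_swap(2)[of a b c "D d"] by simp
  show "derivation4 D spin7_form a b d c = - derivation4 D spin7_form a b c d"
    unfolding derivation4_def
    using spin7_form_swap(3)[of "D a" b c d] spin7_form_swap(3)[of a "D b" c d]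
      spin7_form_swap(3)[of a b "D c" d] spin7_form_swap(3)[of a b c "D d"] by simp
qed


text \<open>The frame components of \<open>d\<Omega> = - n \<and> (D \<cdot> \<Omega>)\<close>, with \<open>\<star>d\<Omega> = i(t)\<Omega>\<close>, read
  \<open>t \<and> \<Omega> = - n \<and> (D \<cdot> \<Omega>)\<close>, since every triple of indices lies in exactly one block of \<open>\<Omega>\<close>.\<close>

locale spin7_frame_equations =
  fixes n t :: "real^8" and D :: "real^8 \<Rightarrow> real^8" and \<alpha> :: "(real^8) list \<Rightarrow> real"
  assumes \<alpha>: "\<And>a b c d e. \<alpha> [a,b,c,d,e] = - ((n \<bullet> a) * derivation4 D spin7_form b c d e
        - (n \<bullet> b) * derivation4 D spin7_form a c d e + (n \<bullet> c) * derivation4 D spin7_form a b d e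
        - (n \<bullet> d) * derivation4 D spin7_form a b c e + (n \<bullet> e) * derivation4 D spin7_form a b c d)"
    and hodge: "\<And>a b c. hodge_std 5 \<alpha> [axis a 1, axis b 1, axis c 1] =
        spin7_form [t, axis a 1, axis b 1, axis c 1]"
begin

lemma alternating: "adjacent_alternating 5 \<alpha>"
  unfolding adjacent_alternating_def
proof (intro allI impI)
  fix xs ys :: "(real^8) list" and a b
  assume l: "length xs + length ys + 2 = 5"
  \<comment> \<open>One identity for each neighbouring position among five arguments: the two terms
    in which \<open>n\<close> meets a swapped vector change places, the other three change sign
    through \<open>derivation4_spin7_form_swap\<close>.\<close>
  have s: "\<alpha> [b,a,c,d,e] = - \<alpha> [a,b,c,d,e]" "\<alpha> [a,c,b,d,e] = - \<alpha> [a,b,c,d,e]"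
     "\<alpha> [a,b,d,c,e] = - \<alpha> [a,b,c,d,e]" "\<alpha> [a,b,c,e,d] = - \<alpha> [a,b,c,d,e]" for a b c d e
    unfolding \<alpha>
    using derivation4_spin7_form_swap(1)[of D a b d e] derivation4_spin7_form_swap(1)[of D a b c e]
      derivation4_spin7_form_swap(1)[of D a b c d] derivation4_spin7_form_swap(1)[of D b c d e]
      derivation4_spin7_form_swap(2)[of D a b c e] derivation4_spin7_form_swap(2)[of D a b c d]
      derivation4_spin7_form_swap(2)[of D b c d e] derivation4_spin7_form_swap(2)[of D a c d e]
      derivation4_spin7_form_swap(3)[of D b c d e] derivation4_spin7_form_swap(3)[of D a c d e]
      derivation4_spin7_form_swap(3)[of D a b d e] derivation4_spin7_form_swap(3)[of D a b c d]
    by (simp_all add: algebra_simps)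
  have "length xs < 4" using l by simp
  then consider "length xs = 0" | "length xs = 1" | "length xs = 2" | "length xs = 3" by linarith
  then show "\<alpha> (xs @ a # b # ys) = - \<alpha> (xs @ b # a # ys)"
    using l by cases (auto simp: length_Suc_conv numeral_2_eq_2 numeral_3_eq_3 s(1)[of a b] s(2)[of _ a b] s(3)[of _ _ a b] s(4)[of _ _ _ a b])
qed

text \<open>The list splits the eight indices into five and three, so \<open>hodge_std_axis\<close>
  reduces the Hodge star at the triple to one component of \<alpha>. The sign of the ordering passes
  to the other side since its square is 1.\<close>

lemma component:
  assumes "sort (js @ [p,q,r]) = [0,1,2,3,4,5,6,7]"
  shows "\<alpha> (map (\<lambda>i. axis (of_nat i) 1) js) = (-1) ^ inversions (js @ [p,q,r]) *
      spin7_form [t, axis (of_nat p) 1, axis (of_nat q) 1, axis (of_nat r) 1]"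
proof -
  let ?ns = "js @ [p,q,r]"
  have len: "length ?ns = 8" using arg_cong[OF assms, of length] by simp
  have m: "mset ?ns = mset [0,1,2,3,4,5,6,7]" using arg_cong[OF assms, of mset] unfolding mset_sort .
  then have "mset (map of_nat ?ns :: 8 list) = mset (map of_nat [0::nat,1,2,3,4,5,6,7])"
    unfolding mset_map by simp
  then have "distinct (map of_nat ?ns :: 8 list) = distinct (map of_nat [0::nat,1,2,3,4,5,6,7] :: 8 list)"
    by (rule mset_eq_imp_distinct_iff)
  then have d: "distinct (map of_nat js @ map of_nat [p,q,r] :: 8 list)" by simp
  let ?J = "map of_nat js :: 8 list" and ?K = "map of_nat [p,q,r] :: 8 list"
  have "hodge_std 5 \<alpha> (map (\<lambda>i. axis i 1) ?K) =
     \<alpha> (map (\<lambda>i. axis i 1) ?J) * ewedge [0,1,2,3,4,5,6,7] (map (\<lambda>i. axis i 1) (?J @ ?K))"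
    using d len by (intro hodge_std_axis alternating) auto
  also have "?J @ ?K = map of_nat ?ns" by simp
  also have "ewedge [0,1,2,3,4,5,6,7] (map (\<lambda>i. axis i 1) (map of_nat ?ns :: 8 list)) = (-1) ^ inversions ?ns"
    using assms len by (rule ewedge_8_sort)
  finally have "spin7_form [t, axis (of_nat p) 1, axis (of_nat q) 1, axis (of_nat r) 1] =
      \<alpha> (map (\<lambda>i. axis (of_nat i) 1) js) * (-1) ^ inversions ?ns"
    by (simp add: hodge o_def)
  then have "(-1) ^ inversions ?ns * spin7_form [t, axis (of_nat p) 1, axis (of_nat q) 1, axis (of_nat r) 1] =
      \<alpha> (map (\<lambda>i. axis (of_nat i) 1) js) * ((-1) ^ inversions ?ns * (-1) ^ inversions ?ns)"
    by (simp add: mult_ac)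
  also have "(-1) ^ inversions ?ns * (-1) ^ inversions ?ns = (1::real)"
    by (simp flip: power_add)
  finally show ?thesis by simp
qed

definition B :: "8 \<Rightarrow> 8 \<Rightarrow> 8 \<Rightarrow> 8 \<Rightarrow> real" where
  "B a b c d = derivation4 D spin7_form (axis a 1) (axis b 1) (axis c 1) (axis d 1)"

text \<open>One equation for each of the 56 triples p < q < r, in lexicographic order. On the left
  stands the coordinate of \<open>t\<close> that completes the triple to a block, on the right, up
  to sign, the component of n \<and> (D \<cdot> \<Omega>) on the other five indices.\<close>

lemma components:
  "t$3 = - n$3 * B 4 5 6 7 + n$4 * B 3 5 6 7 - n$5 * B 3 4 6 7 + n$6 * B 3 4 5 7 - n$7 * B 3 4 5 6"
  "t$2 = - n$2 * B 4 5 6 7 + n$4 * B 2 5 6 7 - n$5 * B 2 4 6 7 + n$6 * B 2 4 5 7 - n$7 * B 2 4 5 6"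
  "t$5 = n$2 * B 3 5 6 7 - n$3 * B 2 5 6 7 + n$5 * B 2 3 6 7 - n$6 * B 2 3 5 7 + n$7 * B 2 3 5 6"
  "t$4 = n$2 * B 3 4 6 7 - n$3 * B 2 4 6 7 + n$4 * B 2 3 6 7 - n$6 * B 2 3 4 7 + n$7 * B 2 3 4 6"
  "t$7 = n$2 * B 3 4 5 7 - n$3 * B 2 4 5 7 + n$4 * B 2 3 5 7 - n$5 * B 2 3 4 7 + n$7 * B 2 3 4 5"
  "t$6 = n$2 * B 3 4 5 6 - n$3 * B 2 4 5 6 + n$4 * B 2 3 5 6 - n$5 * B 2 3 4 6 + n$6 * B 2 3 4 5"
  "t$1 = - n$1 * B 4 5 6 7 + n$4 * B 1 5 6 7 - n$5 * B 1 4 6 7 + n$6 * B 1 4 5 7 - n$7 * B 1 4 5 6"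
  "t$6 = - n$1 * B 3 5 6 7 + n$3 * B 1 5 6 7 - n$5 * B 1 3 6 7 + n$6 * B 1 3 5 7 - n$7 * B 1 3 5 6"
  "t$7 = - n$1 * B 3 4 6 7 + n$3 * B 1 4 6 7 - n$4 * B 1 3 6 7 + n$6 * B 1 3 4 7 - n$7 * B 1 3 4 6"
  "t$4 = n$1 * B 3 4 5 7 - n$3 * B 1 4 5 7 + n$4 * B 1 3 5 7 - n$5 * B 1 3 4 7 + n$7 * B 1 3 4 5"
  "t$5 = n$1 * B 3 4 5 6 - n$3 * B 1 4 5 6 + n$4 * B 1 3 5 6 - n$5 * B 1 3 4 6 + n$6 * B 1 3 4 5"
  "t$7 = n$1 * B 2 5 6 7 - n$2 * B 1 5 6 7 + n$5 * B 1 2 6 7 - n$6 * B 1 2 5 7 + n$7 * B 1 2 5 6"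
  "t$6 = - n$1 * B 2 4 6 7 + n$2 * B 1 4 6 7 - n$4 * B 1 2 6 7 + n$6 * B 1 2 4 7 - n$7 * B 1 2 4 6"
  "t$5 = - n$1 * B 2 4 5 7 + n$2 * B 1 4 5 7 - n$4 * B 1 2 5 7 + n$5 * B 1 2 4 7 - n$7 * B 1 2 4 5"
  "t$4 = n$1 * B 2 4 5 6 - n$2 * B 1 4 5 6 + n$4 * B 1 2 5 6 - n$5 * B 1 2 4 6 + n$6 * B 1 2 4 5"
  "t$1 = n$1 * B 2 3 6 7 - n$2 * B 1 3 6 7 + n$3 * B 1 2 6 7 - n$6 * B 1 2 3 7 + n$7 * B 1 2 3 6"
  "t$2 = - n$1 * B 2 3 5 7 + n$2 * B 1 3 5 7 - n$3 * B 1 2 5 7 + n$5 * B 1 2 3 7 - n$7 * B 1 2 3 5"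
  "t$3 = n$1 * B 2 3 5 6 - n$2 * B 1 3 5 6 + n$3 * B 1 2 5 6 - n$5 * B 1 2 3 6 + n$6 * B 1 2 3 5"
  "t$3 = n$1 * B 2 3 4 7 - n$2 * B 1 3 4 7 + n$3 * B 1 2 4 7 - n$4 * B 1 2 3 7 + n$7 * B 1 2 3 4"
  "t$2 = n$1 * B 2 3 4 6 - n$2 * B 1 3 4 6 + n$3 * B 1 2 4 6 - n$4 * B 1 2 3 6 + n$6 * B 1 2 3 4"
  "t$1 = n$1 * B 2 3 4 5 - n$2 * B 1 3 4 5 + n$3 * B 1 2 4 5 - n$4 * B 1 2 3 5 + n$5 * B 1 2 3 4"
  "t$0 = - n$0 * B 4 5 6 7 + n$4 * B 0 5 6 7 - n$5 * B 0 4 6 7 + n$6 * B 0 4 5 7 - n$7 * B 0 4 5 6"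
  "t$7 = n$0 * B 3 5 6 7 - n$3 * B 0 5 6 7 + n$5 * B 0 3 6 7 - n$6 * B 0 3 5 7 + n$7 * B 0 3 5 6"
  "t$6 = - n$0 * B 3 4 6 7 + n$3 * B 0 4 6 7 - n$4 * B 0 3 6 7 + n$6 * B 0 3 4 7 - n$7 * B 0 3 4 6"
  "t$5 = - n$0 * B 3 4 5 7 + n$3 * B 0 4 5 7 - n$4 * B 0 3 5 7 + n$5 * B 0 3 4 7 - n$7 * B 0 3 4 5"
  "t$4 = n$0 * B 3 4 5 6 - n$3 * B 0 4 5 6 + n$4 * B 0 3 5 6 - n$5 * B 0 3 4 6 + n$6 * B 0 3 4 5"
  "t$6 = n$0 * B 2 5 6 7 - n$2 * B 0 5 6 7 + n$5 * B 0 2 6 7 - n$6 * B 0 2 5 7 + n$7 * B 0 2 5 6"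
  "t$7 = n$0 * B 2 4 6 7 - n$2 * B 0 4 6 7 + n$4 * B 0 2 6 7 - n$6 * B 0 2 4 7 + n$7 * B 0 2 4 6"
  "t$4 = - n$0 * B 2 4 5 7 + n$2 * B 0 4 5 7 - n$4 * B 0 2 5 7 + n$5 * B 0 2 4 7 - n$7 * B 0 2 4 5"
  "t$5 = - n$0 * B 2 4 5 6 + n$2 * B 0 4 5 6 - n$4 * B 0 2 5 6 + n$5 * B 0 2 4 6 - n$6 * B 0 2 4 5"
  "t$0 = n$0 * B 2 3 6 7 - n$2 * B 0 3 6 7 + n$3 * B 0 2 6 7 - n$6 * B 0 2 3 7 + n$7 * B 0 2 3 6"
  "t$3 = - n$0 * B 2 3 5 7 + n$2 * B 0 3 5 7 - n$3 * B 0 2 5 7 + n$5 * B 0 2 3 7 - n$7 * B 0 2 3 5"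
  "t$2 = - n$0 * B 2 3 5 6 + n$2 * B 0 3 5 6 - n$3 * B 0 2 5 6 + n$5 * B 0 2 3 6 - n$6 * B 0 2 3 5"
  "t$2 = - n$0 * B 2 3 4 7 + n$2 * B 0 3 4 7 - n$3 * B 0 2 4 7 + n$4 * B 0 2 3 7 - n$7 * B 0 2 3 4"
  "t$3 = n$0 * B 2 3 4 6 - n$2 * B 0 3 4 6 + n$3 * B 0 2 4 6 - n$4 * B 0 2 3 6 + n$6 * B 0 2 3 4"
  "t$0 = n$0 * B 2 3 4 5 - n$2 * B 0 3 4 5 + n$3 * B 0 2 4 5 - n$4 * B 0 2 3 5 + n$5 * B 0 2 3 4"
  "t$5 = n$0 * B 1 5 6 7 - n$1 * B 0 5 6 7 + n$5 * B 0 1 6 7 - n$6 * B 0 1 5 7 + n$7 * B 0 1 5 6"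
  "t$4 = n$0 * B 1 4 6 7 - n$1 * B 0 4 6 7 + n$4 * B 0 1 6 7 - n$6 * B 0 1 4 7 + n$7 * B 0 1 4 6"
  "t$7 = n$0 * B 1 4 5 7 - n$1 * B 0 4 5 7 + n$4 * B 0 1 5 7 - n$5 * B 0 1 4 7 + n$7 * B 0 1 4 5"
  "t$6 = n$0 * B 1 4 5 6 - n$1 * B 0 4 5 6 + n$4 * B 0 1 5 6 - n$5 * B 0 1 4 6 + n$6 * B 0 1 4 5"
  "t$3 = n$0 * B 1 3 6 7 - n$1 * B 0 3 6 7 + n$3 * B 0 1 6 7 - n$6 * B 0 1 3 7 + n$7 * B 0 1 3 6"
  "t$0 = n$0 * B 1 3 5 7 - n$1 * B 0 3 5 7 + n$3 * B 0 1 5 7 - n$5 * B 0 1 3 7 + n$7 * B 0 1 3 5"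
  "t$1 = - n$0 * B 1 3 5 6 + n$1 * B 0 3 5 6 - n$3 * B 0 1 5 6 + n$5 * B 0 1 3 6 - n$6 * B 0 1 3 5"
  "t$1 = - n$0 * B 1 3 4 7 + n$1 * B 0 3 4 7 - n$3 * B 0 1 4 7 + n$4 * B 0 1 3 7 - n$7 * B 0 1 3 4"
  "t$0 = - n$0 * B 1 3 4 6 + n$1 * B 0 3 4 6 - n$3 * B 0 1 4 6 + n$4 * B 0 1 3 6 - n$6 * B 0 1 3 4"
  "t$3 = n$0 * B 1 3 4 5 - n$1 * B 0 3 4 5 + n$3 * B 0 1 4 5 - n$4 * B 0 1 3 5 + n$5 * B 0 1 3 4"
  "t$2 = n$0 * B 1 2 6 7 - n$1 * B 0 2 6 7 + n$2 * B 0 1 6 7 - n$6 * B 0 1 2 7 + n$7 * B 0 1 2 6"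
  "t$1 = n$0 * B 1 2 5 7 - n$1 * B 0 2 5 7 + n$2 * B 0 1 5 7 - n$5 * B 0 1 2 7 + n$7 * B 0 1 2 5"
  "t$0 = n$0 * B 1 2 5 6 - n$1 * B 0 2 5 6 + n$2 * B 0 1 5 6 - n$5 * B 0 1 2 6 + n$6 * B 0 1 2 5"
  "t$0 = n$0 * B 1 2 4 7 - n$1 * B 0 2 4 7 + n$2 * B 0 1 4 7 - n$4 * B 0 1 2 7 + n$7 * B 0 1 2 4"
  "t$1 = - n$0 * B 1 2 4 6 + n$1 * B 0 2 4 6 - n$2 * B 0 1 4 6 + n$4 * B 0 1 2 6 - n$6 * B 0 1 2 4"
  "t$2 = n$0 * B 1 2 4 5 - n$1 * B 0 2 4 5 + n$2 * B 0 1 4 5 - n$4 * B 0 1 2 5 + n$5 * B 0 1 2 4"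
  "t$7 = - n$0 * B 1 2 3 7 + n$1 * B 0 2 3 7 - n$2 * B 0 1 3 7 + n$3 * B 0 1 2 7 - n$7 * B 0 1 2 3"
  "t$6 = - n$0 * B 1 2 3 6 + n$1 * B 0 2 3 6 - n$2 * B 0 1 3 6 + n$3 * B 0 1 2 6 - n$6 * B 0 1 2 3"
  "t$5 = - n$0 * B 1 2 3 5 + n$1 * B 0 2 3 5 - n$2 * B 0 1 3 5 + n$3 * B 0 1 2 5 - n$5 * B 0 1 2 3"
  "t$4 = - n$0 * B 1 2 3 4 + n$1 * B 0 2 3 4 - n$2 * B 0 1 3 4 + n$3 * B 0 1 2 4 - n$4 * B 0 1 2 3"
  unfolding B_def
  supply \<alpha>[simp] spin7_form_axis[simp] inner_axis[simp]
  subgoal using component[of "[3,4,5,6,7]" 0 1 2] by simp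
  subgoal using component[of "[2,4,5,6,7]" 0 1 3] by simp
  subgoal using component[of "[2,3,5,6,7]" 0 1 4] by simp
  subgoal using component[of "[2,3,4,6,7]" 0 1 5] by simp
  subgoal using component[of "[2,3,4,5,7]" 0 1 6] by simp
  subgoal using component[of "[2,3,4,5,6]" 0 1 7] by simp
  subgoal using component[of "[1,4,5,6,7]" 0 2 3] by simp
  subgoal using component[of "[1,3,5,6,7]" 0 2 4] by simp
  subgoal using component[of "[1,3,4,6,7]" 0 2 5] by simp
  subgoal using component[of "[1,3,4,5,7]" 0 2 6] by simp
  subgoal using component[of "[1,3,4,5,6]" 0 2 7] by simp
  subgoal using component[of "[1,2,5,6,7]" 0 3 4] by simp
  subgoal using component[of "[1,2,4,6,7]" 0 3 5] by simp
  subgoal using component[of "[1,2,4,5,7]" 0 3 6] by simp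
  subgoal using component[of "[1,2,4,5,6]" 0 3 7] by simp
  subgoal using component[of "[1,2,3,6,7]" 0 4 5] by simp
  subgoal using component[of "[1,2,3,5,7]" 0 4 6] by simp
  subgoal using component[of "[1,2,3,5,6]" 0 4 7] by simp
  subgoal using component[of "[1,2,3,4,7]" 0 5 6] by simp
  subgoal using component[of "[1,2,3,4,6]" 0 5 7] by simp
  subgoal using component[of "[1,2,3,4,5]" 0 6 7] by simp
  subgoal using component[of "[0,4,5,6,7]" 1 2 3] by simp
  subgoal using component[of "[0,3,5,6,7]" 1 2 4] by simp
  subgoal using component[of "[0,3,4,6,7]" 1 2 5] by simp
  subgoal using component[of "[0,3,4,5,7]" 1 2 6] by simp
  subgoal using component[of "[0,3,4,5,6]" 1 2 7] by simp
  subgoal using component[of "[0,2,5,6,7]" 1 3 4] by simp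
  subgoal using component[of "[0,2,4,6,7]" 1 3 5] by simp
  subgoal using component[of "[0,2,4,5,7]" 1 3 6] by simp
  subgoal using component[of "[0,2,4,5,6]" 1 3 7] by simp
  subgoal using component[of "[0,2,3,6,7]" 1 4 5] by simp
  subgoal using component[of "[0,2,3,5,7]" 1 4 6] by simp
  subgoal using component[of "[0,2,3,5,6]" 1 4 7] by simp
  subgoal using component[of "[0,2,3,4,7]" 1 5 6] by simp
  subgoal using component[of "[0,2,3,4,6]" 1 5 7] by simp
  subgoal using component[of "[0,2,3,4,5]" 1 6 7] by simp
  subgoal using component[of "[0,1,5,6,7]" 2 3 4] by simp
  subgoal using component[of "[0,1,4,6,7]" 2 3 5] by simp
  subgoal using component[of "[0,1,4,5,7]" 2 3 6] by simp
  subgoal using component[of "[0,1,4,5,6]" 2 3 7] by simp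
  subgoal using component[of "[0,1,3,6,7]" 2 4 5] by simp
  subgoal using component[of "[0,1,3,5,7]" 2 4 6] by simp
  subgoal using component[of "[0,1,3,5,6]" 2 4 7] by simp
  subgoal using component[of "[0,1,3,4,7]" 2 5 6] by simp
  subgoal using component[of "[0,1,3,4,6]" 2 5 7] by simp
  subgoal using component[of "[0,1,3,4,5]" 2 6 7] by simp
  subgoal using component[of "[0,1,2,6,7]" 3 4 5] by simp
  subgoal using component[of "[0,1,2,5,7]" 3 4 6] by simp
  subgoal using component[of "[0,1,2,5,6]" 3 4 7] by simp
  subgoal using component[of "[0,1,2,4,7]" 3 5 6] by simp
  subgoal using component[of "[0,1,2,4,6]" 3 5 7] by simp
  subgoal using component[of "[0,1,2,4,5]" 3 6 7] by simp
  subgoal using component[of "[0,1,2,3,7]" 4 5 6] by simp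
  subgoal using component[of "[0,1,2,3,6]" 4 5 7] by simp
  subgoal using component[of "[0,1,2,3,5]" 4 6 7] by simp
  subgoal using component[of "[0,1,2,3,4]" 5 6 7] by simp
  done

lemma proportional: "n$p * t$q = n$q * t$p"
proof -
  \<comment> \<open>\<open>wij\<close> is, up to sign, the component of n \<and> t \<and> \<Omega>
    on the six indices other than i and j. Each coordinate of \<open>t\<close> has seven
    expressions; the one chosen comes from a triple that contains both i and j, and then all terms
    cancel in pairs, as n \<and> n = 0.\<close>
  have w01: "n$2 * t$3 - n$3 * t$2 - n$4 * t$5 + n$5 * t$4 - n$6 * t$7 + n$7 * t$6 = 0"
    unfolding components(1,2,3,4,5,6) by (simp add: algebra_simps)
  have w02: "n$1 * t$3 - n$3 * t$1 + n$4 * t$6 - n$5 * t$7 - n$6 * t$4 + n$7 * t$5 = 0"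
    unfolding components(1,7,8,9,10,11) by (simp add: algebra_simps)
  have w03: "n$1 * t$2 - n$2 * t$1 - n$4 * t$7 - n$5 * t$6 + n$6 * t$5 + n$7 * t$4 = 0"
    unfolding components(2,7,12,13,14,15) by (simp add: algebra_simps)
  have w04: "- n$1 * t$5 - n$2 * t$6 - n$3 * t$7 + n$5 * t$1 + n$6 * t$2 + n$7 * t$3 = 0"
    unfolding components(3,8,12,16,17,18) by (simp add: algebra_simps)
  have w05: "- n$1 * t$4 - n$2 * t$7 + n$3 * t$6 + n$4 * t$1 - n$6 * t$3 + n$7 * t$2 = 0"
    unfolding components(4,9,13,16,19,20) by (simp add: algebra_simps)
  have w06: "- n$1 * t$7 + n$2 * t$4 + n$3 * t$5 - n$4 * t$2 - n$5 * t$3 + n$7 * t$1 = 0"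
    unfolding components(5,10,14,17,19,21) by (simp add: algebra_simps)
  have w07: "- n$1 * t$6 + n$2 * t$5 - n$3 * t$4 + n$4 * t$3 - n$5 * t$2 + n$6 * t$1 = 0"
    unfolding components(6,11,15,18,20,21) by (simp add: algebra_simps)
  have w12: "n$0 * t$3 - n$3 * t$0 - n$4 * t$7 - n$5 * t$6 + n$6 * t$5 + n$7 * t$4 = 0"
    unfolding components(1,22,23,24,25,26) by (simp add: algebra_simps)
  have w13: "n$0 * t$2 - n$2 * t$0 - n$4 * t$6 + n$5 * t$7 + n$6 * t$4 - n$7 * t$5 = 0"
    unfolding components(2,22,27,28,29,30) by (simp add: algebra_simps)
  have w14: "- n$0 * t$5 + n$2 * t$7 - n$3 * t$6 + n$5 * t$0 + n$6 * t$3 - n$7 * t$2 = 0"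
    unfolding components(3,23,27,31,32,33) by (simp add: algebra_simps)
  have w15: "- n$0 * t$4 - n$2 * t$6 - n$3 * t$7 + n$4 * t$0 + n$6 * t$2 + n$7 * t$3 = 0"
    unfolding components(4,24,28,31,34,35) by (simp add: algebra_simps)
  have w16: "- n$0 * t$7 - n$2 * t$5 + n$3 * t$4 - n$4 * t$3 + n$5 * t$2 + n$7 * t$0 = 0"
    unfolding components(5,25,29,32,34,36) by (simp add: algebra_simps)
  have w17: "- n$0 * t$6 + n$2 * t$4 + n$3 * t$5 - n$4 * t$2 - n$5 * t$3 + n$6 * t$0 = 0"
    unfolding components(6,26,30,33,35,36) by (simp add: algebra_simps)
  have w23: "n$0 * t$1 - n$1 * t$0 - n$4 * t$5 + n$5 * t$4 - n$6 * t$7 + n$7 * t$6 = 0"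
    unfolding components(7,22,37,38,39,40) by (simp add: algebra_simps)
  have w24: "n$0 * t$6 + n$1 * t$7 - n$3 * t$5 + n$5 * t$3 - n$6 * t$0 - n$7 * t$1 = 0"
    unfolding components(8,23,37,41,42,43) by (simp add: algebra_simps)
  have w25: "n$0 * t$7 - n$1 * t$6 - n$3 * t$4 + n$4 * t$3 + n$6 * t$1 - n$7 * t$0 = 0"
    unfolding components(9,24,38,41,44,45) by (simp add: algebra_simps)
  have w26: "- n$0 * t$4 - n$1 * t$5 - n$3 * t$7 + n$4 * t$0 + n$5 * t$1 + n$7 * t$3 = 0"
    unfolding components(10,25,39,42,44,46) by (simp add: algebra_simps)
  have w27: "- n$0 * t$5 + n$1 * t$4 - n$3 * t$6 - n$4 * t$1 + n$5 * t$0 + n$6 * t$3 = 0"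
    unfolding components(11,26,40,43,45,46) by (simp add: algebra_simps)
  have w34: "- n$0 * t$7 + n$1 * t$6 - n$2 * t$5 + n$5 * t$2 - n$6 * t$1 + n$7 * t$0 = 0"
    unfolding components(12,27,37,47,48,49) by (simp add: algebra_simps)
  have w35: "n$0 * t$6 + n$1 * t$7 - n$2 * t$4 + n$4 * t$2 - n$6 * t$0 - n$7 * t$1 = 0"
    unfolding components(13,28,38,47,50,51) by (simp add: algebra_simps)
  have w36: "n$0 * t$5 - n$1 * t$4 - n$2 * t$7 + n$4 * t$1 - n$5 * t$0 + n$7 * t$2 = 0"
    unfolding components(14,29,39,48,50,52) by (simp add: algebra_simps)
  have w37: "- n$0 * t$4 - n$1 * t$5 - n$2 * t$6 + n$4 * t$0 + n$5 * t$1 + n$6 * t$2 = 0"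
    unfolding components(15,30,40,49,51,52) by (simp add: algebra_simps)
  have w45: "- n$0 * t$1 + n$1 * t$0 - n$2 * t$3 + n$3 * t$2 + n$6 * t$7 - n$7 * t$6 = 0"
    unfolding components(16,31,41,47,53,54) by (simp add: algebra_simps)
  have w46: "n$0 * t$2 - n$1 * t$3 - n$2 * t$0 + n$3 * t$1 + n$5 * t$7 - n$7 * t$5 = 0"
    unfolding components(17,32,42,48,53,55) by (simp add: algebra_simps)
  have w47: "- n$0 * t$3 - n$1 * t$2 + n$2 * t$1 + n$3 * t$0 + n$5 * t$6 - n$6 * t$5 = 0"
    unfolding components(18,33,43,49,54,55) by (simp add: algebra_simps)
  have w56: "- n$0 * t$3 - n$1 * t$2 + n$2 * t$1 + n$3 * t$0 + n$4 * t$7 - n$7 * t$4 = 0"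
    unfolding components(19,34,44,50,53,56) by (simp add: algebra_simps)
  have w57: "- n$0 * t$2 + n$1 * t$3 + n$2 * t$0 - n$3 * t$1 + n$4 * t$6 - n$6 * t$4 = 0"
    unfolding components(20,35,45,51,54,56) by (simp add: algebra_simps)
  have w67: "- n$0 * t$1 + n$1 * t$0 - n$2 * t$3 + n$3 * t$2 + n$4 * t$5 - n$5 * t$4 = 0"
    unfolding components(21,36,46,52,55,56) by (simp add: algebra_simps)
  \<comment> \<open>The 28 relations fall into seven groups of four, by the pairings of i with i xor
    k. Up to signs of the unknowns, each relation of a group says that three of its four entries of
    n \<and> t have sum 0; this system has eigenvalues 3 (once) and -1 (three times), so it is
    invertible. Over all groups the eigenspaces have dimensions 7 and 21, the Spin(7) splitting of
    the 2-forms.\<close>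
  have c01: "n$0 * t$1 = n$1 * t$0"  "n$2 * t$3 = n$3 * t$2"  "n$4 * t$5 = n$5 * t$4"  "n$6 * t$7 = n$7 * t$6"
    using w01 w23 w45 w67 by linarith+
  have c02: "n$0 * t$2 = n$2 * t$0"  "n$1 * t$3 = n$3 * t$1"  "n$4 * t$6 = n$6 * t$4"  "n$5 * t$7 = n$7 * t$5"
    using w02 w13 w46 w57 by linarith+
  have c03: "n$0 * t$3 = n$3 * t$0"  "n$1 * t$2 = n$2 * t$1"  "n$4 * t$7 = n$7 * t$4"  "n$5 * t$6 = n$6 * t$5"
    using w03 w12 w47 w56 by linarith+
  have c04: "n$0 * t$4 = n$4 * t$0"  "n$1 * t$5 = n$5 * t$1"  "n$2 * t$6 = n$6 * t$2"  "n$3 * t$7 = n$7 * t$3"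
    using w04 w15 w26 w37 by linarith+
  have c05: "n$0 * t$5 = n$5 * t$0"  "n$1 * t$4 = n$4 * t$1"  "n$2 * t$7 = n$7 * t$2"  "n$3 * t$6 = n$6 * t$3"
    using w05 w14 w27 w36 by linarith+
  have c06: "n$0 * t$6 = n$6 * t$0"  "n$1 * t$7 = n$7 * t$1"  "n$2 * t$4 = n$4 * t$2"  "n$3 * t$5 = n$5 * t$3"
    using w06 w17 w24 w35 by linarith+
  have c07: "n$0 * t$7 = n$7 * t$0"  "n$1 * t$6 = n$6 * t$1"  "n$2 * t$5 = n$5 * t$2"  "n$3 * t$4 = n$4 * t$3"
    using w07 w16 w25 w34 by linarith+
  have "p \<in> UNIV" "q \<in> UNIV" by auto
  then show ?thesis unfolding UNIV_8
    by (elim insertE emptyE) (simp_all add: c01 c02 c03 c04 c05 c06 c07 mult.commute)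
qed

end

text \<open>Adding the seven equations for each coordinate and pairing with \<open>n\<close> gives 7
  (n \<bullet> t) = - 4 tr D + 4 n^T M n, where \<open>M\<close> is the matrix of values of
  \<open>D\<close> on the basis. Both terms on the right vanish by assumption, and \<open>t\<close>
  is a multiple of \<open>n\<close>.\<close>

theorem spin7_frame_equations_trivial:
  assumes "spin7_frame_equations n t D \<alpha>"
    and "norm n = 1"
    and "\<And>w. n \<bullet> D w = 0" and "(\<Sum>i\<in>UNIV. D (axis i 1) $ i) = 0"
  shows "t = 0"
proof -
  interpret spin7_frame_equations n t D \<alpha> by fact
  define M where "M i j = D (axis j 1) $ i" for i j
  note B = B_def derivation4_spin7_form spin7_form_axis M_def[symmetric]
  define Tr where "Tr = M 0 0 + M 1 1 + M 2 2 + M 3 3 + M 4 4 + M 5 5 + M 6 6 + M 7 7"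
  \<comment> \<open>\<open>Co\<close> is \<open>n\<close> applied to the columns of
    \<open>M\<close>. It vanishes because \<open>D\<close> takes its values in the hyperplane
    orthogonal to \<open>n\<close>, the ideal.\<close>
  define Co where "Co i = n$0 * M 0 i + n$1 * M 1 i + n$2 * M 2 i + n$3 * M 3 i + n$4 * M 4 i + n$5 * M 5 i + n$6 * M 6 i + n$7 * M 7 i" for i
  have tr: "Tr = 0"
    using assms(4) by (simp only: sum_8 M_def Tr_def add.assoc)
  have coker: "Co i = 0" for i
    using assms(3)[of "axis i 1"] by (simp only: inner_vec_def sum_8 M_def Co_def inner_real_def add.assoc)
  have sum7: "7 * r = s1 + s2 + s3 + s4 + s5 + s6 + s7"
    if "r = s1" "r = s2" "r = s3" "r = s4" "r = s5" "r = s6" "r = s7" for r s1 s2 s3 s4 s5 s6 s7 :: real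
    using that by simp
  \<comment> \<open>\<open>Nab\<close> is minus the sum of \<Omega>_abcd M_cd over all c, d: it sees
    only the antisymmetric part of \<open>M\<close> and is itself antisymmetric in a, b.\<close>
  define N01 where "N01 = - M 2 3 + M 3 2 + M 4 5 - M 5 4 + M 6 7 - M 7 6"
  define N02 where "N02 = M 1 3 - M 3 1 + M 4 6 - M 5 7 - M 6 4 + M 7 5"
  define N03 where "N03 = - M 1 2 + M 2 1 + M 4 7 + M 5 6 - M 6 5 - M 7 4"
  define N04 where "N04 = - M 1 5 - M 2 6 - M 3 7 + M 5 1 + M 6 2 + M 7 3"
  define N05 where "N05 = M 1 4 + M 2 7 - M 3 6 - M 4 1 + M 6 3 - M 7 2"
  define N06 where "N06 = - M 1 7 + M 2 4 + M 3 5 - M 4 2 - M 5 3 + M 7 1"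
  define N07 where "N07 = M 1 6 - M 2 5 + M 3 4 - M 4 3 + M 5 2 - M 6 1"
  define N12 where "N12 = - M 0 3 + M 3 0 + M 4 7 + M 5 6 - M 6 5 - M 7 4"
  define N13 where "N13 = M 0 2 - M 2 0 - M 4 6 + M 5 7 + M 6 4 - M 7 5"
  define N14 where "N14 = M 0 5 - M 2 7 + M 3 6 - M 5 0 - M 6 3 + M 7 2"
  define N15 where "N15 = - M 0 4 - M 2 6 - M 3 7 + M 4 0 + M 6 2 + M 7 3"
  define N16 where "N16 = M 0 7 + M 2 5 - M 3 4 + M 4 3 - M 5 2 - M 7 0"
  define N17 where "N17 = - M 0 6 + M 2 4 + M 3 5 - M 4 2 - M 5 3 + M 6 0"
  define N23 where "N23 = - M 0 1 + M 1 0 + M 4 5 - M 5 4 + M 6 7 - M 7 6"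
  define N24 where "N24 = M 0 6 + M 1 7 - M 3 5 + M 5 3 - M 6 0 - M 7 1"
  define N25 where "N25 = - M 0 7 + M 1 6 + M 3 4 - M 4 3 - M 6 1 + M 7 0"
  define N26 where "N26 = - M 0 4 - M 1 5 - M 3 7 + M 4 0 + M 5 1 + M 7 3"
  define N27 where "N27 = M 0 5 - M 1 4 + M 3 6 + M 4 1 - M 5 0 - M 6 3"
  define N34 where "N34 = M 0 7 - M 1 6 + M 2 5 - M 5 2 + M 6 1 - M 7 0"
  define N35 where "N35 = M 0 6 + M 1 7 - M 2 4 + M 4 2 - M 6 0 - M 7 1"
  define N36 where "N36 = - M 0 5 + M 1 4 + M 2 7 - M 4 1 + M 5 0 - M 7 2"
  define N37 where "N37 = - M 0 4 - M 1 5 - M 2 6 + M 4 0 + M 5 1 + M 6 2"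
  define N45 where "N45 = M 0 1 - M 1 0 + M 2 3 - M 3 2 - M 6 7 + M 7 6"
  define N46 where "N46 = M 0 2 - M 1 3 - M 2 0 + M 3 1 + M 5 7 - M 7 5"
  define N47 where "N47 = M 0 3 + M 1 2 - M 2 1 - M 3 0 - M 5 6 + M 6 5"
  define N56 where "N56 = M 0 3 + M 1 2 - M 2 1 - M 3 0 - M 4 7 + M 7 4"
  define N57 where "N57 = - M 0 2 + M 1 3 + M 2 0 - M 3 1 + M 4 6 - M 6 4"
  define N67 where "N67 = M 0 1 - M 1 0 + M 2 3 - M 3 2 - M 4 5 + M 5 4"
  note N = N01_def N02_def N03_def N04_def N05_def N06_def N07_def N12_def N13_def N14_def N15_def N16_def N17_def N23_def N24_def N25_def N26_def N27_def N34_def N35_def N36_def N37_def N45_def N46_def N47_def N56_def N57_def N67_def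
  have k0: "7 * t$0 = 2 * (n$1 * N01 + n$2 * N02 + n$3 * N03 + n$4 * N04 + n$5 * N05 + n$6 * N06 + n$7 * N07) - 4 * (n$0 * Tr) + 4 * Co 0"
    unfolding sum7[OF components(50) components(49) components(45) components(42) components(36) components(31) components(22)] Tr_def Co_def B N by (simp add: algebra_simps)
  have k1: "7 * t$1 = 2 * (- n$0 * N01 + n$2 * N12 + n$3 * N13 + n$4 * N14 + n$5 * N15 + n$6 * N16 + n$7 * N17) - 4 * (n$1 * Tr) + 4 * Co 1"
    unfolding sum7[OF components(51) components(48) components(44) components(43) components(21) components(16) components(7)] Tr_def Co_def B N by (simp add: algebra_simps)
  have k2: "7 * t$2 = 2 * (- n$0 * N02 - n$1 * N12 + n$3 * N23 + n$4 * N24 + n$5 * N25 + n$6 * N26 + n$7 * N27) - 4 * (n$2 * Tr) + 4 * Co 2"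
    unfolding sum7[OF components(52) components(47) components(34) components(33) components(20) components(17) components(2)] Tr_def Co_def B N by (simp add: algebra_simps)
  have k3: "7 * t$3 = 2 * (- n$0 * N03 - n$1 * N13 - n$2 * N23 + n$4 * N34 + n$5 * N35 + n$6 * N36 + n$7 * N37) - 4 * (n$3 * Tr) + 4 * Co 3"
    unfolding sum7[OF components(46) components(41) components(35) components(32) components(19) components(18) components(1)] Tr_def Co_def B N by (simp add: algebra_simps)
  have k4: "7 * t$4 = 2 * (- n$0 * N04 - n$1 * N14 - n$2 * N24 - n$3 * N34 + n$5 * N45 + n$6 * N46 + n$7 * N47) - 4 * (n$4 * Tr) + 4 * Co 4"
    unfolding sum7[OF components(56) components(38) components(29) components(26) components(15) components(10) components(4)] Tr_def Co_def B N by (simp add: algebra_simps)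
  have k5: "7 * t$5 = 2 * (- n$0 * N05 - n$1 * N15 - n$2 * N25 - n$3 * N35 - n$4 * N45 + n$6 * N56 + n$7 * N57) - 4 * (n$5 * Tr) + 4 * Co 5"
    unfolding sum7[OF components(55) components(37) components(30) components(25) components(14) components(11) components(3)] Tr_def Co_def B N by (simp add: algebra_simps)
  have k6: "7 * t$6 = 2 * (- n$0 * N06 - n$1 * N16 - n$2 * N26 - n$3 * N36 - n$4 * N46 - n$5 * N56 + n$7 * N67) - 4 * (n$6 * Tr) + 4 * Co 6"
    unfolding sum7[OF components(54) components(40) components(27) components(24) components(13) components(8) components(6)] Tr_def Co_def B N by (simp add: algebra_simps)
  have k7: "7 * t$7 = 2 * (- n$0 * N07 - n$1 * N17 - n$2 * N27 - n$3 * N37 - n$4 * N47 - n$5 * N57 - n$6 * N67) - 4 * (n$7 * Tr) + 4 * Co 7"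
    unfolding sum7[OF components(53) components(39) components(28) components(23) components(12) components(9) components(5)] Tr_def Co_def B N by (simp add: algebra_simps)
  \<comment> \<open>The \<open>N\<close> terms cancel here: each \<open>Nab\<close> enters the
    equations for coordinates a and b with opposite signs.\<close>
  have "7 * (n \<bullet> t) = 0"
    using arg_cong[OF k0, of "(*) (n$0)"] arg_cong[OF k1, of "(*) (n$1)"] arg_cong[OF k2, of "(*) (n$2)"]
      arg_cong[OF k3, of "(*) (n$3)"] arg_cong[OF k4, of "(*) (n$4)"] arg_cong[OF k5, of "(*) (n$5)"]
      arg_cong[OF k6, of "(*) (n$6)"] arg_cong[OF k7, of "(*) (n$7)"]
    unfolding inner_vec_def sum_8 by (simp add: tr coker algebra_simps)
  then have orth: "n \<bullet> t = 0" by simp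
  have "t $ q = 0" for q
  proof -
    have "t $ q = (n \<bullet> n) * t $ q" using assms(2) by (simp add: norm_eq_1)
    also have "\<dots> = (\<Sum>m\<in>UNIV. n$m * (n$m * t$q))"
      by (simp add: inner_vec_def sum_distrib_right mult.assoc)
    also have "\<dots> = n$q * (n \<bullet> t)"
      unfolding proportional[of _ q] by (simp add: inner_vec_def sum_distrib_left mult_ac)
    finally show ?thesis using orth by simp
  qed
  then show ?thesis by (simp add: vec_eq_iff)
qed

section \<open>Calculus\<close>

text \<open>On an open set derivatives depend only on the values there, so they agree as well, and
  the induction hypothesis, with both functions general, applies to them.\<close>

lemma C_on_cong:
  assumes "open S" "\<And>x. x \<in> S \<Longrightarrow> f x = g x" "C_on k S f"
  shows "C_on k S g"
  using assms(2,3)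
proof (induction k arbitrary: f g)
  case 0
  then show ?case by (simp cong: continuous_on_cong)
next
  case (Suc k)
  have d: "(g has_derivative frechet_derivative f (at x)) (at x)" if "x \<in> S" for x
  proof -
    have "(f has_derivative frechet_derivative f (at x)) (at x)"
      using Suc.prems(2) that frechet_derivative_works by auto
    then show ?thesis
      by (rule has_derivative_transform_within_open[OF _ assms(1) that]) (use Suc.prems in auto)
  qed
  have e: "frechet_derivative g (at x) = frechet_derivative f (at x)" if "x \<in> S" for x
    using frechet_derivative_at[OF d[OF that]] by simp
  have "C_on k S (\<lambda>x. frechet_derivative g (at x) v)" for v
    by (rule Suc.IH[of "\<lambda>x. frechet_derivative f (at x) v"]) (use e Suc.prems in auto)
  then show ?case using d by (auto simp: differentiable_def)
qed

lemma smooth_on_cong: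
  "open S \<Longrightarrow> (\<And>x. x \<in> S \<Longrightarrow> f x = g x) \<Longrightarrow> smooth_on S f \<Longrightarrow> smooth_on S g"
  unfolding smooth_on_def using C_on_cong by blast

lemma smooth_on_has_derivative:
  assumes "smooth_on S f" "x \<in> S"
  shows "(f has_derivative frechet_derivative f (at x)) (at x)"
  using assms C_on.simps(2)[of 0 S f] unfolding smooth_on_def frechet_derivative_works[symmetric] by blast

lemma smooth_on_frechet_derivative:
  "smooth_on S f \<Longrightarrow> smooth_on S (\<lambda>x. frechet_derivative f (at x) v)"
  unfolding smooth_on_def by (metis C_on.simps(2))

lemma smooth_on_continuous_on: "smooth_on S f \<Longrightarrow> continuous_on S f"
  unfolding smooth_on_def by (metis C_on.simps(1))

lemma open_slice:
  assumes "open (W :: ('a::topological_space \<times> 'b::topological_space) set)"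
  shows "open {x. (x, y) \<in> W}" "open {y. (x, y) \<in> W}"
proof -
  have "{x. (x, y) \<in> W} = (\<lambda>x. (x, y)) -` W" "{y. (x, y) \<in> W} = (\<lambda>y. (x, y)) -` W" by auto
  moreover have "continuous_on UNIV (\<lambda>x. (x :: 'a, y :: 'b))" "continuous_on UNIV (\<lambda>y. (x :: 'a, y :: 'b))"
    by (intro continuous_intros)+
  ultimately show "open {x. (x, y) \<in> W}" "open {y. (x, y) \<in> W}"
    using assms by (auto intro: open_vimage)
qed

lemma has_derivative_slice:
  assumes "(f has_derivative f') (at (x, y))"
  shows "((\<lambda>x. f (x, y)) has_derivative (\<lambda>u. f' (u, 0))) (at x)"
    and "((\<lambda>y. f (x, y)) has_derivative (\<lambda>v. f' (0, v))) (at y)"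
proof -
  have "((\<lambda>x. (x, y)) has_derivative (\<lambda>u. (u, 0))) (at x)"
    "((\<lambda>y. (x, y)) has_derivative (\<lambda>v. (0, v))) (at y)"
    by (auto intro!: derivative_eq_intros)
  from this[THEN has_derivative_compose] assms
  show "((\<lambda>x. f (x, y)) has_derivative (\<lambda>u. f' (u, 0))) (at x)"
    "((\<lambda>y. f (x, y)) has_derivative (\<lambda>v. f' (0, v))) (at y)" by auto
qed

text \<open>The derivative of the slice in direction \<open>u\<close> is that of \<open>f\<close> in
  direction (u, 0): again a slice of a function on \<open>W\<close>, which closes the
  induction.\<close>

lemma C_on_slice:
  fixes f :: "'a::euclidean_space \<times> 'b::euclidean_space \<Rightarrow> 'c::real_normed_vector"
  assumes "open W" "C_on k W f"
  shows "C_on k {x. (x, y) \<in> W} (\<lambda>x. f (x, y))"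
  using assms(2)
proof (induction k arbitrary: f)
  case 0
  have "continuous_on {x. (x, y) \<in> W} (f \<circ> (\<lambda>x. (x, y)))"
    using 0 by (intro continuous_on_compose continuous_intros) (auto elim: continuous_on_subset)
  then show ?case by (simp add: o_def)
next
  case (Suc k)
  have d: "((\<lambda>x. f (x, y)) has_derivative (\<lambda>u. frechet_derivative f (at (x, y)) (u, 0))) (at x)"
    if "(x, y) \<in> W" for x
    using Suc.prems that by (intro has_derivative_slice) (auto simp: frechet_derivative_works)
  have e: "frechet_derivative (\<lambda>x. f (x, y)) (at x) u = frechet_derivative f (at (x, y)) (u, 0)"
    if "(x, y) \<in> W" for x u
    using frechet_derivative_at[OF d[OF that]] by metis
  have "C_on k {x. (x, y) \<in> W} (\<lambda>x. frechet_derivative (\<lambda>x. f (x, y)) (at x) u)" for u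
    by (rule C_on_cong[OF open_slice(1)[OF assms(1)] _ Suc.IH[of "\<lambda>z. frechet_derivative f (at z) (u, 0)"]])
      (use e Suc.prems in auto)
  then show ?case using d by (auto simp: differentiable_def)
qed

lemma smooth_on_slice:
  fixes f :: "'a::euclidean_space \<times> 'b::euclidean_space \<Rightarrow> 'c::real_normed_vector"
  assumes "open W" "smooth_on W f"
  shows "smooth_on {x. (x, y) \<in> W} (\<lambda>x. f (x, y))"
  using assms C_on_slice unfolding smooth_on_def by blast

section \<open>Symmetry of second derivatives\<close>

lemma second_difference_mean_value:
  fixes f :: "'a::euclidean_space \<Rightarrow> real"
  assumes "smooth_on S f" "0 < h" "cball x (h * (norm u + norm v)) \<subseteq> S"
  obtains y where "norm (y - x) \<le> h * (norm u + norm v)"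
    "f (x + h *\<^sub>R u + h *\<^sub>R v) - f (x + h *\<^sub>R u) - f (x + h *\<^sub>R v) + f x =
       h * (h * frechet_derivative (\<lambda>z. frechet_derivative f (at z) u) (at y) v)"
proof -
  have S: "x + s *\<^sub>R u + t *\<^sub>R v \<in> S" if "0 \<le> s" "s \<le> h" "0 \<le> t" "t \<le> h" for s t
  proof -
    have "norm (s *\<^sub>R u + t *\<^sub>R v) \<le> s * norm u + t * norm v"
      using that norm_triangle_ineq[of "s *\<^sub>R u" "t *\<^sub>R v"] by simp
    also have "\<dots> \<le> h * (norm u + norm v)"
      unfolding distrib_left using that by (intro add_mono mult_right_mono) auto
    finally have "x + (s *\<^sub>R u + t *\<^sub>R v) \<in> cball x (h * (norm u + norm v))"
      by (simp only: mem_cball dist_norm norm_minus_commute[of x] add_diff_cancel_left')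
    then show ?thesis using assms(3) by (auto simp: add.assoc)
  qed
  let ?D = "\<lambda>z. frechet_derivative f (at z)"
  let ?E = "\<lambda>z. frechet_derivative (\<lambda>z. frechet_derivative f (at z) u) (at z)"
  have d: "((\<lambda>s. f (x + s *\<^sub>R u + t *\<^sub>R v)) has_derivative (\<lambda>r. ?D (x + s *\<^sub>R u + t *\<^sub>R v) (r *\<^sub>R u)))
      (at s within {0..h})"
    if "0 \<le> s" "s \<le> h" "0 \<le> t" "t \<le> h" for s t
    by (rule has_derivative_compose[where g = f and f = "\<lambda>s. x + s *\<^sub>R u + t *\<^sub>R v", OF _ smooth_on_has_derivative[OF assms(1) S[OF that]]])
      (auto intro!: derivative_eq_intros)
  \<comment> \<open>Mean value theorem for s \<mapsto> f (x + s u + h v) - f (x + s u).\<close>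
  have "\<exists>s\<in>{0<..<h}. (f (x + h *\<^sub>R u + h *\<^sub>R v) - f (x + h *\<^sub>R u + 0 *\<^sub>R v))
      - (f (x + 0 *\<^sub>R u + h *\<^sub>R v) - f (x + 0 *\<^sub>R u + 0 *\<^sub>R v)) =
      ?D (x + s *\<^sub>R u + h *\<^sub>R v) ((h - 0) *\<^sub>R u) - ?D (x + s *\<^sub>R u + 0 *\<^sub>R v) ((h - 0) *\<^sub>R u)"
    by (rule mvt_simple[OF assms(2)]) (use assms(2) in \<open>auto intro!: has_derivative_diff d d[where t = 0, simplified]\<close>)
  then obtain s where s: "0 < s" "s < h"
    and 1: "f (x + h *\<^sub>R u + h *\<^sub>R v) - f (x + h *\<^sub>R u) - f (x + h *\<^sub>R v) + f x =
      ?D (x + s *\<^sub>R u + h *\<^sub>R v) (h *\<^sub>R u) - ?D (x + s *\<^sub>R u) (h *\<^sub>R u)" by auto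
  have lin: "?D z (h *\<^sub>R u) = h * ?D z u" if "z \<in> S" for z
    using has_derivative_linear[OF smooth_on_has_derivative[OF assms(1) that]] by (simp add: linear_scale)
  \<comment> \<open>Mean value theorem once more, for the derivative of \<open>f\<close> along
    \<open>u\<close> as a function of the step in direction \<open>v\<close>.\<close>
  have "\<exists>t\<in>{0<..<h}. ?D (x + s *\<^sub>R u + h *\<^sub>R v) u - ?D (x + s *\<^sub>R u + 0 *\<^sub>R v) u =
      ?E (x + s *\<^sub>R u + t *\<^sub>R v) ((h - 0) *\<^sub>R v)"
  proof (rule mvt_simple[OF assms(2)])
    fix t assume t: "0 \<le> t" "t \<le> h"
    show "((\<lambda>t. ?D (x + s *\<^sub>R u + t *\<^sub>R v) u) has_derivative (\<lambda>r. ?E (x + s *\<^sub>R u + t *\<^sub>R v) (r *\<^sub>R v)))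
      (at t within {0..h})"
      by (rule has_derivative_compose[where g = "\<lambda>z. ?D z u" and f = "\<lambda>t. x + s *\<^sub>R u + t *\<^sub>R v",
            OF _ smooth_on_has_derivative[OF smooth_on_frechet_derivative[OF assms(1)] S]])
        (use t s in \<open>auto intro!: derivative_eq_intros\<close>)
  qed
  then obtain t where t: "0 < t" "t < h"
    and 2: "?D (x + s *\<^sub>R u + h *\<^sub>R v) u - ?D (x + s *\<^sub>R u) u = ?E (x + s *\<^sub>R u + t *\<^sub>R v) (h *\<^sub>R v)" by auto
  let ?y = "x + s *\<^sub>R u + t *\<^sub>R v"
  have y: "?y \<in> S" using S[of s t] s t by simp
  have "?E ?y (h *\<^sub>R v) = h * ?E ?y v"
    using has_derivative_linear[OF smooth_on_has_derivative[OF smooth_on_frechet_derivative[OF assms(1)] y]]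
    by (simp add: linear_scale)
  moreover have "x + s *\<^sub>R u + h *\<^sub>R v \<in> S" "x + s *\<^sub>R u \<in> S"
    using S[of s h] S[of s 0] s assms(2) by auto
  ultimately have "f (x + h *\<^sub>R u + h *\<^sub>R v) - f (x + h *\<^sub>R u) - f (x + h *\<^sub>R v) + f x = h * (h * ?E ?y v)"
    using 1 2 lin by (simp add: right_diff_distrib[symmetric])
  moreover have "norm (?y - x) \<le> h * (norm u + norm v)"
  proof -
    have "norm (s *\<^sub>R u + t *\<^sub>R v) \<le> s * norm u + t * norm v"
      using s t norm_triangle_ineq[of "s *\<^sub>R u" "t *\<^sub>R v"] by simp
    also have "\<dots> \<le> h * (norm u + norm v)"
      unfolding distrib_left using s t by (intro add_mono mult_right_mono) auto
    finally show ?thesis by (metis add.assoc add_diff_cancel_left')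
  qed
  ultimately show ?thesis by (rule that[rotated])
qed

text \<open>The second difference is symmetric in \<open>u\<close> and \<open>v\<close> and equals
  h^2 times either mixed derivative at some point near \<open>x\<close>; both derivatives are
  continuous at \<open>x\<close>.\<close>

lemma frechet_derivative_commute_real:
  fixes f :: "'a::euclidean_space \<Rightarrow> real"
  assumes "open S" "smooth_on S f" "x \<in> S"
  shows "frechet_derivative (\<lambda>z. frechet_derivative f (at z) u) (at x) v =
         frechet_derivative (\<lambda>z. frechet_derivative f (at z) v) (at x) u"
proof -
  let ?E = "\<lambda>u v z. frechet_derivative (\<lambda>z. frechet_derivative f (at z) u) (at z) v"
  have "dist (?E u v x) (?E v u x) < 2 * e" if "e > 0" for e :: real
  proof -
    have c: "continuous (at x) (?E u v)" for u v
      using smooth_on_continuous_on[OF smooth_on_frechet_derivative[OF smooth_on_frechet_derivative[OF assms(2)]]]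
        assms(1,3) by (simp add: continuous_on_eq_continuous_at)
    obtain d1 where d1: "d1 > 0" "\<And>y. dist y x < d1 \<Longrightarrow> dist (?E u v y) (?E u v x) < e"
      using c[of u v] \<open>e > 0\<close> unfolding continuous_at_eps_delta by blast
    obtain d2 where d2: "d2 > 0" "\<And>y. dist y x < d2 \<Longrightarrow> dist (?E v u y) (?E v u x) < e"
      using c[of v u] \<open>e > 0\<close> unfolding continuous_at_eps_delta by blast
    obtain r where r: "r > 0" "cball x r \<subseteq> S" using assms(1,3) open_contains_cball by blast
    define d where "d = Min {d1, d2, r}"
    have d: "d > 0" "d \<le> d1" "d \<le> d2" "d \<le> r" using d1 d2 r by (auto simp: d_def)
    \<comment> \<open>The summand 1 keeps the denominator positive when both vectors are 0; the
      factor 2 yields the bound d / 2 < d.\<close>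
    define h where "h = d / (2 * (norm u + norm v + 1))"
    have h: "h > 0" using d by (simp add: h_def add_nonneg_pos)
    have "h * (norm u + norm v) \<le> h * (norm u + norm v + 1)" using h by simp
    also have "\<dots> = d / 2" by (simp add: h_def add_nonneg_eq_0_iff field_simps) 
    also have "\<dots> < d" using d by simp
    finally have hd: "h * (norm u + norm v) < d" .
    then have sub: "cball x (h * (norm u + norm v)) \<subseteq> S" "cball x (h * (norm v + norm u)) \<subseteq> S"
      using r d by (auto simp: subset_iff add.commute)
    obtain y where y: "norm (y - x) \<le> h * (norm u + norm v)"
      "f (x + h *\<^sub>R u + h *\<^sub>R v) - f (x + h *\<^sub>R u) - f (x + h *\<^sub>R v) + f x = h * (h * ?E u v y)"
      by (rule second_difference_mean_value[OF assms(2) h sub(1)])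
    obtain z where z: "norm (z - x) \<le> h * (norm v + norm u)"
      "f (x + h *\<^sub>R v + h *\<^sub>R u) - f (x + h *\<^sub>R v) - f (x + h *\<^sub>R u) + f x = h * (h * ?E v u z)"
      by (rule second_difference_mean_value[OF assms(2) h sub(2)])
    have "x + h *\<^sub>R v + h *\<^sub>R u = x + h *\<^sub>R u + h *\<^sub>R v" by (simp add: add_ac)
    then have "f (x + h *\<^sub>R v + h *\<^sub>R u) = f (x + h *\<^sub>R u + h *\<^sub>R v)" by (rule arg_cong)
    then have "h * (h * ?E u v y) = h * (h * ?E v u z)" using y(2) z(2) by linarith
    then have "?E u v y = ?E v u z" using h by simp
    moreover have "dist (?E u v y) (?E u v x) < e" using y hd d by (intro d1) (auto simp: dist_norm)
    moreover have "dist (?E v u z) (?E v u x) < e" using z hd d by (intro d2) (auto simp: dist_norm add.commute)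
    ultimately show ?thesis by (smt (verit) dist_commute dist_triangle)
  qed
  from this[of "dist (?E u v x) (?E v u x) / 2"] show ?thesis by fastforce
qed

lemma smooth_on_inner:
  fixes f :: "'a::euclidean_space \<Rightarrow> 'b::real_inner"
  assumes "open S" "smooth_on S f"
  shows "smooth_on S (\<lambda>x. f x \<bullet> b)"
proof -
  have "C_on k S (\<lambda>x. f x \<bullet> b)" if "C_on k S f" for k
    using that
  proof (induction k arbitrary: f)
    case 0
    then show ?case by (auto intro: continuous_intros)
  next
    case (Suc k)
    have d: "((\<lambda>x. f x \<bullet> b) has_derivative (\<lambda>v. frechet_derivative f (at x) v \<bullet> b)) (at x)" if "x \<in> S" for x
      using Suc.prems that by (intro has_derivative_inner_left) (auto simp: frechet_derivative_works)
    have e: "frechet_derivative (\<lambda>x. f x \<bullet> b) (at x) v = frechet_derivative f (at x) v \<bullet> b" if "x \<in> S" for x v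
      using frechet_derivative_at[OF d[OF that]] by metis
    have "C_on k S (\<lambda>x. frechet_derivative (\<lambda>x. f x \<bullet> b) (at x) v)" for v
      by (rule C_on_cong[OF assms(1) _ Suc.IH[of "\<lambda>x. frechet_derivative f (at x) v"]]) (use e Suc.prems in auto)
    then show ?case using d by (auto simp: differentiable_def)
  qed
  then show ?thesis using assms unfolding smooth_on_def by blast
qed

text \<open>Coordinatewise, since the mean value theorem behind the scalar case is about real
  values.\<close>

lemma frechet_derivative_commute:
  fixes f :: "'a::euclidean_space \<Rightarrow> 'b::euclidean_space"
  assumes "open S" "smooth_on S f" "x \<in> S"
  shows "frechet_derivative (\<lambda>z. frechet_derivative f (at z) u) (at x) v =
         frechet_derivative (\<lambda>z. frechet_derivative f (at z) v) (at x) u"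
proof (rule euclidean_eqI)
  fix b :: 'b assume "b \<in> Basis"
  have *: "frechet_derivative (\<lambda>z. frechet_derivative (\<lambda>y. f y \<bullet> b) (at z) u) (at x) v =
      frechet_derivative (\<lambda>z. frechet_derivative f (at z) u) (at x) v \<bullet> b" for u v
  proof -
    have e: "frechet_derivative f (at z) u \<bullet> b = frechet_derivative (\<lambda>y. f y \<bullet> b) (at z) u" if "z \<in> S" for z
    proof -
      have "((\<lambda>y. f y \<bullet> b) has_derivative (\<lambda>v. frechet_derivative f (at z) v \<bullet> b)) (at z)"
        by (intro has_derivative_inner_left smooth_on_has_derivative[OF assms(2) that])
      from frechet_derivative_at[OF this] show ?thesis by metis
    qed
    have "((\<lambda>z. frechet_derivative f (at z) u \<bullet> b) has_derivative
        (\<lambda>v. frechet_derivative (\<lambda>z. frechet_derivative f (at z) u) (at x) v \<bullet> b)) (at x)"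
      by (intro has_derivative_inner_left smooth_on_has_derivative[OF smooth_on_frechet_derivative[OF assms(2)] assms(3)])
    then have "((\<lambda>z. frechet_derivative (\<lambda>y. f y \<bullet> b) (at z) u) has_derivative
        (\<lambda>v. frechet_derivative (\<lambda>z. frechet_derivative f (at z) u) (at x) v \<bullet> b)) (at x)"
      by (rule has_derivative_transform_within_open[OF _ assms(1,3)]) (rule e)
    from frechet_derivative_at[OF this] show ?thesis by metis
  qed
  show "frechet_derivative (\<lambda>z. frechet_derivative f (at z) u) (at x) v \<bullet> b =
      frechet_derivative (\<lambda>z. frechet_derivative f (at z) v) (at x) u \<bullet> b"
    using frechet_derivative_commute_real[OF assms(1) smooth_on_inner[OF assms(1,2)] assms(3), of b u v]
    unfolding * .
qed

text \<open>Jacobi's formula at the identity. In the Leibniz expansion a permutation other than the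
  identity moves at least two indices, so after one factor is differentiated a zero entry of the
  identity matrix remains; the identity permutation yields the trace.\<close>

lemma has_derivative_det_at_mat_1:
  fixes A :: "'a::real_normed_vector \<Rightarrow> real^'n^'n"
  assumes d: "\<And>i j. ((\<lambda>x. A x $ i $ j) has_derivative (\<lambda>h. A' h $ i $ j)) (at a)" and "A a = mat 1"
  shows "((\<lambda>x. det (A x)) has_derivative (\<lambda>h. trace (A' h))) (at a)"
proof -
  let ?U = "UNIV :: 'n set"
  have *: "((\<lambda>x. det (A x)) has_derivative (\<lambda>h. \<Sum>p | p permutes ?U. of_int (sign p) *
      (\<Sum>i\<in>?U. A' h $ i $ p i * (\<Prod>j\<in>?U - {i}. A a $ j $ p j)))) (at a)"
    unfolding det_def
    by (rule has_derivative_sum has_derivative_mult_right has_derivative_prod d)+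
  have z: "(\<Sum>i\<in>?U. A' h $ i $ p i * (\<Prod>j\<in>?U - {i}. A a $ j $ p j)) = 0" if p: "p permutes ?U" "p \<noteq> id" for p h
  proof (rule sum.neutral, rule ballI)
    fix i :: 'n
    obtain k where k: "p k \<noteq> k" using p(2) by (auto simp: fun_eq_iff)
    have "\<exists>j. j \<noteq> i \<and> p j \<noteq> j"
    proof (cases "k = i")
      case True
      then have "p (p k) \<noteq> p k" using k p(1) by (metis permutes_inj injD)
      then show ?thesis using k True by metis
    qed (use k in auto)
    then obtain j where "j \<noteq> i" "p j \<noteq> j" by auto
    then have "(\<Prod>j\<in>?U - {i}. A a $ j $ p j) = 0"
      unfolding assms(2) by (intro prod_zero bexI[of _ j]) (auto simp: mat_def)
    then show "A' h $ i $ p i * (\<Prod>j\<in>?U - {i}. A a $ j $ p j) = 0" by simp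
  qed
  have "(\<Sum>p | p permutes ?U. of_int (sign p) *
      (\<Sum>i\<in>?U. A' h $ i $ p i * (\<Prod>j\<in>?U - {i}. A a $ j $ p j))) = trace (A' h)" for h
  proof -
    have "(\<Sum>p | p permutes ?U. of_int (sign p) *
      (\<Sum>i\<in>?U. A' h $ i $ p i * (\<Prod>j\<in>?U - {i}. A a $ j $ p j))) =
      (\<Sum>p\<in>{id}. of_int (sign p) *
      (\<Sum>i\<in>?U. A' h $ i $ p i * (\<Prod>j\<in>?U - {i}. A a $ j $ p j)))"
    proof (rule sum.mono_neutral_right)
      show "\<forall>p\<in>{p. p permutes ?U} - {id}. of_int (sign p) *
        (\<Sum>i\<in>?U. A' h $ i $ p i * (\<Prod>j\<in>?U - {i}. A a $ j $ p j)) = 0" using z by simp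
    qed (auto simp: permutes_id)
    also have "\<dots> = trace (A' h)" unfolding assms(2) by (simp add: mat_def trace_def)
    finally show ?thesis .
  qed
  with * show ?thesis by simp
qed

section \<open>Lie groups in charts and left-invariant vector fields\<close>

text \<open>\<open>inv_into\<close> agrees on the range of the chart with the inverse provided by
  the homeomorphism.\<close>

lemma continuous_inv_chart:
  assumes "is_chart T c"
  shows "continuous_map (top_of_set (crange c)) T (inv_into (cdom c) (coord c))"
proof -
  have sub: "cdom c \<subseteq> topspace T" using assms by (auto simp: is_chart_def dest: openin_subset)
  have inj: "inj_on (coord c) (cdom c)"
    using assms sub by (auto simp: is_chart_def homeomorphic_map_def topspace_subtopology Int_absorb1)
  obtain g where g: "homeomorphic_maps (subtopology T (cdom c)) (top_of_set (crange c)) (coord c) g"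
    using assms by (auto simp: is_chart_def homeomorphic_map_maps)
  have "inv_into (cdom c) (coord c) x = g x"
    if x: "x \<in> topspace (top_of_set (crange c))" for x
  proof -
    obtain p where p: "p \<in> cdom c" "x = coord c p" using x by (auto simp: crange_def)
    have "p \<in> topspace (subtopology T (cdom c))" using p(1) sub by auto
    then have "g (coord c p) = p" using g unfolding homeomorphic_maps_def by blast
    then have "g x = p" using p(2) by (simp only:)
    then show ?thesis using inv_into_f_f[OF inj p(1)] p(2) by simp
  qed
  moreover have "continuous_map (top_of_set (crange c)) (subtopology T (cdom c)) g"
    using g unfolding homeomorphic_maps_def by blast
  ultimately have "continuous_map (top_of_set (crange c)) (subtopology T (cdom c)) (inv_into (cdom c) (coord c))"
    by (metis (full_types) continuous_map_eq)
  then show ?thesis by (rule continuous_map_into_fulltopology)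
qed

lemma inv_chart:
  "x \<in> crange c \<Longrightarrow> inv_into (cdom c) (coord c) x \<in> cdom c"
  "x \<in> crange c \<Longrightarrow> coord c (inv_into (cdom c) (coord c) x) = x"
  unfolding crange_def by (auto intro: inv_into_into f_inv_into_f)

lemma inj_on_chart:
  assumes "is_chart T c" shows "inj_on (coord c) (cdom c)"
proof -
  have "cdom c \<subseteq> topspace T" using assms by (auto simp: is_chart_def dest: openin_subset)
  then show ?thesis
    using assms by (auto simp: is_chart_def homeomorphic_map_def topspace_subtopology Int_absorb1)
qed

lemma open_chart_image:
  assumes "is_chart T c" "openin T U" "U \<subseteq> cdom c"
  shows "open (coord c ` U)"
proof -
  have "openin (subtopology T (cdom c)) U" using assms(2,3) by (auto simp: openin_subtopology)
  then have "openin (top_of_set (crange c)) (coord c ` U)"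
    using assms(1) homeomorphic_imp_open_map unfolding is_chart_def open_map_def by blast
  then show ?thesis using assms(1) by (auto simp: is_chart_def openin_open_eq)
qed

locale lie_grp =
  fixes G :: "('g, 'b) monoid_scheme" (structure) and T :: "'g topology"
    and A :: "('g, 'e::euclidean_space) chart set"
  assumes lie_group: "lie_group G T A"
begin

sublocale group G using lie_group by (simp add: lie_group_def)

abbreviation icoord :: "('g, 'e) chart \<Rightarrow> 'e \<Rightarrow> 'g" where
  "icoord c \<equiv> inv_into (cdom c) (coord c)"

lemma topspace: "topspace T = carrier G"
  and smooth_manifold: "smooth_manifold T A"
  and smooth_mult: "smooth_map (prod_topology T T) (prod_atlas A A) T A (\<lambda>(x, y). x \<otimes> y)"
  and smooth_inverse: "smooth_map T A T A (\<lambda>x. inv x)"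
  using lie_group by (auto simp: lie_group_def)

lemma chart: "c \<in> A \<Longrightarrow> is_chart T c"
  using smooth_manifold by (auto simp: smooth_manifold_def)

lemma openin_cdom: "c \<in> A \<Longrightarrow> openin T (cdom c)" and open_crange: "c \<in> A \<Longrightarrow> open (crange c)"
  using chart by (auto simp: is_chart_def)

lemma cdom_carrier: "c \<in> A \<Longrightarrow> p \<in> cdom c \<Longrightarrow> p \<in> carrier G"
  using openin_cdom openin_subset topspace by blast

lemma icoord_coord [simp]: "c \<in> A \<Longrightarrow> p \<in> cdom c \<Longrightarrow> icoord c (coord c p) = p"
  using inj_on_chart[OF chart] by simp

lemma coord_in_crange [simp]: "p \<in> cdom c \<Longrightarrow> coord c p \<in> crange c"
  by (simp add: crange_def)

lemma chart_at: "p \<in> carrier G \<Longrightarrow> \<exists>c\<in>A. p \<in> cdom c"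
  using smooth_manifold topspace by (auto simp: smooth_manifold_def)

lemma continuous_mult: "continuous_map (prod_topology T T) T (\<lambda>(x, y). x \<otimes> y)"
  using smooth_mult by (simp add: smooth_map_def)

lemma continuous_mult':
  assumes "continuous_map X T f" "continuous_map X T g"
  shows "continuous_map X T (\<lambda>x. f x \<otimes> g x)"
  using continuous_map_compose[OF continuous_map_pairedI[OF assms] continuous_mult] by (simp add: o_def)

lemma continuous_inverse: "continuous_map T T (\<lambda>x. inv x)"
  using smooth_inverse by (simp add: smooth_map_def)

lemma continuous_left: "g \<in> carrier G \<Longrightarrow> continuous_map T T (\<lambda>h. g \<otimes> h)"
  and continuous_right: "g \<in> carrier G \<Longrightarrow> continuous_map T T (\<lambda>h. h \<otimes> g)"
  by (auto intro!: continuous_mult' continuous_map_id[unfolded id_def] simp: topspace)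

section \<open>Multiplication and tangent maps in coordinates\<close>

definition mdom :: "('g, 'e) chart \<Rightarrow> ('g, 'e) chart \<Rightarrow> ('g, 'e) chart \<Rightarrow> ('e \<times> 'e) set" where
  "mdom b c d = {z \<in> crange b \<times> crange c. icoord b (fst z) \<otimes> icoord c (snd z) \<in> cdom d}"

definition mul :: "('g, 'e) chart \<Rightarrow> ('g, 'e) chart \<Rightarrow> ('g, 'e) chart \<Rightarrow> 'e \<times> 'e \<Rightarrow> 'e" where
  "mul b c d z = coord d (icoord b (fst z) \<otimes> icoord c (snd z))"

lemma open_mdom:
  assumes "b \<in> A" "c \<in> A" "d \<in> A" shows "open (mdom b c d)"
proof -
  let ?X = "top_of_set (crange b \<times> crange c)"
  have o: "open (crange b \<times> crange c)" using assms by (intro open_Times open_crange)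
  have "continuous_map ?X (top_of_set (crange b)) fst" "continuous_map ?X (top_of_set (crange c)) snd"
    by (auto intro: continuous_intros)
  then have "continuous_map ?X T (icoord b \<circ> fst)" "continuous_map ?X T (icoord c \<circ> snd)"
    using continuous_inv_chart[OF chart] assms by (blast intro: continuous_map_compose)+
  from continuous_mult'[OF this]
  have "openin ?X {z \<in> topspace ?X. icoord b (fst z) \<otimes> icoord c (snd z) \<in> cdom d}"
    by (intro openin_continuous_map_preimage[OF _ openin_cdom[OF assms(3)]]) (simp add: o_def)
  then show ?thesis using o by (simp add: openin_open_eq mdom_def)
qed

text \<open>The local representation in a product chart inverts a product of coordinate maps. On the
  open set \<open>mdom\<close> that inverse is the pair of the two inverses, so the representation
  is \<open>mul\<close> there.\<close>

lemma smooth_mul: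
  assumes "b \<in> A" "c \<in> A" "d \<in> A" shows "smooth_on (mdom b c d) (mul b c d)"
proof -
  let ?bc = "(cdom b \<times> cdom c, map_prod (coord b) (coord c))"
  let ?m = "\<lambda>(x, y). x \<otimes> y"
  have "?bc \<in> prod_atlas A A" unfolding prod_atlas_def using assms by blast
  then have s: "smooth_on (coord ?bc ` {p \<in> cdom ?bc. ?m p \<in> cdom d}) (local_rep ?bc d ?m)"
    using smooth_mult assms(3) by (auto simp: smooth_map_def)
  have bc: "cdom ?bc = cdom b \<times> cdom c" "coord ?bc = map_prod (coord b) (coord c)"
    by (simp_all add: cdom_def coord_def)
  have dom: "coord ?bc ` {p \<in> cdom ?bc. ?m p \<in> cdom d} = mdom b c d"
  proof (intro equalityI subsetI)
    fix z assume "z \<in> coord ?bc ` {p \<in> cdom ?bc. ?m p \<in> cdom d}"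
    then show "z \<in> mdom b c d" using assms unfolding bc by (auto simp: mdom_def)
  next
    fix z assume z: "z \<in> mdom b c d"
    then have "z = coord ?bc (icoord b (fst z), icoord c (snd z))"
      "(icoord b (fst z), icoord c (snd z)) \<in> {p \<in> cdom ?bc. ?m p \<in> cdom d}"
      unfolding bc by (auto simp: mdom_def inv_chart)
    then show "z \<in> coord ?bc ` {p \<in> cdom ?bc. ?m p \<in> cdom d}" by blast
  qed
  have inj: "inj_on (coord ?bc) (cdom ?bc)"
    unfolding bc using assms inj_on_chart[OF chart] by (intro map_prod_inj_on) auto
  have "local_rep ?bc d ?m z = mul b c d z" if "z \<in> mdom b c d" for z
  proof -
    have "inv_into (cdom ?bc) (coord ?bc) z = (icoord b (fst z), icoord c (snd z))"
      by (rule inv_into_f_eq[OF inj]) (use that in \<open>auto simp: bc mdom_def inv_chart\<close>)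
    then show ?thesis by (simp add: local_rep_def mul_def)
  qed
  then show ?thesis by (rule smooth_on_cong[OF open_mdom[OF assms] _ s[unfolded dom]])
qed

text \<open>Determinants of tangent maps require differentiability in all charts, rather than
  smoothness; it is preserved under composition by the chain rule alone.\<close>

definition chart_diff :: "('g \<Rightarrow> 'g) \<Rightarrow> bool" where
  "chart_diff F \<longleftrightarrow> continuous_map T T F \<and>
     (\<forall>c\<in>A. \<forall>d\<in>A. \<forall>p\<in>cdom c. F p \<in> cdom d \<longrightarrow> local_rep c d F differentiable (at (coord c p)))"

text \<open>The tangent map of \<open>F\<close> at \<open>p\<close>, read in the charts
  \<open>c\<close> and \<open>d\<close> as a map of the model space.\<close>

definition TD :: "('g, 'e) chart \<Rightarrow> ('g, 'e) chart \<Rightarrow> ('g \<Rightarrow> 'g) \<Rightarrow> 'g \<Rightarrow> 'e \<Rightarrow> 'e" where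
  "TD c d F p = frechet_derivative (local_rep c d F) (at (coord c p))"

lemma TD_has_derivative:
  assumes "chart_diff F" "c \<in> A" "d \<in> A" "p \<in> cdom c" "F p \<in> cdom d"
  shows "(local_rep c d F has_derivative TD c d F p) (at (coord c p))"
  using assms unfolding chart_diff_def TD_def by (simp add: frechet_derivative_works)

lemma TD_linear:
  "chart_diff F \<Longrightarrow> c \<in> A \<Longrightarrow> d \<in> A \<Longrightarrow> p \<in> cdom c \<Longrightarrow> F p \<in> cdom d \<Longrightarrow> linear (TD c d F p)"
  using TD_has_derivative has_derivative_linear by blast

lemma open_coord_preimage:
  assumes "continuous_map T T F" "c \<in> A" "d \<in> A"
  shows "open (coord c ` {q \<in> cdom c. F q \<in> cdom d})"
proof -
  have "openin T {q \<in> topspace T. F q \<in> cdom d}"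
    using assms openin_cdom by (intro openin_continuous_map_preimage)
  then have "openin T (cdom c \<inter> {q \<in> topspace T. F q \<in> cdom d})"
    using assms openin_cdom by (intro openin_Int)
  moreover have "cdom c \<inter> {q \<in> topspace T. F q \<in> cdom d} = {q \<in> cdom c. F q \<in> cdom d}"
    using cdom_carrier[OF assms(2)] topspace by auto
  ultimately show ?thesis using chart[OF assms(2)] by (intro open_chart_image) auto
qed

text \<open>The composite factors through the chart \<open>d\<close> on the set of points that
  \<open>F\<close> sends into its domain, which is open.\<close>

lemma TD_chain:
  assumes F: "chart_diff F" and F': "chart_diff F'" and A: "c \<in> A" "d \<in> A" "e \<in> A"
    and p: "p \<in> cdom c" "F p \<in> cdom d" "F' (F p) \<in> cdom e"
  shows "(local_rep c e (\<lambda>x. F' (F x)) has_derivative (\<lambda>v. TD d e F' (F p) (TD c d F p v))) (at (coord c p))"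
proof -
  let ?S = "coord c ` {q \<in> cdom c. F q \<in> cdom d}"
  have 1: "(local_rep c d F has_derivative TD c d F p) (at (coord c p))"
    by (rule TD_has_derivative) fact+
  have "local_rep c d F (coord c p) = coord d (F p)" using A p by (simp add: local_rep_def)
  then have 2: "(local_rep d e F' has_derivative TD d e F' (F p)) (at (local_rep c d F (coord c p)))"
    using TD_has_derivative[OF F' A(2,3) p(2,3)] by simp
  show ?thesis
  proof (rule has_derivative_transform_within_open[OF has_derivative_compose[OF 1 2]])
    show "open ?S" using F A by (intro open_coord_preimage) (auto simp: chart_diff_def)
    show "coord c p \<in> ?S" using p by auto
    show "local_rep d e F' (local_rep c d F x) = local_rep c e (\<lambda>x. F' (F x)) x" if "x \<in> ?S" for x
      using that A by (auto simp: local_rep_def)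
  qed
qed

lemma TD_comp:
  assumes "chart_diff F" "chart_diff F'" "c \<in> A" "d \<in> A" "e \<in> A"
    "p \<in> cdom c" "F p \<in> cdom d" "F' (F p) \<in> cdom e"
  shows "TD c e (\<lambda>x. F' (F x)) p v = TD d e F' (F p) (TD c d F p v)"
  using frechet_derivative_at[OF TD_chain[OF assms]] unfolding TD_def[of c e] by metis

lemma chart_diff_carrier:
  assumes "chart_diff F" "p \<in> carrier G" shows "F p \<in> carrier G"
proof -
  have "continuous_map T T F" using assms by (simp add: chart_diff_def)
  from continuous_map_image_subset_topspace[OF this] show ?thesis
    using assms(2) unfolding topspace by blast
qed

lemma chart_diff_comp:
  assumes "chart_diff F" "chart_diff F'" shows "chart_diff (\<lambda>x. F' (F x))"
  unfolding chart_diff_def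
proof (intro conjI ballI impI)
  show "continuous_map T T (\<lambda>x. F' (F x))"
    using assms continuous_map_compose[of T T F T F'] by (simp add: chart_diff_def o_def)
  fix c e p assume *: "c \<in> A" "e \<in> A" "p \<in> cdom c" "F' (F p) \<in> cdom e"
  then have "F p \<in> carrier G" using chart_diff_carrier[OF assms(1)] cdom_carrier by blast
  then obtain d where "d \<in> A" "F p \<in> cdom d" using chart_at by blast
  from TD_chain[OF assms *(1) this(1) *(2) *(3) this(2) *(4)]
  show "local_rep c e (\<lambda>x. F' (F x)) differentiable at (coord c p)" by (rule differentiableI)
qed

text \<open>Charts see only points of the carrier. This allows group laws, which hold only there, to
  be used inside tangent maps.\<close>

lemma chart_diff_cong:
  assumes "chart_diff F" "\<And>q. q \<in> carrier G \<Longrightarrow> F q = F' q"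
  shows "chart_diff F'" and "c \<in> A \<Longrightarrow> d \<in> A \<Longrightarrow> p \<in> cdom c \<Longrightarrow> F p \<in> cdom d \<Longrightarrow> TD c d F p = TD c d F' p"
proof -
  have d: "(local_rep c d F' has_derivative TD c d F p) (at (coord c p))"
    if "c \<in> A" "d \<in> A" "p \<in> cdom c" "F p \<in> cdom d" for c d p
  proof (rule has_derivative_transform_within_open[OF TD_has_derivative[OF assms(1) that] open_crange[OF that(1)]])
    show "coord c p \<in> crange c" using that by simp
    show "local_rep c d F x = local_rep c d F' x" if "x \<in> crange c" for x
      using assms(2) cdom_carrier[OF \<open>c \<in> A\<close> inv_chart(1)[OF that]] by (simp add: local_rep_def)
  qed
  then show "c \<in> A \<Longrightarrow> d \<in> A \<Longrightarrow> p \<in> cdom c \<Longrightarrow> F p \<in> cdom d \<Longrightarrow> TD c d F p = TD c d F' p"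
    using frechet_derivative_at unfolding TD_def by blast
  show "chart_diff F'" unfolding chart_diff_def
  proof (intro conjI ballI impI)
    show "continuous_map T T F'"
      using assms by (intro continuous_map_eq[of T T F F']) (auto simp: chart_diff_def topspace)
    show "local_rep c d F' differentiable at (coord c p)"
      if "c \<in> A" "d \<in> A" "p \<in> cdom c" "F' p \<in> cdom d" for c d p
      using d[OF that(1-3)] that(4) assms(2) cdom_carrier[OF that(1,3)] by (auto intro: differentiableI)
  qed
qed

lemma chart_diff_id: "chart_diff (\<lambda>p. p)"
  unfolding chart_diff_def
proof (intro conjI ballI impI)
  fix c d p assume *: "c \<in> A" "d \<in> A" "p \<in> cdom c" "p \<in> cdom d"
  have "smooth_on (coord c ` (cdom c \<inter> cdom d)) (local_rep c d (\<lambda>p. p))"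
    using smooth_manifold * by (auto simp: smooth_manifold_def)
  from smooth_on_has_derivative[OF this, of "coord c p"] *
  show "local_rep c d (\<lambda>p. p) differentiable at (coord c p)" by (auto intro: differentiableI)
qed (simp add: continuous_map_id[unfolded id_def])

lemma TD_id:
  assumes "c \<in> A" "p \<in> cdom c" shows "TD c c (\<lambda>p. p) p v = v"
proof -
  have "(local_rep c c (\<lambda>p. p) has_derivative (\<lambda>v. v)) (at (coord c p))"
  proof (rule has_derivative_transform_within_open[OF has_derivative_ident open_crange[OF assms(1)]])
    show "coord c p \<in> crange c" using assms by simp
    show "x = local_rep c c (\<lambda>p. p) x" if "x \<in> crange c" for x
      using inv_chart(2)[OF that] by (simp add: local_rep_def)
  qed
  from frechet_derivative_at[OF this] show ?thesis by (metis TD_def)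
qed

text \<open>In coordinates the translations are slices of \<open>mul\<close>, so their derivatives
  are its two partial derivatives.\<close>

lemma translation_has_derivative:
  assumes "b \<in> A" "c \<in> A" "d \<in> A" "g \<in> cdom b" "p \<in> cdom c"
  shows "g \<otimes> p \<in> cdom d \<Longrightarrow> (local_rep c d (\<lambda>h. g \<otimes> h) has_derivative
      (\<lambda>v. frechet_derivative (mul b c d) (at (coord b g, coord c p)) (0, v))) (at (coord c p))"
    and "g \<otimes> p \<in> cdom d \<Longrightarrow> (local_rep b d (\<lambda>h. h \<otimes> p) has_derivative
      (\<lambda>u. frechet_derivative (mul b c d) (at (coord b g, coord c p)) (u, 0))) (at (coord b g))"
proof -
  assume gp: "g \<otimes> p \<in> cdom d"
  have "(coord b g, coord c p) \<in> mdom b c d" using assms gp by (simp add: mdom_def)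
  then have *: "(mul b c d has_derivative frechet_derivative (mul b c d) (at (coord b g, coord c p)))
      (at (coord b g, coord c p))"
    using assms by (intro smooth_on_has_derivative[OF smooth_mul])
  have "local_rep c d (\<lambda>h. g \<otimes> h) = (\<lambda>y. mul b c d (coord b g, y))"
    "local_rep b d (\<lambda>h. h \<otimes> p) = (\<lambda>x. mul b c d (x, coord c p))"
    using assms by (simp_all add: local_rep_def mul_def fun_eq_iff)
  with has_derivative_slice[OF *]
  show "(local_rep c d (\<lambda>h. g \<otimes> h) has_derivative
      (\<lambda>v. frechet_derivative (mul b c d) (at (coord b g, coord c p)) (0, v))) (at (coord c p))"
    "(local_rep b d (\<lambda>h. h \<otimes> p) has_derivative
      (\<lambda>u. frechet_derivative (mul b c d) (at (coord b g, coord c p)) (u, 0))) (at (coord b g))"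
    by simp_all
qed

lemma TD_left:
  assumes "b \<in> A" "c \<in> A" "d \<in> A" "g \<in> cdom b" "p \<in> cdom c" "g \<otimes> p \<in> cdom d"
  shows "TD c d (\<lambda>h. g \<otimes> h) p v = frechet_derivative (mul b c d) (at (coord b g, coord c p)) (0, v)"
  using frechet_derivative_at[OF translation_has_derivative(1)[OF assms]] unfolding TD_def by metis

lemma TD_right:
  assumes "b \<in> A" "c \<in> A" "d \<in> A" "g \<in> cdom b" "p \<in> cdom c" "g \<otimes> p \<in> cdom d"
  shows "TD b d (\<lambda>h. h \<otimes> p) g u = frechet_derivative (mul b c d) (at (coord b g, coord c p)) (u, 0)"
  using frechet_derivative_at[OF translation_has_derivative(2)[OF assms]] unfolding TD_def by metis

lemma chart_diff_left: "g \<in> carrier G \<Longrightarrow> chart_diff (\<lambda>h. g \<otimes> h)"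
  unfolding chart_diff_def
proof (intro conjI ballI impI)
  assume g: "g \<in> carrier G"
  then show "continuous_map T T (\<lambda>h. g \<otimes> h)" by (rule continuous_left)
  obtain b where "b \<in> A" "g \<in> cdom b" using chart_at[OF g] by blast
  then show "local_rep c d (\<lambda>h. g \<otimes> h) differentiable (at (coord c p))"
    if "c \<in> A" "d \<in> A" "p \<in> cdom c" "g \<otimes> p \<in> cdom d" for c d p
    using translation_has_derivative(1)[of b c d g p] that by (blast intro: differentiableI)
qed

lemma chart_diff_right: "g \<in> carrier G \<Longrightarrow> chart_diff (\<lambda>h. h \<otimes> g)"
  unfolding chart_diff_def
proof (intro conjI ballI impI)
  assume g: "g \<in> carrier G"
  then show "continuous_map T T (\<lambda>h. h \<otimes> g)" by (rule continuous_right)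
  obtain b where "b \<in> A" "g \<in> cdom b" using chart_at[OF g] by blast
  then show "local_rep c d (\<lambda>h. h \<otimes> g) differentiable (at (coord c p))"
    if "c \<in> A" "d \<in> A" "p \<in> cdom c" "p \<otimes> g \<in> cdom d" for c d p
    using translation_has_derivative(2)[of c b d p g] that by (blast intro: differentiableI)
qed

lemma TD_left_left:
  assumes "g \<in> carrier G" "h \<in> carrier G" "c \<in> A" "d \<in> A" "e \<in> A"
    "p \<in> cdom c" "h \<otimes> p \<in> cdom d" "g \<otimes> (h \<otimes> p) \<in> cdom e"
  shows "TD d e (\<lambda>x. g \<otimes> x) (h \<otimes> p) (TD c d (\<lambda>x. h \<otimes> x) p v) = TD c e (\<lambda>x. (g \<otimes> h) \<otimes> x) p v"
proof -
  have "chart_diff (\<lambda>x. (g \<otimes> h) \<otimes> x)" using assms by (intro chart_diff_left) simp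
  moreover have "(g \<otimes> h) \<otimes> x = g \<otimes> (h \<otimes> x)" if "x \<in> carrier G" for x using that assms m_assoc by simp
  ultimately have "TD c e (\<lambda>x. (g \<otimes> h) \<otimes> x) p = TD c e (\<lambda>x. g \<otimes> (h \<otimes> x)) p"
    using assms cdom_carrier by (intro chart_diff_cong(2)) auto
  then show ?thesis using assms TD_comp[OF chart_diff_left chart_diff_left] by simp
qed

end

section \<open>Left-invariant fields as vectors at the identity\<close>

locale lie_grp_base = lie_grp +
  fixes c0
  assumes c0: "c0 \<in> A" and one_c0: "\<one> \<in> cdom c0"
begin

definition a0 where "a0 = coord c0 \<one>"

text \<open>The left-invariant field with value \<open>v\<close> at the identity, \<open>v\<close>
  being read in \<open>c0\<close>. The value 0 elsewhere follows the convention of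
  \<open>vector_field\<close>.\<close>

definition left_field :: "'c \<Rightarrow> ('a, 'c) vfield" where
  "left_field v c x = (if c \<in> A \<and> x \<in> crange c then TD c0 c (\<lambda>h. icoord c x \<otimes> h) \<one> v else 0)"

lemma left_field_coord:
  "c \<in> A \<Longrightarrow> p \<in> cdom c \<Longrightarrow> left_field v c (coord c p) = TD c0 c (\<lambda>h. p \<otimes> h) \<one> v"
  by (simp add: left_field_def)

text \<open>A partial derivative of the multiplication along the slice through the identity: this
  form shows that the field is smooth in \<open>x\<close> and later gives its derivative.\<close>

lemma left_field_mul:
  assumes "c \<in> A" "x \<in> crange c"
  shows "left_field v c x = frechet_derivative (mul c c0 c) (at (x, a0)) (0, v)"
  using TD_left[of c c0 c "icoord c x" \<one> v] assms c0 one_c0 inv_chart[OF assms(2)]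
    cdom_carrier[OF assms(1) inv_chart(1)[OF assms(2)]]
  by (simp add: left_field_def a0_def)

lemma mdom_slice:
  assumes "c \<in> A" shows "{x. (x, a0) \<in> mdom c c0 c} = crange c"
proof -
  have "icoord c x \<otimes> \<one> = icoord c x" if "x \<in> crange c" for x
    using cdom_carrier[OF assms inv_chart(1)[OF that]] by simp
  then show ?thesis using inv_chart(1)[of _ c] c0 one_c0 by (auto simp: mdom_def a0_def)
qed

lemma left_field_smooth:
  assumes "c \<in> A" shows "smooth_on (crange c) (left_field v c)"
proof -
  have "smooth_on {x. (x, a0) \<in> mdom c c0 c} (\<lambda>x. frechet_derivative (mul c c0 c) (at (x, a0)) (0, v))"
    using assms c0 by (intro smooth_on_slice[of _ "\<lambda>z. frechet_derivative (mul c c0 c) (at z) (0, v)"]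
        smooth_on_frechet_derivative smooth_mul open_mdom)
  then show ?thesis unfolding mdom_slice[OF assms]
    by (rule smooth_on_cong[OF open_crange[OF assms], rotated]) (simp add: left_field_mul assms)
qed

lemma left_field_related:
  assumes "g \<in> carrier G"
  shows "related_by A A (\<lambda>h. g \<otimes> h) (left_field v) (left_field v)"
  unfolding related_by_def
proof (intro ballI impI)
  fix c d p assume *: "c \<in> A" "d \<in> A" "p \<in> cdom c" "g \<otimes> p \<in> cdom d"
  then have p: "p \<in> carrier G" using cdom_carrier by blast
  show "left_field v d (coord d (g \<otimes> p)) =
      frechet_derivative (local_rep c d ((\<otimes>) g)) (at (coord c p)) (left_field v c (coord c p))"
    using TD_left_left[of g p c0 c d \<one> v] * p assms c0 one_c0
    by (simp add: left_field_coord flip: TD_def)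
qed

lemma left_field_in_lie_algebra: "left_field v \<in> lie_algebra G A"
proof -
  have "related_by A A (\<lambda>p. p) (left_field v) (left_field v)"
    unfolding related_by_def
  proof (intro ballI impI)
    fix c d p assume *: "c \<in> A" "d \<in> A" "p \<in> cdom c" "p \<in> cdom d"
    then have p: "p \<in> carrier G" using cdom_carrier by blast
    show "left_field v d (coord d p) =
        frechet_derivative (local_rep c d (\<lambda>p. p)) (at (coord c p)) (left_field v c (coord c p))"
      using TD_comp[OF chart_diff_left[OF p] chart_diff_id, of c0 c d \<one> v] * p c0 one_c0
      by (simp add: left_field_coord flip: TD_def)
  qed
  moreover have "\<forall>c x. c \<notin> A \<or> x \<notin> crange c \<longrightarrow> left_field v c x = 0"
    by (auto simp: left_field_def)
  ultimately show ?thesis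
    by (simp add: lie_algebra_def vector_field_def left_field_smooth left_field_related)
qed

text \<open>Invariance under left translation by a point determines the field at that point from its
  value at the identity; where charts give no information both sides are 0.\<close>

lemma lie_algebra_left_field:
  assumes "X \<in> lie_algebra G A" shows "X = left_field (X c0 a0)"
proof (intro ext)
  fix c x
  show "X c x = left_field (X c0 a0) c x"
  proof (cases "c \<in> A \<and> x \<in> crange c")
    case True
    let ?p = "icoord c x"
    have p: "?p \<in> cdom c" "coord c ?p = x" "?p \<in> carrier G"
      using True inv_chart[of x c] cdom_carrier[of c "icoord c x"] by simp_all
    have "related_by A A (\<lambda>h. ?p \<otimes> h) X X" using assms p unfolding lie_algebra_def by blast
    from this[unfolded related_by_def, rule_format, of c0 c \<one>]
    have "X c (coord c (?p \<otimes> \<one>)) = TD c0 c (\<lambda>h. ?p \<otimes> h) \<one> (X c0 (coord c0 \<one>))"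
      using True p c0 one_c0 by (simp add: TD_def)
    then show ?thesis using True p by (simp add: left_field_def a0_def)
  next
    case False
    have "\<forall>c x. c \<notin> A \<or> x \<notin> crange c \<longrightarrow> X c x = 0"
      using assms unfolding lie_algebra_def vector_field_def by blast
    then have "X c x = 0" using False by blast
    then show ?thesis unfolding left_field_def if_not_P[OF False] .
  qed
qed

lemma left_field_linear:
  assumes "c \<in> A" "x \<in> crange c" shows "linear (\<lambda>v. left_field v c x)"
proof -
  have p: "icoord c x \<in> cdom c" by (rule inv_chart(1)[OF assms(2)])
  then have p': "icoord c x \<in> carrier G" by (rule cdom_carrier[OF assms(1)])
  have "linear (TD c0 c (\<lambda>h. icoord c x \<otimes> h) \<one>)"
    by (rule TD_linear[OF chart_diff_left[OF p'] c0 assms(1) one_c0]) (simp add: p p')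
  then show ?thesis using assms by (simp add: left_field_def)
qed

lemma left_field_base: "left_field v c0 a0 = v"
proof -
  have "TD c0 c0 (\<lambda>h. h) \<one> = TD c0 c0 (\<lambda>h. \<one> \<otimes> h) \<one>"
    using c0 one_c0 by (intro chart_diff_cong(2) chart_diff_id) auto
  then show ?thesis using c0 one_c0 TD_id[of c0 \<one> v] by (simp add: a0_def left_field_coord)
qed

text \<open>Left translation by the inverse of the point carries the value back to
  \<open>v\<close>.\<close>

lemma left_field_inj:
  assumes "c \<in> A" "x \<in> crange c" shows "inj (\<lambda>v. left_field v c x)"
proof (rule inj_on_inverseI)
  fix v
  let ?p = "icoord c x"
  have p: "?p \<in> cdom c" "coord c ?p = x" "?p \<in> carrier G"
    using assms inv_chart[of x c] cdom_carrier[of c "icoord c x"] by simp_all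
  have "TD c c0 (\<lambda>h. inv ?p \<otimes> h) ?p (left_field v c x) = TD c0 c0 (\<lambda>h. (inv ?p \<otimes> ?p) \<otimes> h) \<one> v"
    using TD_left_left[of "inv ?p" ?p c0 c c0 \<one> v] p assms c0 one_c0 by (simp add: left_field_def)
  also have "\<dots> = left_field v c0 a0"
    using p c0 one_c0 by (simp add: left_field_coord a0_def)
  finally show "TD c c0 (\<lambda>h. inv ?p \<otimes> h) ?p (left_field v c x) = v" by (simp add: left_field_base)
qed

end

section \<open>Left Haar measure\<close>

lemma ennreal_suminf_swap:
  fixes a :: "nat \<Rightarrow> nat \<Rightarrow> ennreal"
  shows "(\<Sum>i. \<Sum>j. a i j) = (\<Sum>j. \<Sum>i. a i j)"
proof -
  have "(\<Sum>i. \<Sum>j. a i j) = (\<integral>\<^sup>+ i. (\<Sum>j. a i j) \<partial>count_space UNIV)"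
    by (simp add: nn_integral_count_space_nat)
  also have "\<dots> = (\<Sum>j. \<integral>\<^sup>+ i. a i j \<partial>count_space UNIV)"
    by (rule nn_integral_suminf) simp
  finally show ?thesis by (simp add: nn_integral_count_space_nat)
qed

text \<open>Passage between the nonnegative integral, in which the measure is built, and absolute
  integrability, in which the change of variables is stated.\<close>

lemma nn_integral_eq_ennreal_iff:
  fixes f :: "'a::euclidean_space \<Rightarrow> real"
  assumes f: "f \<in> borel_measurable borel" "\<And>x. 0 \<le> f x" and S: "S \<in> sets borel" and r: "0 \<le> r"
  shows "(\<integral>\<^sup>+x. ennreal (f x) * indicator S x \<partial>lborel) = ennreal r \<longleftrightarrow>
     f absolutely_integrable_on S \<and> integral S f = r"
proof
  assume *: "(\<integral>\<^sup>+x. ennreal (f x) * indicator S x \<partial>lborel) = ennreal r"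
  have e: "ennreal (f x) * indicator S x = ennreal (indicator S x * f x)" for x
    by (simp split: split_indicator)
  have "((\<lambda>x. indicator S x * f x) has_integral r) UNIV"
    using f S r * unfolding e by (intro nn_integral_has_integral) auto
  also have "(\<lambda>x. indicator S x * f x) = (\<lambda>x. if x \<in> S then f x else 0)"
    by (auto simp: fun_eq_iff split: split_indicator)
  finally have "(f has_integral r) S" by (simp only: has_integral_restrict_UNIV)
  then show "f absolutely_integrable_on S \<and> integral S f = r"
    using f(2) by (auto simp: absolutely_integrable_on_iff_nonneg integral_unique)
next
  assume *: "f absolutely_integrable_on S \<and> integral S f = r"
  then have "(f has_integral r) S"
    using set_lebesgue_integral_eq_integral(1) by (metis integrable_integral)
  then show "(\<integral>\<^sup>+x. ennreal (f x) * indicator S x \<partial>lborel) = ennreal r"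
    using f(2) by (intro nn_integral_has_integral_lebesgue')
qed

text \<open>The Jacobian equation turns the transformed integrand into k f. The change of variables
  is an equivalence of integrability, so an infinite integral over \<open>S\<close> forces an
  infinite one over the image.\<close>

lemma nn_integral_change_of_variables:
  fixes \<phi> :: "real^'n::{finite,wellorder} \<Rightarrow> real^'n::_"
  assumes f: "f \<in> borel_measurable borel" "\<And>x. 0 \<le> f x"
    and S: "S \<in> sets borel" "\<phi> ` S \<in> sets borel" "inj_on \<phi> S"
    and der: "\<And>x. x \<in> S \<Longrightarrow> (\<phi> has_derivative \<phi>' x) (at x)"
    and k: "k > 0" "\<And>x. x \<in> S \<Longrightarrow> \<bar>det (matrix (\<phi>' x))\<bar> * f (\<phi> x) = k * f x"
  shows "(\<integral>\<^sup>+x. ennreal (f x) * indicator (\<phi> ` S) x \<partial>lborel) =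
    ennreal k * (\<integral>\<^sup>+x. ennreal (f x) * indicator S x \<partial>lborel)"
proof -
  let ?I = "\<lambda>S. \<integral>\<^sup>+x. ennreal (f x) * indicator S x \<partial>lborel"
  \<comment> \<open>The change of variables is for vector-valued functions, hence the detour through
    \<open>real^1\<close>.\<close>
  let ?v = "\<lambda>x. vec (f x) :: real^1"
  have cov: "(\<lambda>x. k * f x) absolutely_integrable_on S \<and> integral S (\<lambda>x. k * f x) = b \<longleftrightarrow>
      f absolutely_integrable_on (\<phi> ` S) \<and> integral (\<phi> ` S) f = b" for b
  proof -
    have "(\<lambda>x. \<bar>det (matrix (\<phi>' x))\<bar> *\<^sub>R ?v (\<phi> x)) absolutely_integrable_on S \<and>
           integral S (\<lambda>x. \<bar>det (matrix (\<phi>' x))\<bar> *\<^sub>R ?v (\<phi> x)) = vec b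
     \<longleftrightarrow> ?v absolutely_integrable_on (\<phi> ` S) \<and> integral (\<phi> ` S) ?v = vec b"
      using S der by (intro has_absolute_integral_change_of_variables) (auto intro: has_derivative_at_withinI)
    then have "(\<lambda>x. \<bar>det (matrix (\<phi>' x))\<bar> * f (\<phi> x)) absolutely_integrable_on S \<and>
           integral S (\<lambda>x. \<bar>det (matrix (\<phi>' x))\<bar> * f (\<phi> x)) = b
     \<longleftrightarrow> f absolutely_integrable_on (\<phi> ` S) \<and> integral (\<phi> ` S) f = b"
      by (simp add: absolutely_integrable_on_1_iff integral_on_1_eq vec_eq_iff)
    moreover have "(\<lambda>x. \<bar>det (matrix (\<phi>' x))\<bar> * f (\<phi> x)) absolutely_integrable_on S \<longleftrightarrow>
        (\<lambda>x. k * f x) absolutely_integrable_on S"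
      using k(2) by (intro set_integrable_cong) auto
    moreover have "integral S (\<lambda>x. \<bar>det (matrix (\<phi>' x))\<bar> * f (\<phi> x)) = integral S (\<lambda>x. k * f x)"
      using k(2) by (intro Henstock_Kurzweil_Integration.integral_cong) auto
    ultimately show ?thesis by simp
  qed
  have ai: "(\<lambda>x. k * f x) absolutely_integrable_on S \<longleftrightarrow> f absolutely_integrable_on S"
    using k(1) set_integrable_mult_right_iff[of k lebesgue S f] by simp
  show ?thesis
  proof (cases "?I S")
    case (real r)
    then have "f absolutely_integrable_on S" "integral S f = r"
      using nn_integral_eq_ennreal_iff[OF f S(1)] by auto
    then have "(\<lambda>x. k * f x) absolutely_integrable_on S \<and> integral S (\<lambda>x. k * f x) = k * r"
      using ai by simp
    then have "f absolutely_integrable_on (\<phi> ` S) \<and> integral (\<phi> ` S) f = k * r"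
      using cov[of "k * r"] by blast
    then have "?I (\<phi> ` S) = ennreal (k * r)"
      using nn_integral_eq_ennreal_iff[OF f S(2), of "k * r"] real(1) k(1) by simp
    then show ?thesis using real k(1) by (simp add: ennreal_mult)
  next
    case top
    have "?I (\<phi> ` S) = top_class.top"
    proof (cases "?I (\<phi> ` S)")
      case (real r)
      then have "f absolutely_integrable_on (\<phi> ` S)" using nn_integral_eq_ennreal_iff[OF f S(2)] by auto
      then have "(\<lambda>x. k * f x) absolutely_integrable_on S" using cov by blast
      then have "f absolutely_integrable_on S" using ai by simp
      then have "?I S = ennreal (integral S f)"
        using nn_integral_eq_ennreal_iff[OF f S(1), of "integral S f"] f(2)
        by (simp add: integral_nonneg set_lebesgue_integral_eq_integral(1))
      then show ?thesis using top by simp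
    qed
    then show ?thesis using top k(1) by (simp add: ennreal_mult_top)
  qed
qed

lemma det_matrix_compose:
  fixes f g :: "real^'n \<Rightarrow> real^'n"
  assumes "linear f" "linear g"
  shows "det (matrix (\<lambda>x. g (f x))) = det (matrix g) * det (matrix f)"
  using matrix_compose[OF assms] by (simp add: det_mul o_def)

locale lie_grp_vec = lie_grp_base G T A c0
  for G (structure) and T :: "'g topology" and A :: "('g, real^'n::{finite,wellorder}) chart set" and c0
begin

text \<open>The density of left Haar measure in \<open>c0\<close>: the reciprocal of the coordinate
  volume spanned by the left-invariant fields of the standard basis, so that this frame has unit
  volume everywhere.\<close>

definition density_fun :: "real^'n::_ \<Rightarrow> real" where
  "density_fun x = (if x \<in> crange c0 then 1 / \<bar>det (matrix (\<lambda>v. left_field v c0 x))\<bar> else 0)"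

lemma det_left_field: "x \<in> crange c0 \<Longrightarrow> det (matrix (\<lambda>v. left_field v c0 x)) \<noteq> 0"
  using left_field_linear[OF c0] left_field_inj[OF c0] det_nz_iff_inj by blast

lemma density_fun_nonneg: "0 \<le> density_fun x"
  and density_fun_pos: "x \<in> crange c0 \<Longrightarrow> 0 < density_fun x"
  using det_left_field by (auto simp: density_fun_def)

lemma continuous_density_fun: "continuous_on (crange c0) density_fun"
proof -
  have "continuous_on (crange c0) (\<lambda>x. 1 / \<bar>det (matrix (\<lambda>v. left_field v c0 x))\<bar>)"
    unfolding det_def matrix_def
    using det_left_field smooth_on_continuous_on[OF left_field_smooth[OF c0]]
    by (intro continuous_intros ballI) (auto simp: det_def matrix_def)
  then show ?thesis by (simp add: density_fun_def cong: continuous_on_cong)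
qed

lemma borel_crange: "crange c0 \<in> sets borel"
  using open_crange[OF c0] by (rule borel_open)

lemma borel_density_fun: "density_fun \<in> borel_measurable borel"
proof -
  have "(\<lambda>x. indicator (crange c0) x *\<^sub>R density_fun x) \<in> borel_measurable borel"
    by (rule borel_measurable_continuous_on_indicator[OF borel_crange continuous_density_fun])
  also have "(\<lambda>x. indicator (crange c0) x *\<^sub>R density_fun x) = density_fun"
    by (auto simp: density_fun_def indicator_def)
  finally show ?thesis .
qed

text \<open>Carries the Borel \<sigma>-algebra of the group; the invariant measure on these sets is
  \<open>haar\<close>.\<close>

definition Gm :: "'g measure" where
  "Gm = sigma (carrier G) {V. openin T V}"

lemma space_Gm [simp]: "space Gm = carrier G"
  unfolding Gm_def by (rule space_measure_of_conv)

lemma open_Pow: "{V. openin T V} \<subseteq> Pow (carrier G)"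
  using openin_subset topspace by blast

lemma sets_Gm_subset: "E \<in> sets Gm \<Longrightarrow> E \<subseteq> carrier G"
  using sets.sets_into_space by fastforce

lemma open_sets_Gm: "openin T V \<Longrightarrow> V \<in> sets Gm"
  unfolding Gm_def using open_Pow by simp

lemma continuous_measurable_Gm: "continuous_map T T F \<Longrightarrow> F \<in> measurable Gm Gm"
  unfolding Gm_def
proof (rule measurable_measure_of[OF open_Pow])
  assume F: "continuous_map T T F"
  show "F \<in> space (sigma (carrier G) {V. openin T V}) \<rightarrow> carrier G"
    using continuous_map_image_subset_topspace[OF F] by (auto simp: topspace space_measure_of_conv)
  fix V assume "V \<in> {V. openin T V}"
  then have "openin T {x \<in> topspace T. F x \<in> V}" using F by (auto intro: openin_continuous_map_preimage)
  moreover have "{x \<in> topspace T. F x \<in> V} = F -` V \<inter> space (sigma (carrier G) {V. openin T V})"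
    by (auto simp: topspace space_measure_of_conv)
  ultimately show "F -` V \<inter> space (sigma (carrier G) {V. openin T V}) \<in> sets (sigma (carrier G) {V. openin T V})"
    using open_Pow by simp
qed

definition cset :: "'g set \<Rightarrow> (real^'n::_) set" where
  "cset E = {x \<in> crange c0. icoord c0 x \<in> E}"

lemma borel_cset: assumes "E \<in> sets Gm" shows "cset E \<in> sets borel"
proof -
  have "icoord c0 \<in> measurable (restrict_space borel (crange c0)) Gm"
    unfolding Gm_def
  proof (rule measurable_measure_of[OF open_Pow])
    show "icoord c0 \<in> space (restrict_space borel (crange c0)) \<rightarrow> carrier G"
      using inv_chart(1)[of _ c0] cdom_carrier[OF c0] by (auto simp: space_restrict_space)
    fix V assume "V \<in> {V. openin T V}"
    then have "openin (top_of_set (crange c0)) {x \<in> topspace (top_of_set (crange c0)). icoord c0 x \<in> V}"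
      by (intro openin_continuous_map_preimage[OF continuous_inv_chart[OF chart[OF c0]]]) simp
    then have "open {x \<in> crange c0. icoord c0 x \<in> V}"
      using open_crange[OF c0] by (simp add: openin_open_eq)
    moreover have "{x \<in> crange c0. icoord c0 x \<in> V} = icoord c0 -` V \<inter> space (restrict_space borel (crange c0))"
      by (auto simp: space_restrict_space)
    ultimately show "icoord c0 -` V \<inter> space (restrict_space borel (crange c0)) \<in> sets (restrict_space borel (crange c0))"
      using borel_crange by (auto simp: sets_restrict_space_iff space_restrict_space)
  qed
  from measurable_sets[OF this assms]
  have "icoord c0 -` E \<inter> crange c0 \<in> sets borel"
    using borel_crange by (simp add: sets_restrict_space_iff space_restrict_space)
  also have "icoord c0 -` E \<inter> crange c0 = cset E" by (auto simp: cset_def)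
  finally show ?thesis .
qed

section \<open>Two-sided translations and the modular function\<close>

definition tr :: "'g \<Rightarrow> 'g \<Rightarrow> 'g \<Rightarrow> 'g" where
  "tr h g x = h \<otimes> x \<otimes> g"

lemma tr_closed [simp]: "h \<in> carrier G \<Longrightarrow> g \<in> carrier G \<Longrightarrow> x \<in> carrier G \<Longrightarrow> tr h g x \<in> carrier G"
  by (simp add: tr_def)

lemma tr_tr:
  assumes "h \<in> carrier G" "g \<in> carrier G" "h' \<in> carrier G" "g' \<in> carrier G" "x \<in> carrier G"
  shows "tr h g (tr h' g' x) = tr (h \<otimes> h') (g' \<otimes> g) x"
  using assms by (simp add: tr_def m_assoc)

lemma tr_one: "x \<in> carrier G \<Longrightarrow> tr \<one> \<one> x = x"
  by (simp add: tr_def)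

lemma tr_inv:
  assumes "h \<in> carrier G" "g \<in> carrier G" "x \<in> carrier G"
  shows "tr (inv h) (inv g) (tr h g x) = x" "tr h g (tr (inv h) (inv g) x) = x"
  using assms by (simp_all add: tr_tr tr_one)

lemma tr_image_image:
  assumes "h \<in> carrier G" "g \<in> carrier G" "h' \<in> carrier G" "g' \<in> carrier G" "E \<subseteq> carrier G"
  shows "tr h g ` tr h' g' ` E = tr (h \<otimes> h') (g' \<otimes> g) ` E"
proof -
  have "tr h g (tr h' g' x) = tr (h \<otimes> h') (g' \<otimes> g) x" if "x \<in> E" for x
    using tr_tr[OF assms(1-4)] that assms(5) by blast
  then show ?thesis unfolding image_image by (rule image_cong[OF refl])
qed

lemma inj_on_tr:
  assumes "h \<in> carrier G" "g \<in> carrier G" shows "inj_on (tr h g) (carrier G)"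
  by (rule inj_on_inverseI[of _ "tr (inv h) (inv g)"]) (rule tr_inv(1)[OF assms])

lemma chart_diff_tr:
  assumes "h \<in> carrier G" "g \<in> carrier G" shows "chart_diff (tr h g)"
  using chart_diff_comp[OF chart_diff_left[OF assms(1)] chart_diff_right[OF assms(2)]]
  by (simp add: tr_def[abs_def])

lemma tr_vimage:
  assumes "h \<in> carrier G" "g \<in> carrier G" "E \<subseteq> carrier G"
  shows "tr h g ` E = tr (inv h) (inv g) -` E \<inter> carrier G"
proof (intro equalityI subsetI)
  fix y assume "y \<in> tr h g ` E"
  then obtain x where x: "x \<in> E" "y = tr h g x" by blast
  then have "x \<in> carrier G" using assms(3) by blast
  then show "y \<in> tr (inv h) (inv g) -` E \<inter> carrier G"
    using x assms(1,2) tr_inv(1)[OF assms(1,2)] by simp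
next
  fix y assume y: "y \<in> tr (inv h) (inv g) -` E \<inter> carrier G"
  then have "y = tr h g (tr (inv h) (inv g) y)" using tr_inv(2)[OF assms(1,2)] by simp
  then show "y \<in> tr h g ` E" using y by blast
qed

lemma tr_sets:
  assumes "h \<in> carrier G" "g \<in> carrier G" "E \<in> sets Gm" shows "tr h g ` E \<in> sets Gm"
proof -
  have "continuous_map T T (tr (inv h) (inv g))"
    using chart_diff_tr assms by (simp add: chart_diff_def)
  from measurable_sets[OF continuous_measurable_Gm[OF this] assms(3)]
  show ?thesis using tr_vimage[OF assms(1,2) sets_Gm_subset[OF assms(3)]] by simp
qed

text \<open>\<open>tr (inv g) g\<close> is the conjugation x \<mapsto> g^-1 x g, so this is |det
  Ad(g^-1)|. It turns out to be the factor by which right translation by \<open>g\<close> scales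
  left Haar measure.\<close>

definition modulus :: "'g \<Rightarrow> real" where
  "modulus g = \<bar>det (matrix (TD c0 c0 (tr (inv g) g) \<one>))\<bar>"

lemma tr_conj_one: "g \<in> carrier G \<Longrightarrow> tr (inv g) g \<one> = \<one>"
  by (simp add: tr_def)

text \<open>Conjugations by \<open>g\<close> and by its inverse undo each other, so their
  determinants have product 1.\<close>

lemma modulus_pos:
  assumes g: "g \<in> carrier G" shows "modulus g > 0"
proof -
  let ?C = "\<lambda>g. TD c0 c0 (tr (inv g) g) \<one>"
  have d: "chart_diff (tr (inv g) g)" "chart_diff (tr (inv (inv g)) (inv g))"
    using g by (simp_all add: chart_diff_tr)
  have t: "tr (inv g) g \<one> = \<one>" "tr (inv (inv g)) (inv g) \<one> = \<one>" using g tr_conj_one[of g] tr_conj_one[of "inv g"] by simp_all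
  have lin: "linear (?C g)" "linear (?C (inv g))"
    using t c0 one_c0 by (auto intro!: TD_linear d)
  have "TD c0 c0 (\<lambda>x. x) \<one> = TD c0 c0 (\<lambda>x. tr (inv (inv g)) (inv g) (tr (inv g) g x)) \<one>"
    using g c0 one_c0 by (intro chart_diff_cong(2) chart_diff_id) (simp_all add: tr_inv tr_tr tr_one)
  then have "?C (inv g) (?C g v) = v" for v
    using TD_comp[OF d c0 c0 c0 one_c0, of v] TD_id[OF c0 one_c0, of v] t one_c0 by simp
  then have "det (matrix (?C (inv g))) * det (matrix (?C g)) = 1"
    using det_matrix_compose[OF lin] by (simp add: matrix_id[unfolded id_def])
  then show ?thesis by (auto simp: modulus_def)
qed

text \<open>Differentiate h (p x) g = (h p g) (g^-1 x g) at the identity and take determinants: the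
  left translations contribute the densities, the conjugation contributes
  \<open>modulus g\<close>.\<close>

lemma jacobian_tr:
  assumes h: "h \<in> carrier G" and g: "g \<in> carrier G" and p: "p \<in> cdom c0" and q: "tr h g p \<in> cdom c0"
  shows "\<bar>det (matrix (TD c0 c0 (tr h g) p))\<bar> * density_fun (coord c0 (tr h g p)) =
    modulus g * density_fun (coord c0 p)"
proof -
  let ?q = "tr h g p"
  have pc: "p \<in> carrier G" "?q \<in> carrier G" using p q cdom_carrier[OF c0] by auto
  have e: "tr h g (p \<otimes> x) = ?q \<otimes> tr (inv g) g x" if x: "x \<in> carrier G" for x
  proof -
    have "?q \<otimes> tr (inv g) g x = h \<otimes> p \<otimes> (g \<otimes> inv g) \<otimes> x \<otimes> g"
      unfolding tr_def using h g pc(1) x by (simp only: m_assoc m_closed inv_closed)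
    also have "\<dots> = tr h g (p \<otimes> x)" unfolding tr_def using h g pc x by (simp add: m_assoc)
    finally show ?thesis by simp
  qed
  have L: "TD c0 c0 (\<lambda>x. r \<otimes> x) \<one> = (\<lambda>v. left_field v c0 (coord c0 r))" if "r \<in> cdom c0" for r
    using left_field_coord[OF c0 that] by (simp add: fun_eq_iff)
  have one: "p \<otimes> \<one> = p" "?q \<otimes> \<one> = ?q" "tr (inv g) g \<one> = \<one>" using pc g tr_conj_one by simp_all
  have d: "chart_diff (\<lambda>x. p \<otimes> x)" "chart_diff (\<lambda>x. ?q \<otimes> x)" "chart_diff (tr h g)" "chart_diff (tr (inv g) g)"
    using pc h g by (auto intro: chart_diff_left chart_diff_tr)
  have lin: "linear (TD c0 c0 (\<lambda>x. p \<otimes> x) \<one>)" "linear (TD c0 c0 (\<lambda>x. ?q \<otimes> x) \<one>)"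
    "linear (TD c0 c0 (tr h g) p)" "linear (TD c0 c0 (tr (inv g) g) \<one>)"
    using one p q one_c0 by (auto intro!: TD_linear d c0)
  have "TD c0 c0 (\<lambda>x. tr h g (p \<otimes> x)) \<one> = TD c0 c0 (\<lambda>x. ?q \<otimes> tr (inv g) g x) \<one>"
    by (rule chart_diff_cong(2)[OF chart_diff_comp[OF d(1,3)] _ c0 c0 one_c0])
      (simp_all add: one q e)
  moreover have "TD c0 c0 (\<lambda>x. tr h g (p \<otimes> x)) \<one> = (\<lambda>v. TD c0 c0 (tr h g) p (TD c0 c0 (\<lambda>x. p \<otimes> x) \<one> v))"
    using TD_comp[OF d(1,3) c0 c0 c0 one_c0] one p q by (simp add: fun_eq_iff)
  moreover have "TD c0 c0 (\<lambda>x. ?q \<otimes> tr (inv g) g x) \<one> =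
      (\<lambda>v. TD c0 c0 (\<lambda>x. ?q \<otimes> x) \<one> (TD c0 c0 (tr (inv g) g) \<one> v))"
    using TD_comp[OF d(4,2) c0 c0 c0 one_c0] one p q one_c0 by (simp add: fun_eq_iff)
  ultimately have "det (matrix (TD c0 c0 (tr h g) p)) * det (matrix (TD c0 c0 (\<lambda>x. p \<otimes> x) \<one>)) =
    det (matrix (TD c0 c0 (\<lambda>x. ?q \<otimes> x) \<one>)) * det (matrix (TD c0 c0 (tr (inv g) g) \<one>))"
    using det_matrix_compose[OF lin(1,3)] det_matrix_compose[OF lin(4,2)] by simp
  then have "\<bar>det (matrix (TD c0 c0 (tr h g) p))\<bar> * \<bar>det (matrix (TD c0 c0 (\<lambda>x. p \<otimes> x) \<one>))\<bar> =
    \<bar>det (matrix (TD c0 c0 (\<lambda>x. ?q \<otimes> x) \<one>))\<bar> * modulus g"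
    unfolding modulus_def by (simp flip: abs_mult)
  then show ?thesis
    using det_left_field[of "coord c0 p"] det_left_field[of "coord c0 ?q"] p q
    unfolding L[OF p] L[OF q] by (simp add: density_fun_def field_simps)
qed

text \<open>Haar measure of the part of \<open>E\<close> inside the single chart \<open>c0\<close>;
  points outside that chart are not counted.\<close>

definition \<nu> :: "'g set \<Rightarrow> ennreal" where
  "\<nu> E = emeasure (density lborel (\<lambda>x. ennreal (density_fun x))) (cset E)"

lemma \<nu>_nn_integral:
  "E \<in> sets Gm \<Longrightarrow> \<nu> E = (\<integral>\<^sup>+x. ennreal (density_fun x) * indicator (cset E) x \<partial>lborel)"
  unfolding \<nu>_def using borel_density_fun borel_cset by (subst emeasure_density) auto

text \<open>Change of variables with the factor from \<open>jacobian_tr\<close>. Both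
  \<open>E\<close> and its translate have to lie in the chart, as \<nu> ignores everything
  outside.\<close>

lemma \<nu>_tr:
  assumes h: "h \<in> carrier G" and g: "g \<in> carrier G" and E: "E \<in> sets Gm" "E \<subseteq> cdom c0" "tr h g ` E \<subseteq> cdom c0"
  shows "\<nu> (tr h g ` E) = ennreal (modulus g) * \<nu> E"
proof -
  let ?\<phi> = "local_rep c0 c0 (tr h g)"
  have rep: "?\<phi> x = coord c0 (tr h g (icoord c0 x))" for x by (simp add: local_rep_def)
  have im: "cset (tr h g ` E) = ?\<phi> ` cset E"
  proof (intro equalityI subsetI)
    fix y assume "y \<in> cset (tr h g ` E)"
    then obtain p where p: "y \<in> crange c0" "p \<in> E" "icoord c0 y = tr h g p" by (auto simp: cset_def)
    then have "p \<in> cdom c0" using E by blast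
    then have "coord c0 p \<in> cset E" "?\<phi> (coord c0 p) = y"
      using p c0 inv_chart(2)[OF p(1)] unfolding rep by (simp_all add: cset_def)
    then show "y \<in> ?\<phi> ` cset E" by blast
  next
    fix y assume "y \<in> ?\<phi> ` cset E"
    then obtain x where x: "x \<in> crange c0" "icoord c0 x \<in> E" "y = ?\<phi> x" by (auto simp: cset_def)
    then have t: "tr h g (icoord c0 x) \<in> cdom c0" using E by blast
    then show "y \<in> cset (tr h g ` E)" using x c0 unfolding rep by (simp add: cset_def)
  qed
  have "(\<integral>\<^sup>+x. ennreal (density_fun x) * indicator (?\<phi> ` cset E) x \<partial>lborel) =
      ennreal (modulus g) * (\<integral>\<^sup>+x. ennreal (density_fun x) * indicator (cset E) x \<partial>lborel)"
  proof (rule nn_integral_change_of_variables[where \<phi>' = "\<lambda>x. TD c0 c0 (tr h g) (icoord c0 x)"])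
    show "cset E \<in> sets borel" by (rule borel_cset[OF E(1)])
    show "?\<phi> ` cset E \<in> sets borel" using borel_cset[OF tr_sets[OF h g E(1)]] im by simp
    show "inj_on ?\<phi> (cset E)"
    proof (rule inj_onI)
      fix x y assume xy: "x \<in> cset E" "y \<in> cset E" "?\<phi> x = ?\<phi> y"
      then have *: "icoord c0 x \<in> E" "icoord c0 y \<in> E" "x \<in> crange c0" "y \<in> crange c0" by (auto simp: cset_def)
      then have "tr h g (icoord c0 x) = tr h g (icoord c0 y)"
        using xy(3) E(3) inj_on_chart[OF chart[OF c0]] unfolding rep by (auto dest: inj_onD)
      moreover have "icoord c0 x \<in> carrier G" "icoord c0 y \<in> carrier G"
        using *(1,2) sets_Gm_subset[OF E(1)] by blast+
      ultimately have "icoord c0 x = icoord c0 y" using inj_on_tr[OF h g] by (auto dest: inj_onD)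
      then show "x = y" using inv_chart(2)[OF *(3)] inv_chart(2)[OF *(4)] by metis
    qed
    fix x assume "x \<in> cset E"
    then have *: "x \<in> crange c0" "icoord c0 x \<in> cdom c0" "tr h g (icoord c0 x) \<in> cdom c0"
      using E by (auto simp: cset_def)
    show "(?\<phi> has_derivative TD c0 c0 (tr h g) (icoord c0 x)) (at x)"
      using TD_has_derivative[OF chart_diff_tr[OF h g] c0 c0 *(2,3)] inv_chart(2)[OF *(1)] by simp
    show "\<bar>det (matrix (TD c0 c0 (tr h g) (icoord c0 x)))\<bar> * density_fun (?\<phi> x) = modulus g * density_fun x"
      using jacobian_tr[OF h g *(2,3)] inv_chart(2)[OF *(1)] unfolding rep by simp
  qed (use borel_density_fun density_fun_nonneg modulus_pos[OF g] in auto)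
  then show ?thesis using E h g by (simp add: \<nu>_nn_integral tr_sets im)
qed

section \<open>From one chart to the whole group\<close>

lemma \<nu>_suminf:
  assumes "range E \<subseteq> sets Gm" "disjoint_family E"
  shows "\<nu> (\<Union>i. E i) = (\<Sum>i::nat. \<nu> (E i))"
proof -
  have "cset (\<Union>i. E i) = (\<Union>i. cset (E i))" by (auto simp: cset_def)
  moreover have "disjoint_family (\<lambda>i. cset (E i))" using assms(2) by (auto simp: disjoint_family_on_def cset_def)
  moreover have "range (\<lambda>i. cset (E i)) \<subseteq> sets (density lborel (\<lambda>x. ennreal (density_fun x)))"
    using assms(1) borel_cset by auto
  ultimately show ?thesis unfolding \<nu>_def by (simp add: suminf_emeasure)
qed

lemma disjoint_family_tr:
  fixes E :: "nat \<Rightarrow> 'g set"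
  assumes "h \<in> carrier G" "g \<in> carrier G" "\<And>i. E i \<subseteq> carrier G" "disjoint_family E"
  shows "disjoint_family (\<lambda>i. tr h g ` E i)"
  unfolding disjoint_family_on_def
proof (intro ballI impI)
  fix i j :: nat assume "i \<noteq> j"
  then have "tr h g ` (E i \<inter> E j) = {}" using assms(4) by (auto simp: disjoint_family_on_def)
  then show "tr h g ` E i \<inter> tr h g ` E j = {}"
    using inj_on_image_Int[OF inj_on_tr[OF assms(1,2)] assms(3,3), of i j] by simp
qed

lemma \<nu>_tr_suminf:
  assumes "h \<in> carrier G" "g \<in> carrier G" "range E \<subseteq> sets Gm" "disjoint_family E"
  shows "\<nu> (tr h g ` (\<Union>i. E i)) = (\<Sum>i::nat. \<nu> (tr h g ` E i))"
proof -
  have E: "E i \<in> sets Gm" for i using assms(3) by blast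
  have "\<nu> (\<Union>i. tr h g ` E i) = (\<Sum>i. \<nu> (tr h g ` E i))"
    using tr_sets[OF assms(1,2) E] sets_Gm_subset[OF E] assms(4)
    by (intro \<nu>_suminf disjoint_family_tr[OF assms(1,2)]) auto
  then show ?thesis by (simp add: image_UN)
qed

text \<open>The translates of \<open>cdom c0\<close> by all group elements are an open cover; second
  countability, through the Lindelof property, leaves countably many of them.\<close>

lemma cdom_translates: "\<exists>centre. range centre \<subseteq> carrier G \<and> (\<Union>n::nat. tr (centre n) \<one> ` cdom c0) = carrier G"
proof -
  let ?W = "\<lambda>g. tr g \<one> ` cdom c0"
  have sub: "cdom c0 \<subseteq> carrier G" using cdom_carrier[OF c0] by blast
  have o: "openin T (?W g)" if g: "g \<in> carrier G" for g
  proof -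
    have "continuous_map T T (tr (inv g) (inv \<one>))" using chart_diff_tr[of "inv g" "inv \<one>"] g by (simp add: chart_diff_def)
    from openin_continuous_map_preimage[OF this openin_cdom[OF c0]]
    have "openin T {x \<in> topspace T. tr (inv g) (inv \<one>) x \<in> cdom c0}" .
    also have "{x \<in> topspace T. tr (inv g) (inv \<one>) x \<in> cdom c0} = ?W g"
      unfolding tr_vimage[OF g one_closed sub] topspace by blast
    finally show ?thesis .
  qed
  have cov: "\<Union>(?W ` carrier G) = topspace T"
  proof (intro equalityI subsetI)
    fix x assume "x \<in> \<Union>(?W ` carrier G)"
    then obtain g where "g \<in> carrier G" "x \<in> ?W g" by blast
    then show "x \<in> topspace T" using o openin_subset by blast
  next
    fix x assume "x \<in> topspace T"
    then have x: "x \<in> carrier G" using topspace by simp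
    then have "x = tr x \<one> \<one>" by (simp add: tr_def)
    then have "x \<in> ?W x" using one_c0 by blast
    then show "x \<in> \<Union>(?W ` carrier G)" using x by blast
  qed
  have L: "Lindelof_space T"
    using smooth_manifold by (simp add: smooth_manifold_def second_countable_imp_Lindelof_space)
  have op: "openin T U" if "U \<in> ?W ` carrier G" for U using o that by blast
  have "\<exists>\<V>. countable \<V> \<and> \<V> \<subseteq> ?W ` carrier G \<and> \<Union>\<V> = topspace T"
    by (rule Lindelof_spaceD[OF L _ cov]) (rule op)
  then obtain \<V> where V: "countable \<V>" "\<V> \<subseteq> ?W ` carrier G" "\<Union>\<V> = topspace T"
    by (elim exE conjE)
  obtain C where C: "countable C" "C \<subseteq> carrier G" "\<V> = ?W ` C"
    using countable_subset_image[of \<V> ?W "carrier G", THEN iffD1, OF conjI[OF V(1,2)]]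
    by (elim exE conjE)
  have UC: "\<Union>(?W ` C) = carrier G" using V(3) unfolding C(3) topspace .
  then have "C \<noteq> {}" using one_closed by auto
  then have "range (from_nat_into C) = C" using C(1) by simp
  moreover have "(\<Union>n. ?W (from_nat_into C n)) = \<Union>(?W ` range (from_nat_into C))" by blast
  ultimately have "(\<Union>n. ?W (from_nat_into C n)) = carrier G" using UC by simp
  moreover have "range (from_nat_into C) \<subseteq> carrier G" using C(2) \<open>range (from_nat_into C) = C\<close> by simp
  ultimately show ?thesis by blast
qed

definition centre :: "nat \<Rightarrow> 'g" where
  "centre = (SOME centre. range centre \<subseteq> carrier G \<and> (\<Union>n::nat. tr (centre n) \<one> ` cdom c0) = carrier G)"

lemma centre: "centre n \<in> carrier G" "(\<Union>n. tr (centre n) \<one> ` cdom c0) = carrier G"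
  using someI_ex[OF cdom_translates, folded centre_def] by auto

definition tile :: "nat \<Rightarrow> 'g set" where
  "tile = disjointed (\<lambda>n. tr (centre n) \<one> ` cdom c0)"

lemma tile_sets: "tile n \<in> sets Gm"
proof -
  have "range tile \<subseteq> sets Gm" unfolding tile_def
    by (rule sets.range_disjointed_sets) (use tr_sets[OF centre(1) one_closed open_sets_Gm[OF openin_cdom[OF c0]]] in blast)
  then show ?thesis by blast
qed

lemma tile_disjoint: "disjoint_family tile" and tile_UN: "(\<Union>n. tile n) = carrier G"
  unfolding tile_def by (auto simp: disjoint_family_disjointed UN_disjointed_eq centre(2))

lemma tile_back: "tr (inv (centre n)) \<one> ` tile n \<subseteq> cdom c0"
proof -
  have sub: "cdom c0 \<subseteq> carrier G" using cdom_carrier[OF c0] by blast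
  have "tr (inv (centre n)) \<one> ` tile n \<subseteq> tr (inv (centre n)) \<one> ` tr (centre n) \<one> ` cdom c0"
    unfolding tile_def using disjointed_subset by (intro image_mono)
  also have "\<dots> = cdom c0" using centre(1) sub tr_one by (simp add: tr_image_image subset_iff cong: image_cong_simp)
  finally show ?thesis .
qed

text \<open>Each tile is translated back into the chart, and what \<open>E\<close> has in it is
  measured there by \<nu>.\<close>

definition \<mu> :: "'g set \<Rightarrow> ennreal" where
  "\<mu> E = (\<Sum>n. \<nu> (tr (inv (centre n)) \<one> ` (E \<inter> tile n)))"

text \<open>The value does not depend on the partition. Both partitions are refined to the pieces
  \<open>E \<inter> Q k \<inter> tile n\<close>; such a piece has two positions inside the chart,
  related by a translation, so \<open>\<nu>_tr\<close> applies, and the double sum is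
  exchanged.\<close>

lemma \<mu>_decomposition:
  assumes E: "E \<in> sets Gm" and Q: "\<And>k. Q k \<in> sets Gm" "disjoint_family Q" "(\<Union>k. Q k) = carrier G"
    and a: "\<And>k. a k \<in> carrier G" and b: "b \<in> carrier G" and sub: "\<And>k. tr (a k) b ` (E \<inter> Q k) \<subseteq> cdom c0"
  shows "(\<Sum>k. \<nu> (tr (a k) b ` (E \<inter> Q k))) = ennreal (modulus b) * \<mu> E"
proof -
  let ?R = "\<lambda>n k. E \<inter> Q k \<inter> tile n"
  have R: "?R n k \<in> sets Gm" for n k using E Q tile_sets by blast
  have Ec: "E \<subseteq> carrier G" by (rule sets_Gm_subset[OF E])
  have d: "disjoint_family (\<lambda>n. ?R n k)" "disjoint_family (\<lambda>k. ?R n k)" for n k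
    using tile_disjoint Q(2) unfolding disjoint_family_on_def by blast+
  have "\<nu> (tr (a k) b ` (E \<inter> Q k)) = (\<Sum>n. ennreal (modulus b) * \<nu> (tr (inv (centre n)) \<one> ` ?R n k))" for k
  proof -
    have eq: "E \<inter> Q k = (\<Union>n. ?R n k)" using Ec tile_UN by blast
    have "range (\<lambda>n. ?R n k) \<subseteq> sets Gm" using R by blast
    from trans[OF arg_cong[where f = "\<lambda>X. \<nu> (tr (a k) b ` X)", OF eq] \<nu>_tr_suminf[OF a b this d(1)]]
    have f: "\<nu> (tr (a k) b ` (E \<inter> Q k)) = (\<Sum>n. \<nu> (tr (a k) b ` ?R n k))" .
    have t: "\<nu> (tr (a k) b ` ?R n k) = ennreal (modulus b) * \<nu> (tr (inv (centre n)) \<one> ` ?R n k)" for n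
    proof -
      have Rc: "?R n k \<subseteq> carrier G" by (rule sets_Gm_subset[OF R])
      \<comment> \<open>The translation by \<open>a k\<close> and \<open>b\<close> is factored
        through the position of the tile in the chart: \<open>centre n\<close> cancels its
        inverse.\<close>
      have e: "tr (a k \<otimes> centre n) b ` tr (inv (centre n)) \<one> ` ?R n k = tr (a k) b ` ?R n k"
        using a[of k] b centre(1)[of n] Rc by (simp add: tr_image_image m_assoc)
      have "\<nu> (tr (a k \<otimes> centre n) b ` tr (inv (centre n)) \<one> ` ?R n k) = ennreal (modulus b) * \<nu> (tr (inv (centre n)) \<one> ` ?R n k)"
      proof (rule \<nu>_tr)
        show "tr (inv (centre n)) \<one> ` ?R n k \<in> sets Gm" by (intro tr_sets R) (simp_all add: centre)
        show "tr (inv (centre n)) \<one> ` ?R n k \<subseteq> cdom c0" using tile_back by blast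
        show "tr (a k \<otimes> centre n) b ` tr (inv (centre n)) \<one> ` ?R n k \<subseteq> cdom c0"
          unfolding e using sub[of k] by blast
      qed (use a b centre in simp_all)
      then show ?thesis unfolding e .
    qed
    show ?thesis unfolding f t ..
  qed
  then have "(\<Sum>k. \<nu> (tr (a k) b ` (E \<inter> Q k))) =
      (\<Sum>k. \<Sum>n. ennreal (modulus b) * \<nu> (tr (inv (centre n)) \<one> ` ?R n k))" by simp
  also have "\<dots> = (\<Sum>n. \<Sum>k. ennreal (modulus b) * \<nu> (tr (inv (centre n)) \<one> ` ?R n k))"
    by (rule ennreal_suminf_swap)
  finally have f: "(\<Sum>k. \<nu> (tr (a k) b ` (E \<inter> Q k))) =
      ennreal (modulus b) * (\<Sum>n. \<Sum>k. \<nu> (tr (inv (centre n)) \<one> ` ?R n k))"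
    by simp
  have t: "(\<Sum>k. \<nu> (tr (inv (centre n)) \<one> ` ?R n k)) = \<nu> (tr (inv (centre n)) \<one> ` (E \<inter> tile n))" for n
  proof -
    have eq: "E \<inter> tile n = (\<Union>k. ?R n k)" using Ec Q(3) by blast
    have "range (\<lambda>k. ?R n k) \<subseteq> sets Gm" using R by blast
    from trans[OF arg_cong[where f = "\<lambda>X. \<nu> (tr (inv (centre n)) \<one> ` X)", OF eq]
        \<nu>_tr_suminf[OF inv_closed[OF centre(1)] one_closed this d(2)]]
    show ?thesis by (rule sym)
  qed
  show ?thesis unfolding f t \<mu>_def ..
qed

text \<open>Cutting the translate of \<open>E\<close> by the tiles amounts to cutting
  \<open>E\<close> by the tiles translated backwards, another partition to which
  \<open>\<mu>_decomposition\<close> applies.\<close>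

lemma \<mu>_tr:
  assumes h: "h \<in> carrier G" and b: "b \<in> carrier G" and E: "E \<in> sets Gm"
  shows "\<mu> (tr h b ` E) = ennreal (modulus b) * \<mu> E"
proof -
  let ?Q = "\<lambda>n. tr (inv h) (inv b) ` tile n"
  have Ec: "E \<subseteq> carrier G" and Pc: "tile n \<subseteq> carrier G" for n
    using sets_Gm_subset E tile_sets by auto
  have e: "tr (inv (centre n) \<otimes> h) b ` (E \<inter> ?Q n) = tr (inv (centre n)) \<one> ` (tr h b ` E \<inter> tile n)" for n
  proof -
    have Qc: "?Q n \<subseteq> carrier G" using Pc h b by (auto simp: subset_iff)
    have "tr (inv (centre n) \<otimes> h) b ` (E \<inter> ?Q n) = tr (inv (centre n)) \<one> ` tr h b ` (E \<inter> ?Q n)"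
      using Ec h b centre(1) by (subst tr_image_image) auto
    also have "tr h b ` (E \<inter> ?Q n) = tr h b ` E \<inter> tr h b ` ?Q n"
      by (rule inj_on_image_Int[OF inj_on_tr[OF h b] Ec Qc])
    also have "tr h b ` ?Q n = tile n"
      using h b Pc[of n] tr_one by (simp add: tr_image_image subset_iff cong: image_cong_simp)
    finally show ?thesis .
  qed
  have "(\<Sum>n. \<nu> (tr (inv (centre n) \<otimes> h) b ` (E \<inter> ?Q n))) = ennreal (modulus b) * \<mu> E"
  proof (rule \<mu>_decomposition[OF E])
    show "disjoint_family ?Q" using h b Pc tile_disjoint by (intro disjoint_family_tr) auto
    show "(\<Union>k. ?Q k) = carrier G"
      unfolding image_UN[symmetric] tile_UN using h b tr_vimage[of "inv h" "inv b" "carrier G"] by auto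
    show "tr (inv (centre k) \<otimes> h) b ` (E \<inter> ?Q k) \<subseteq> cdom c0" for k
      unfolding e using tile_back by blast
  qed (use h b centre tile_sets tr_sets in auto)
  then show ?thesis unfolding e by (simp add: \<mu>_def)
qed

lemma \<mu>_suminf:
  assumes "range E \<subseteq> sets Gm" "disjoint_family E"
  shows "\<mu> (\<Union>i. E i) = (\<Sum>i::nat. \<mu> (E i))"
proof -
  have "\<nu> (tr (inv (centre n)) \<one> ` ((\<Union>i. E i) \<inter> tile n)) = (\<Sum>i. \<nu> (tr (inv (centre n)) \<one> ` (E i \<inter> tile n)))" for n
  proof -
    have eq: "(\<Union>i. E i) \<inter> tile n = (\<Union>i. E i \<inter> tile n)" by blast
    have d: "disjoint_family (\<lambda>i. E i \<inter> tile n)" using assms(2) unfolding disjoint_family_on_def by blast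
    have r: "range (\<lambda>i. E i \<inter> tile n) \<subseteq> sets Gm" using assms(1) tile_sets by blast
    show ?thesis unfolding eq by (rule \<nu>_tr_suminf[OF inv_closed[OF centre(1)] one_closed r d])
  qed
  then show ?thesis unfolding \<mu>_def by (simp add: ennreal_suminf_swap[of "\<lambda>n i. \<nu> (tr (inv (centre n)) \<one> ` (E i \<inter> tile n))"])
qed

definition haar :: "'g measure" where
  "haar = measure_of (carrier G) (sets Gm) \<mu>"

lemma sets_haar [simp]: "sets haar = sets Gm"
  unfolding haar_def using sets.space_closed[of Gm] sets.sigma_sets_eq[of Gm] by simp

lemma emeasure_haar: "E \<in> sets Gm \<Longrightarrow> emeasure haar E = \<mu> E"
  unfolding haar_def
proof (rule emeasure_measure_of_sigma)
  show "sigma_algebra (carrier G) (sets Gm)" using sets.sigma_algebra_axioms[of Gm] by simp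
  show "positive (sets Gm) \<mu>" by (simp add: positive_def \<mu>_def \<nu>_def cset_def)
  show "countably_additive (sets Gm) \<mu>"
    by (rule countably_additiveI) (simp add: \<mu>_suminf)
qed

lemma haar_tr:
  "h \<in> carrier G \<Longrightarrow> b \<in> carrier G \<Longrightarrow> E \<in> sets Gm \<Longrightarrow>
    emeasure haar (tr h b ` E) = ennreal (modulus b) * emeasure haar E"
  by (simp add: emeasure_haar tr_sets \<mu>_tr)

lemma haar_chart:
  assumes "E \<in> sets Gm" "E \<subseteq> cdom c0"
  shows "\<nu> E = ennreal (modulus \<one>) * emeasure haar E"
proof -
  let ?Q = "\<lambda>k::nat. if k = 0 then carrier G else {}"
  have Ec: "E \<subseteq> carrier G" by (rule sets_Gm_subset[OF assms(1)])
  then have t: "tr \<one> \<one> ` E = E" using tr_one by (simp add: subset_iff cong: image_cong_simp)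
  have im: "tr \<one> \<one> ` (E \<inter> ?Q k) = (if k = 0 then E else {})" for k
    using t Ec by (auto simp: Int_absorb2)
  have "(\<Sum>k. \<nu> (tr \<one> \<one> ` (E \<inter> ?Q k))) = ennreal (modulus \<one>) * \<mu> E"
  proof (rule \<mu>_decomposition[OF assms(1)])
    show "?Q k \<in> sets Gm" for k using sets.top[of Gm] by simp
    show "disjoint_family ?Q" by (auto simp: disjoint_family_on_def)
    show "(\<Union>k. ?Q k) = carrier G" by (auto split: if_splits)
    show "tr \<one> \<one> ` (E \<inter> ?Q k) \<subseteq> cdom c0" for k unfolding im using assms(2) by simp
  qed simp_all
  moreover have "(\<Sum>k. \<nu> (tr \<one> \<one> ` (E \<inter> ?Q k))) = \<nu> E"
    unfolding im by (subst suminf_finite[of "{0}"]) (auto simp: \<nu>_def cset_def)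
  ultimately show ?thesis using emeasure_haar[OF assms(1)] by simp
qed

end

section \<open>Unimodularity\<close>

context lie_grp_vec
begin

lemma modulus_one: "modulus \<one> = 1"
proof -
  have "TD c0 c0 (\<lambda>x. x) \<one> = TD c0 c0 (tr (inv \<one>) \<one>) \<one>"
    by (rule chart_diff_cong(2)[OF chart_diff_id _ c0 c0 one_c0 one_c0]) (simp add: tr_one)
  moreover have "TD c0 c0 (\<lambda>x. x) \<one> = (\<lambda>v. v)"
    using TD_id[OF c0 one_c0] by (simp add: fun_eq_iff)
  ultimately have "TD c0 c0 (tr (inv \<one>) \<one>) \<one> = (\<lambda>v. v)" by simp
  then show ?thesis by (simp only: modulus_def matrix_id[unfolded id_def] det_I abs_one)
qed

lemma haar_left: "h \<in> carrier G \<Longrightarrow> E \<in> sets Gm \<Longrightarrow> emeasure haar (tr h \<one> ` E) = emeasure haar E"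
  by (simp add: haar_tr modulus_one)

lemma haar_chart': "E \<in> sets Gm \<Longrightarrow> E \<subseteq> cdom c0 \<Longrightarrow> emeasure haar E = \<nu> E"
  by (simp add: haar_chart modulus_one)

lemma openin_chart_ball:
  assumes "ball (coord c0 \<one>) r \<subseteq> crange c0"
  shows "openin T {p \<in> cdom c0. coord c0 p \<in> ball (coord c0 \<one>) r}"
proof -
  have sub: "cdom c0 \<subseteq> topspace T" using openin_subset[OF openin_cdom[OF c0]] .
  have "continuous_map (subtopology T (cdom c0)) (top_of_set (crange c0)) (coord c0)"
    using chart[OF c0] by (simp add: is_chart_def homeomorphic_imp_continuous_map)
  moreover have "openin (top_of_set (crange c0)) (ball (coord c0 \<one>) r)"
    using assms open_crange[OF c0] by (simp add: openin_open_eq)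
  ultimately have "openin (subtopology T (cdom c0))
      {p \<in> topspace (subtopology T (cdom c0)). coord c0 p \<in> ball (coord c0 \<one>) r}"
    by (rule openin_continuous_map_preimage)
  moreover have "topspace (subtopology T (cdom c0)) = cdom c0" using sub by auto
  ultimately have "openin (subtopology T (cdom c0)) {p \<in> cdom c0. coord c0 p \<in> ball (coord c0 \<one>) r}"
    by (simp only:)
  then show ?thesis by (rule openin_trans_full[OF _ openin_cdom[OF c0]])
qed

text \<open>The density is continuous, hence bounded on a closed ball inside the chart, and the ball
  has finite Lebesgue measure.\<close>

lemma finite_neighbourhood:
  obtains V where "openin T V" "\<one> \<in> V" "V \<subseteq> cdom c0" "\<And>W. W \<in> sets Gm \<Longrightarrow> W \<subseteq> V \<Longrightarrow> \<nu> W < \<infinity>"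
proof -
  have "coord c0 \<one> \<in> crange c0" using one_c0 by simp
  then obtain r where r: "r > 0" "cball (coord c0 \<one>) r \<subseteq> crange c0"
    using open_crange[OF c0] open_contains_cball by blast
  let ?K = "cball (coord c0 \<one>) r"
  let ?V = "{p \<in> cdom c0. coord c0 p \<in> ball (coord c0 \<one>) r}"
  have b: "ball (coord c0 \<one>) r \<subseteq> crange c0" using r(2) ball_subset_cball by blast
  have "compact (density_fun ` ?K)"
    by (intro compact_continuous_image continuous_on_subset[OF continuous_density_fun r(2)] compact_cball)
  then have "bdd_above (density_fun ` ?K)" by (intro bounded_imp_bdd_above compact_imp_bounded)
  then obtain B where "\<forall>y\<in>density_fun ` ?K. y \<le> B" unfolding bdd_above_def by (elim exE)
  then have B: "density_fun x \<le> B" if "x \<in> ?K" for x using that by (rule bspec[OF _ imageI])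
  have fin: "\<nu> W < \<infinity>" if W: "W \<in> sets Gm" "W \<subseteq> ?V" for W
  proof -
    have "cset W \<subseteq> ?K"
    proof
      fix x assume "x \<in> cset W"
      then have "x \<in> crange c0" "icoord c0 x \<in> ?V" using W(2) by (auto simp: cset_def)
      then show "x \<in> ?K" using inv_chart(2)[of x c0] by simp
    qed
    then have "\<nu> W \<le> (\<integral>\<^sup>+x. ennreal B * indicator ?K x \<partial>lborel)"
      unfolding \<nu>_nn_integral[OF W(1)]
      by (intro nn_integral_mono) (auto simp: indicator_def intro!: ennreal_leI B)
    also have "\<dots> = ennreal B * emeasure lborel ?K" by (subst nn_integral_cmult_indicator) auto
    also have "\<dots> < \<infinity>"
      using emeasure_lborel_cball_finite[of "coord c0 \<one>" r] by (simp add: ennreal_mult_less_top)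
    finally show ?thesis .
  qed
  show ?thesis
    by (rule that[of ?V, OF openin_chart_ball[OF b] _ _ fin]) (use r(1) one_c0 in auto)
qed

text \<open>The density is positive on the chart, so measure zero would make the nonempty open set
  \<open>cset V\<close> negligible.\<close>

lemma \<nu>_open_pos:
  assumes "openin T V" "V \<subseteq> cdom c0" "p \<in> V"
  shows "\<nu> V > 0"
proof (rule ccontr)
  assume "\<not> \<nu> V > 0"
  then have "(\<integral>\<^sup>+x. ennreal (density_fun x) * indicator (cset V) x \<partial>lborel) = 0"
    using \<nu>_nn_integral[OF open_sets_Gm[OF assms(1)]] by (simp add: not_gr_zero)
  moreover have m: "cset V \<in> sets borel" by (rule borel_cset[OF open_sets_Gm[OF assms(1)]])
  ultimately have "AE x in lborel. ennreal (density_fun x) * indicator (cset V) x = 0"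
    using borel_density_fun by (subst (asm) nn_integral_0_iff_AE) auto
  moreover have "density_fun x > 0" if "x \<in> cset V" for x
    using that density_fun_pos by (auto simp: cset_def)
  ultimately have "AE x in lborel. x \<notin> cset V"
    by (elim eventually_mono) (force simp: indicator_def split: if_splits)
  then have "cset V \<in> null_sets lborel" using m by (simp add: AE_iff_null_sets)
  then have "negligible (cset V)" by (simp add: negligible_iff_null_sets null_sets_completionI)
  moreover have "open (cset V)"
  proof -
    have "cset V = coord c0 ` V"
    proof (intro equalityI subsetI)
      fix x assume "x \<in> cset V"
      then have "icoord c0 x \<in> V" "coord c0 (icoord c0 x) = x" using inv_chart(2)[of x c0] by (auto simp: cset_def)
      then show "x \<in> coord c0 ` V" by (metis imageI)
    next
      fix x assume "x \<in> coord c0 ` V"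
      then obtain q where "q \<in> V" "q \<in> cdom c0" "x = coord c0 q" using assms(2) by blast
      then show "x \<in> cset V" using c0 by (simp add: cset_def)
    qed
    then show ?thesis using open_chart_image[OF chart[OF c0] assms(1,2)] by simp
  qed
  moreover have "coord c0 p \<in> cset V" using assms(2,3) c0 by (auto simp: cset_def)
  ultimately show False using open_not_negligible by blast
qed

text \<open>Continuity of (x, y) \<mapsto> x y^-1 at the identity. It supplies neighbourhoods whose
  translates by a discrete subgroup are disjoint.\<close>

lemma small_neighbourhood:
  assumes "openin T O'" "\<one> \<in> O'"
  obtains V where "openin T V" "\<one> \<in> V" "\<And>x y. x \<in> V \<Longrightarrow> y \<in> V \<Longrightarrow> x \<otimes> inv y \<in> O'"
proof -
  let ?f = "\<lambda>z. fst z \<otimes> inv (snd z)"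
  have "continuous_map (prod_topology T T) T (\<lambda>z. inv (snd z))"
    using continuous_map_compose[OF continuous_map_snd continuous_inverse] by (simp add: o_def)
  then have "continuous_map (prod_topology T T) T ?f"
    by (rule continuous_mult'[OF continuous_map_fst])
  from openin_continuous_map_preimage[OF this assms(1)]
  have o: "openin (prod_topology T T) {z \<in> topspace (prod_topology T T). ?f z \<in> O'}" .
  have "(\<one>, \<one>) \<in> {z \<in> topspace (prod_topology T T). ?f z \<in> O'}"
    using assms(2) by (simp add: topspace)
  from o[unfolded openin_prod_topology_alt, rule_format, OF this]
  obtain U W where UW: "openin T U" "openin T W" "\<one> \<in> U" "\<one> \<in> W"
    "U \<times> W \<subseteq> {z \<in> topspace (prod_topology T T). ?f z \<in> O'}"
    by (elim exE conjE)
  show ?thesis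
    by (rule that[of "U \<inter> W"]) (use UW in auto)
qed

lemma coset_proj_eq_iff:
  assumes "subgroup \<Gamma> G" "x \<in> carrier G" "y \<in> carrier G" "coset_proj G \<Gamma> x = coset_proj G \<Gamma> y"
  shows "\<exists>\<gamma>\<in>\<Gamma>. x = \<gamma> \<otimes> y"
proof -
  have "x \<in> coset_proj G \<Gamma> y"
    using rcos_self[OF assms(2,1)] assms(4) by (simp add: coset_proj_def)
  then show ?thesis by (auto simp: coset_proj_def r_coset_def)
qed

text \<open>With a neighbourhood V of the identity that separates \<Gamma>, compactness covers the
  group by finitely many sets \<Gamma> V h_i. The domain collects from each V h_i what is not in the
  earlier \<Gamma> V h_j. Its measure is finite because right translates of V have finite measure,
  and positive because its countably many \<Gamma>-translates cover the group.\<close>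

lemma fundamental_domain:
  assumes \<Gamma>: "subgroup \<Gamma> G" "subtopology T \<Gamma> = discrete_topology \<Gamma>"
    and cpt: "compact_space (coset_topology G T \<Gamma>)"
  obtains F where "F \<in> sets Gm" "0 < emeasure haar F" "emeasure haar F < \<infinity>" "countable \<Gamma>"
    "(\<Union>\<gamma>\<in>\<Gamma>. tr \<gamma> \<one> ` F) = carrier G"
    "\<And>\<gamma> x. \<gamma> \<in> \<Gamma> \<Longrightarrow> x \<in> F \<Longrightarrow> \<gamma> \<otimes> x \<in> F \<Longrightarrow> \<gamma> = \<one>"
proof -
  interpret \<Gamma>: subgroup \<Gamma> G by fact
  have \<Gamma>c: "\<gamma> \<in> carrier G" if "\<gamma> \<in> \<Gamma>" for \<gamma> using that by (rule \<Gamma>.mem_carrier)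
  have "second_countable T" using smooth_manifold by (simp add: smooth_manifold_def)
  then have "second_countable (discrete_topology \<Gamma>)"
    using second_countable_subtopology \<Gamma>(2) by metis
  then have cnt: "countable \<Gamma>" by (simp add: second_countable_discrete_topology)
  have "openin (subtopology T \<Gamma>) {\<one>}" using \<Gamma>(2) by simp
  then obtain O' where O': "openin T O'" "{\<one>} = O' \<inter> \<Gamma>" by (auto simp: openin_subtopology)
  then have "\<one> \<in> O'" by blast
  then obtain V1 where V1: "openin T V1" "\<one> \<in> V1" "\<And>x y. x \<in> V1 \<Longrightarrow> y \<in> V1 \<Longrightarrow> x \<otimes> inv y \<in> O'"
    using small_neighbourhood[OF O'(1)] by blast
  obtain V2 where V2: "openin T V2" "\<one> \<in> V2" "V2 \<subseteq> cdom c0" "\<And>W. W \<in> sets Gm \<Longrightarrow> W \<subseteq> V2 \<Longrightarrow> \<nu> W < \<infinity>"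
    using finite_neighbourhood by blast
  define V where "V = V1 \<inter> V2"
  have V: "openin T V" "\<one> \<in> V" "V \<subseteq> cdom c0" using V1 V2 by (auto simp: V_def)
  have Vm: "V \<in> sets Gm" by (rule open_sets_Gm[OF V(1)])
  have Vc: "V \<subseteq> carrier G" by (rule sets_Gm_subset[OF Vm])
  have Vfin: "emeasure haar V < \<infinity>" using haar_chart'[OF Vm V(3)] V2(4)[OF Vm] by (simp add: V_def)
  have Vpos: "0 < emeasure haar V" using haar_chart'[OF Vm V(3)] \<nu>_open_pos[OF V(1,3,2)] by simp
  \<comment> \<open>If x and \<gamma> x lie in V, then \<gamma> = (\<gamma> x) x^-1 lies in the open
    set isolating the identity in \<Gamma>.\<close>
  have Vsep: "\<gamma> = \<one>" if "\<gamma> \<in> \<Gamma>" "x \<in> V" "\<gamma> \<otimes> x \<in> V" for \<gamma> x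
  proof -
    have xc: "x \<in> carrier G" using that Vc by blast
    have "\<gamma> \<otimes> x \<otimes> inv x \<in> O'" using that V1(3) by (simp add: V_def)
    then have "\<gamma> \<in> O'" using xc \<Gamma>c[OF that(1)] by (simp add: m_assoc)
    then show ?thesis using that(1) O'(2) by blast
  qed
  define S where "S h = (\<Union>\<gamma>\<in>\<Gamma>. tr \<gamma> h ` V)" for h
  have Sm: "S h \<in> sets Gm" if "h \<in> carrier G" for h
    unfolding S_def by (rule sets.countable_UN'[OF cnt]) (use that \<Gamma>c Vm tr_sets in blast)
  have So: "openin T (S h)" if h: "h \<in> carrier G" for h
    unfolding S_def
  proof (rule openin_clauses(3), rule ballI)
    fix U assume "U \<in> (\<lambda>\<gamma>. tr \<gamma> h ` V) ` \<Gamma>"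
    then obtain \<gamma> where \<gamma>: "\<gamma> \<in> \<Gamma>" "U = tr \<gamma> h ` V" by blast
    have "continuous_map T T (tr (inv \<gamma>) (inv h))"
      using chart_diff_tr h \<Gamma>c[OF \<gamma>(1)] by (simp add: chart_diff_def)
    from openin_continuous_map_preimage[OF this V(1)]
    have "openin T {x \<in> topspace T. tr (inv \<gamma>) (inv h) x \<in> V}" .
    also have "{x \<in> topspace T. tr (inv \<gamma>) (inv h) x \<in> V} = U"
      unfolding \<gamma>(2) tr_vimage[OF \<Gamma>c[OF \<gamma>(1)] h Vc] topspace by blast
    finally show "openin T U" .
  qed
  have S_inv: "\<gamma> \<otimes> x \<in> S h" if \<gamma>: "\<gamma> \<in> \<Gamma>" and x: "x \<in> S h" and h: "h \<in> carrier G" for \<gamma> x h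
  proof -
    obtain \<delta> v where \<delta>: "\<delta> \<in> \<Gamma>" "v \<in> V" "x = tr \<delta> h v" using x unfolding S_def by blast
    have "v \<in> carrier G" using \<delta>(2) Vc by blast
    then have "\<gamma> \<otimes> x = tr (\<gamma> \<otimes> \<delta>) h v" using \<delta> \<gamma> h \<Gamma>c by (simp add: tr_def m_assoc)
    then show ?thesis using \<delta> \<gamma> \<Gamma>.m_closed unfolding S_def by blast
  qed
  let ?\<pi> = "coset_proj G \<Gamma>"
  have pre: "{p \<in> topspace T. ?\<pi> p \<in> ?\<pi> ` S h} = S h" if h: "h \<in> carrier G" for h
  proof (intro equalityI subsetI)
    fix p assume "p \<in> {p \<in> topspace T. ?\<pi> p \<in> ?\<pi> ` S h}"
    then obtain q where q: "p \<in> carrier G" "q \<in> S h" "?\<pi> p = ?\<pi> q" using topspace by auto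
    moreover have "q \<in> carrier G" using sets_Gm_subset[OF Sm[OF h]] q(2) by blast
    ultimately obtain \<gamma> where "\<gamma> \<in> \<Gamma>" "p = \<gamma> \<otimes> q" using coset_proj_eq_iff[OF \<Gamma>(1)] by blast
    then show "p \<in> S h" using S_inv q(2) h by blast
  next
    fix p assume "p \<in> S h"
    then show "p \<in> {p \<in> topspace T. ?\<pi> p \<in> ?\<pi> ` S h}"
      using sets_Gm_subset[OF Sm[OF h]] topspace by blast
  qed
  have op: "openin (coset_topology G T \<Gamma>) (?\<pi> ` S h)" if h: "h \<in> carrier G" for h
    unfolding openin_quotient_topology pre[OF h]
    using So[OF h] sets_Gm_subset[OF Sm[OF h]] topspace by auto
  have self: "h \<in> S h" if h: "h \<in> carrier G" for h
  proof -
    have "h = tr \<one> h \<one>" using h by (simp add: tr_def)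
    then show ?thesis using V(2) \<Gamma>.one_closed unfolding S_def by blast
  qed
  have "\<exists>\<F>. finite \<F> \<and> \<F> \<subseteq> (\<lambda>h. ?\<pi> ` S h) ` carrier G \<and> topspace (coset_topology G T \<Gamma>) \<subseteq> \<Union>\<F>"
  proof -
    have 1: "\<forall>U\<in>(\<lambda>h. ?\<pi> ` S h) ` carrier G. openin (coset_topology G T \<Gamma>) U" using op by blast
    have 2: "topspace (coset_topology G T \<Gamma>) \<subseteq> \<Union>((\<lambda>h. ?\<pi> ` S h) ` carrier G)"
      unfolding topspace_quotient_topology topspace using self by blast
    show ?thesis using cpt 1 2 unfolding compact_space_alt by blast
  qed
  then obtain H where H: "finite H" "H \<subseteq> carrier G" "topspace (coset_topology G T \<Gamma>) \<subseteq> \<Union>((\<lambda>h. ?\<pi> ` S h) ` H)"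
    by (metis finite_subset_image)
  have cov: "\<exists>h\<in>H. x \<in> S h" if x: "x \<in> carrier G" for x
  proof -
    have "?\<pi> x \<in> topspace (coset_topology G T \<Gamma>)"
      unfolding topspace_quotient_topology topspace using x by blast
    then obtain h where h: "h \<in> H" "?\<pi> x \<in> ?\<pi> ` S h" using H(3) by blast
    then have "x \<in> {p \<in> topspace T. ?\<pi> p \<in> ?\<pi> ` S h}" using x topspace by simp
    then have "x \<in> S h" using pre[of h] H(2) h(1) by blast
    then show ?thesis using h(1) by blast
  qed
  obtain hs where hs: "set hs = H" using H(1) finite_list by blast
  have hc: "hs ! i \<in> carrier G" if "i < length hs" for i using that hs H(2) nth_mem by blast
  \<comment> \<open>Whole saturated sets are removed: with only the earlier V h_j removed, pieces
    with different indices could contain points of one \<Gamma>-orbit.\<close>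
  define D where "D i = tr \<one> (hs ! i) ` V - (\<Union>j<i. S (hs ! j))" for i
  define F where "F = (\<Union>i<length hs. D i)"
  have Dm: "D i \<in> sets Gm" if i: "i < length hs" for i
  proof -
    have "(\<Union>j<i. S (hs ! j)) \<in> sets Gm" using i hc Sm by (intro sets.finite_UN) auto
    moreover have "tr \<one> (hs ! i) ` V \<in> sets Gm" using hc[OF i] Vm by (intro tr_sets) auto
    ultimately show ?thesis unfolding D_def by (rule sets.Diff[rotated])
  qed
  then have Fm: "F \<in> sets Gm" unfolding F_def by (intro sets.finite_UN) auto
  have Fc: "F \<subseteq> carrier G" by (rule sets_Gm_subset[OF Fm])
  have DS: "D i \<subseteq> S (hs ! i)" for i using \<Gamma>.one_closed unfolding D_def S_def by blast
  have U: "(\<Union>\<gamma>\<in>\<Gamma>. tr \<gamma> \<one> ` F) = carrier G"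
  proof (intro equalityI subsetI)
    fix x assume "x \<in> (\<Union>\<gamma>\<in>\<Gamma>. tr \<gamma> \<one> ` F)"
    then obtain \<gamma> y where "\<gamma> \<in> \<Gamma>" "y \<in> F" "x = tr \<gamma> \<one> y" by blast
    then show "x \<in> carrier G" using \<Gamma>c Fc by auto
  next
    fix x assume x: "x \<in> carrier G"
    let ?Q = "\<lambda>i. i < length hs \<and> x \<in> S (hs ! i)"
    have "\<exists>i. ?Q i" using cov[OF x] hs by (metis in_set_conv_nth)
    \<comment> \<open>For the least such index, the representative of x in V h_i avoids the earlier
      saturated sets because x does and they are \<Gamma>-invariant.\<close>
    define i where "i = (LEAST i. ?Q i)"
    have i: "?Q i" unfolding i_def using \<open>\<exists>i. ?Q i\<close> by (rule LeastI_ex)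
    have least: "x \<notin> S (hs ! j)" if "j < i" for j using not_less_Least[of j ?Q] that i unfolding i_def by auto
    obtain \<gamma> v where \<gamma>: "\<gamma> \<in> \<Gamma>" "v \<in> V" "x = tr \<gamma> (hs ! i) v" using i unfolding S_def by blast
    have vc: "v \<in> carrier G" using \<gamma>(2) Vc by blast
    let ?y = "tr \<one> (hs ! i) v"
    have y: "?y \<in> carrier G" "x = \<gamma> \<otimes> ?y" using \<gamma> vc hc[of i] i \<Gamma>c[OF \<gamma>(1)] by (simp_all add: tr_def m_assoc)
    have "?y \<notin> S (hs ! j)" if "j < i" for j
      using S_inv[OF \<gamma>(1), of ?y "hs ! j"] least[OF that] y(2) hc[of j] that i by auto
    then have "?y \<in> D i" using \<gamma>(2) unfolding D_def by blast
    then have "?y \<in> F" using i unfolding F_def by blast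
    moreover have "x = tr \<gamma> \<one> ?y" using y \<Gamma>c[OF \<gamma>(1)] by (simp add: tr_def)
    ultimately show "x \<in> (\<Union>\<gamma>\<in>\<Gamma>. tr \<gamma> \<one> ` F)" using \<gamma>(1) by blast
  qed
  have sep: "\<gamma> = \<one>" if \<gamma>: "\<gamma> \<in> \<Gamma>" and x: "x \<in> F" and y: "\<gamma> \<otimes> x \<in> F" for \<gamma> x
  proof -
    obtain i where i: "i < length hs" "x \<in> D i" using x unfolding F_def by blast
    obtain j where j: "j < length hs" "\<gamma> \<otimes> x \<in> D j" using y unfolding F_def by blast
    have xc: "x \<in> carrier G" using x Fc by blast
    have "\<gamma> \<otimes> x \<in> S (hs ! i)" using S_inv[OF \<gamma> _ hc[OF i(1)]] i(2) DS by blast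
    then have 1: "\<not> i < j" using j(2) unfolding D_def by blast
    have "inv \<gamma> \<otimes> (\<gamma> \<otimes> x) = x" using xc \<Gamma>c[OF \<gamma>] by (simp flip: m_assoc)
    then have "x \<in> S (hs ! j)" using S_inv[OF \<Gamma>.m_inv_closed[OF \<gamma>] _ hc[OF j(1)]] j(2) DS by (metis subsetD)
    then have "\<not> j < i" using i(2) unfolding D_def by blast
    \<comment> \<open>Two points of one orbit lie in the same piece; there h_i cancels on the right
      and the separation property of V applies.\<close>
    with 1 have ij: "i = j" by simp
    obtain v w where vw: "v \<in> V" "x = tr \<one> (hs ! i) v" "w \<in> V" "\<gamma> \<otimes> x = tr \<one> (hs ! i) w"
      using i(2) j(2) unfolding ij D_def by blast
    have c: "v \<in> carrier G" "w \<in> carrier G" using vw Vc by blast+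
    have "\<gamma> \<otimes> v \<otimes> hs ! i = w \<otimes> hs ! i"
      using vw(2,4) c hc[OF i(1)] \<Gamma>c[OF \<gamma>] by (simp add: tr_def m_assoc)
    then have "\<gamma> \<otimes> v = w" using c hc[OF i(1)] \<Gamma>c[OF \<gamma>] by simp
    then show ?thesis using Vsep[OF \<gamma> vw(1)] vw(3) by simp
  qed
  have fin: "emeasure haar F < \<infinity>"
  proof -
    have "emeasure haar F \<le> (\<Sum>i<length hs. emeasure haar (D i))"
      unfolding F_def using Dm by (intro emeasure_subadditive_finite) auto
    also have "\<dots> \<le> (\<Sum>i<length hs. emeasure haar (tr \<one> (hs ! i) ` V))"
      using hc Vm by (intro sum_mono emeasure_mono) (auto simp: D_def tr_sets)
    also have "\<dots> = (\<Sum>i<length hs. ennreal (modulus (hs ! i)) * emeasure haar V)"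
      using hc Vm by (intro sum.cong refl haar_tr) auto
    also have "\<dots> < \<infinity>" using Vfin by (simp add: ennreal_mult_less_top)
    finally show ?thesis .
  qed
  have pos: "0 < emeasure haar F"
  proof (rule ccontr)
    assume "\<not> 0 < emeasure haar F"
    then have "F \<in> null_sets haar" using Fm by (simp add: null_sets_def not_gr_zero)
    then have "tr \<gamma> \<one> ` F \<in> null_sets haar" if "\<gamma> \<in> \<Gamma>" for \<gamma>
      using haar_left[OF \<Gamma>c[OF that] Fm] tr_sets[OF \<Gamma>c[OF that] one_closed Fm] by (simp add: null_sets_def)
    then have "(\<Union>\<gamma>\<in>\<Gamma>. tr \<gamma> \<one> ` F) \<in> null_sets haar" using cnt by (intro null_sets_UN') auto
    then have "V \<in> null_sets haar" using U Vc Vm null_sets_subset by (metis sets_haar)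
    then show False using Vpos by (simp add: null_sets_def)
  qed
  show ?thesis by (rule that[OF Fm pos fin cnt U sep])
qed

text \<open>Cut F g by the sets \<gamma> F, and F by the sets \<gamma> F g. The pieces correspond
  under left translations, so F g and F have equal measure, and this measure, finite and positive,
  can be cancelled.\<close>

theorem unimodular:
  assumes \<Gamma>: "subgroup \<Gamma> G" "subtopology T \<Gamma> = discrete_topology \<Gamma>"
    and cpt: "compact_space (coset_topology G T \<Gamma>)" and g: "g \<in> carrier G"
  shows "modulus g = 1"
proof -
  interpret \<Gamma>: subgroup \<Gamma> G by fact
  have \<Gamma>c: "\<gamma> \<in> carrier G" if "\<gamma> \<in> \<Gamma>" for \<gamma> using that by (rule \<Gamma>.mem_carrier)
  obtain F where F: "F \<in> sets Gm" "0 < emeasure haar F" "emeasure haar F < \<infinity>" "countable \<Gamma>"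
    "(\<Union>\<gamma>\<in>\<Gamma>. tr \<gamma> \<one> ` F) = carrier G"
    "\<And>\<gamma> x. \<gamma> \<in> \<Gamma> \<Longrightarrow> x \<in> F \<Longrightarrow> \<gamma> \<otimes> x \<in> F \<Longrightarrow> \<gamma> = \<one>"
    using fundamental_domain[OF \<Gamma> cpt] by blast
  have Fc: "F \<subseteq> carrier G" by (rule sets_Gm_subset[OF F(1)])
  have disj: "disjoint_family_on (\<lambda>\<gamma>. tr \<gamma> b ` F) \<Gamma>" if b: "b \<in> carrier G" for b
    unfolding disjoint_family_on_def
  proof (intro ballI impI)
    fix \<gamma> \<delta> assume *: "\<gamma> \<in> \<Gamma>" "\<delta> \<in> \<Gamma>" "\<gamma> \<noteq> \<delta>"
    show "tr \<gamma> b ` F \<inter> tr \<delta> b ` F = {}"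
    proof (rule ccontr)
      assume "tr \<gamma> b ` F \<inter> tr \<delta> b ` F \<noteq> {}"
      then obtain x y where xy: "x \<in> F" "y \<in> F" "tr \<gamma> b x = tr \<delta> b y" by blast
      have c: "x \<in> carrier G" "y \<in> carrier G" "\<gamma> \<in> carrier G" "\<delta> \<in> carrier G" using xy Fc * \<Gamma>c by blast+
      have "\<gamma> \<otimes> x = \<delta> \<otimes> y" using xy(3) c b by (simp add: tr_def)
      then have "inv \<delta> \<otimes> \<gamma> \<otimes> x = y" using c by (simp add: m_assoc inv_solve_left')
      then have "inv \<delta> \<otimes> \<gamma> = \<one>"
        using F(6)[of "inv \<delta> \<otimes> \<gamma>" x] xy * by simp
      then have "\<gamma> = \<delta>" using c by (metis inv_equality inv_inv inv_closed)
      then show False using *(3) by simp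
    qed
  qed
  have un: "(\<Union>\<gamma>\<in>\<Gamma>. tr \<gamma> b ` F) = carrier G" if b: "b \<in> carrier G" for b
  proof -
    have "tr \<gamma> b ` F = tr \<one> b ` tr \<gamma> \<one> ` F" if "\<gamma> \<in> \<Gamma>" for \<gamma>
      using tr_image_image[OF one_closed b \<Gamma>c[OF that] one_closed Fc] b \<Gamma>c[OF that] by simp
    then have "(\<Union>\<gamma>\<in>\<Gamma>. tr \<gamma> b ` F) = tr \<one> b ` (\<Union>\<gamma>\<in>\<Gamma>. tr \<gamma> \<one> ` F)" by (simp add: image_UN)
    also have "\<dots> = carrier G"
      unfolding F(5) tr_vimage[OF one_closed b order_refl] using b by auto
    finally show ?thesis .
  qed
  have split: "emeasure haar E = (\<integral>\<^sup>+\<gamma>. emeasure haar (E \<inter> tr \<gamma> b ` F) \<partial>count_space \<Gamma>)"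
    if E: "E \<in> sets Gm" and b: "b \<in> carrier G" for E b
  proof -
    have "E = (\<Union>\<gamma>\<in>\<Gamma>. E \<inter> tr \<gamma> b ` F)" using un[OF b] sets_Gm_subset[OF E] by blast
    then have "emeasure haar E = emeasure haar (\<Union>\<gamma>\<in>\<Gamma>. E \<inter> tr \<gamma> b ` F)" by simp
    also have "\<dots> = (\<integral>\<^sup>+\<gamma>. emeasure haar (E \<inter> tr \<gamma> b ` F) \<partial>count_space \<Gamma>)"
    proof (rule emeasure_UN_countable[OF _ F(4)])
      show "E \<inter> tr \<gamma> b ` F \<in> sets haar" if "\<gamma> \<in> \<Gamma>" for \<gamma>
        using E tr_sets[OF \<Gamma>c[OF that] b F(1)] by auto
      show "disjoint_family_on (\<lambda>\<gamma>. E \<inter> tr \<gamma> b ` F) \<Gamma>"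
        using disj[OF b] unfolding disjoint_family_on_def by blast
    qed
    finally show ?thesis .
  qed
  let ?Fg = "tr \<one> g ` F"
  have Fg: "?Fg \<in> sets Gm" by (rule tr_sets[OF one_closed g F(1)])
  have swap: "emeasure haar (?Fg \<inter> tr \<gamma> \<one> ` F) = emeasure haar (F \<inter> tr (inv \<gamma>) g ` F)" if \<gamma>: "\<gamma> \<in> \<Gamma>" for \<gamma>
  proof -
    have c: "\<gamma> \<in> carrier G" "inv \<gamma> \<in> carrier G" using \<Gamma>c[OF \<gamma>] by simp_all
    have "tr \<gamma> \<one> ` (F \<inter> tr (inv \<gamma>) g ` F) = tr \<gamma> \<one> ` F \<inter> tr \<gamma> \<one> ` tr (inv \<gamma>) g ` F"
      by (rule inj_on_image_Int[OF inj_on_tr[OF c(1) one_closed] Fc sets_Gm_subset[OF tr_sets[OF c(2) g F(1)]]])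
    also have "tr \<gamma> \<one> ` tr (inv \<gamma>) g ` F = ?Fg" using c g by (simp add: tr_image_image[OF c(1) one_closed c(2) g Fc])
    finally have "tr \<gamma> \<one> ` F \<inter> ?Fg = tr \<gamma> \<one> ` (F \<inter> tr (inv \<gamma>) g ` F)" by simp
    moreover have "F \<inter> tr (inv \<gamma>) g ` F \<in> sets Gm" using F(1) tr_sets[OF c(2) g F(1)] by blast
    ultimately show ?thesis using haar_left[OF c(1)] by (metis Int_commute)
  qed
  \<comment> \<open>Left translation by \<gamma> turned the index of the piece into its inverse;
    inversion permutes \<Gamma>.\<close>
  have bij: "bij_betw (\<lambda>\<gamma>. inv \<gamma>) \<Gamma> \<Gamma>"
    by (rule bij_betw_byWitness[where f' = "\<lambda>\<gamma>. inv \<gamma>"]) (use \<Gamma>c \<Gamma>.m_inv_closed in auto)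
  have "emeasure haar ?Fg = (\<integral>\<^sup>+\<gamma>. emeasure haar (?Fg \<inter> tr \<gamma> \<one> ` F) \<partial>count_space \<Gamma>)"
    by (rule split[OF Fg one_closed])
  also have "\<dots> = (\<integral>\<^sup>+\<gamma>. emeasure haar (F \<inter> tr (inv \<gamma>) g ` F) \<partial>count_space \<Gamma>)"
    using swap by (intro nn_integral_cong) simp
  also have "\<dots> = (\<integral>\<^sup>+\<gamma>. emeasure haar (F \<inter> tr \<gamma> g ` F) \<partial>count_space \<Gamma>)"
    by (rule nn_integral_bij_count_space[OF bij])
  also have "\<dots> = emeasure haar F" by (rule split[OF F(1) g, symmetric])
  finally have "ennreal (modulus g) * emeasure haar F = emeasure haar F"
    using haar_tr[OF one_closed g F(1)] by simp
  then show ?thesis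
    using F(2,3) modulus_pos[OF g]
    by (cases "emeasure haar F") (auto simp flip: ennreal_mult)
qed

end

section \<open>The trace of the adjoint representation\<close>

context lie_grp_base
begin

text \<open>The second derivative of the multiplication at the identity, along \<open>z\<close> and
  then \<open>w\<close>. Its mixed part determines the Lie bracket.\<close>

definition D2 :: "'c \<times> 'c \<Rightarrow> 'c \<times> 'c \<Rightarrow> 'c" where
  "D2 z w = frechet_derivative (\<lambda>\<zeta>. frechet_derivative (mul c0 c0 c0) (at \<zeta>) z) (at (a0, a0)) w"

lemma base_mdom: "(a0, a0) \<in> mdom c0 c0 c0"
  using c0 one_c0 by (simp add: mdom_def a0_def)

lemma a0_crange: "a0 \<in> crange c0"
  using one_c0 by (simp add: a0_def)

lemma D2_has_derivative:
  "((\<lambda>\<zeta>. frechet_derivative (mul c0 c0 c0) (at \<zeta>) z) has_derivative D2 z) (at (a0, a0))"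
  unfolding D2_def
  by (rule smooth_on_has_derivative[OF smooth_on_frechet_derivative[OF smooth_mul[OF c0 c0 c0]] base_mdom])

lemma D2_commute: "D2 z w = D2 w z"
  unfolding D2_def
  by (rule frechet_derivative_commute[OF open_mdom[OF c0 c0 c0] smooth_mul[OF c0 c0 c0] base_mdom])

text \<open>A left-invariant field is the partial derivative of \<open>mul\<close> in the second
  variable; moving the base point differentiates in the first.\<close>

lemma left_field_derivative: "frechet_derivative (left_field w c0) (at a0) h = D2 (0, w) (h, 0)"
proof -
  have "(left_field w c0 has_derivative (\<lambda>h. D2 (0, w) (h, 0))) (at a0)"
    by (rule has_derivative_transform_within_open[OF has_derivative_slice(1)[OF D2_has_derivative]
          open_crange[OF c0] a0_crange])
      (simp add: left_field_mul[OF c0])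
  from frechet_derivative_at[OF this] show ?thesis by metis
qed

lemma lie_bracket_base:
  "lie_bracket A (left_field v) (left_field w) c0 a0 = D2 (0, w) (v, 0) - D2 (0, v) (w, 0)"
  using c0 a0_crange by (simp add: lie_bracket_def left_field_base left_field_derivative)

end

context lie_grp_vec
begin

text \<open>Since g (g^-1 x g) = x g, right translation is conjugation followed by left translation;
  at the identity the determinants multiply and the conjugation contributes the modulus.\<close>

lemma modulus_eq_one_det:
  assumes y: "y \<in> crange c0" and mod1: "modulus (icoord c0 y) = 1"
  shows "\<bar>det (matrix (\<lambda>u. frechet_derivative (mul c0 c0 c0) (at (a0, y)) (u, 0)))\<bar> =
         \<bar>det (matrix (\<lambda>v. frechet_derivative (mul c0 c0 c0) (at (y, a0)) (0, v)))\<bar>"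
proof -
  let ?g = "icoord c0 y"
  have g: "?g \<in> cdom c0" "coord c0 ?g = y" by (rule inv_chart[OF y])+
  then have gc: "?g \<in> carrier G" using cdom_carrier[OF c0] by blast
  have R: "TD c0 c0 (\<lambda>h. h \<otimes> ?g) \<one> = (\<lambda>u. frechet_derivative (mul c0 c0 c0) (at (a0, y)) (u, 0))"
    using TD_right[OF c0 c0 c0 one_c0 g(1)] g gc by (simp add: fun_eq_iff a0_def)
  have L: "TD c0 c0 (\<lambda>h. ?g \<otimes> h) \<one> = (\<lambda>v. frechet_derivative (mul c0 c0 c0) (at (y, a0)) (0, v))"
    using TD_left[OF c0 c0 c0 g(1) one_c0] g gc by (simp add: fun_eq_iff a0_def)
  have d: "chart_diff (\<lambda>h. ?g \<otimes> h)" "chart_diff (\<lambda>h. h \<otimes> ?g)" "chart_diff (tr (inv ?g) ?g)"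
    using gc by (simp_all add: chart_diff_left chart_diff_right chart_diff_tr)
  have t: "tr (inv ?g) ?g \<one> = \<one>" "?g \<otimes> \<one> = ?g" "\<one> \<otimes> ?g = ?g" using gc tr_conj_one by simp_all
  have e: "?g \<otimes> tr (inv ?g) ?g x = x \<otimes> ?g" if "x \<in> carrier G" for x
    using gc that by (simp add: tr_def flip: m_assoc)
  have "TD c0 c0 (\<lambda>x. ?g \<otimes> tr (inv ?g) ?g x) \<one> = TD c0 c0 (\<lambda>h. h \<otimes> ?g) \<one>"
    by (rule chart_diff_cong(2)[OF chart_diff_comp[OF d(3,1)] e c0 c0 one_c0]) (simp_all only: t g)
  moreover have "TD c0 c0 (\<lambda>x. ?g \<otimes> tr (inv ?g) ?g x) \<one> =
      (\<lambda>v. TD c0 c0 (\<lambda>h. ?g \<otimes> h) \<one> (TD c0 c0 (tr (inv ?g) ?g) \<one> v))"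
    using TD_comp[OF d(3,1) c0 c0 c0 one_c0] t g one_c0 by (simp add: fun_eq_iff)
  moreover have "linear (TD c0 c0 (tr (inv ?g) ?g) \<one>)" "linear (TD c0 c0 (\<lambda>h. ?g \<otimes> h) \<one>)"
    using t g one_c0 by (auto intro!: TD_linear d c0)
  ultimately have "det (matrix (TD c0 c0 (\<lambda>h. h \<otimes> ?g) \<one>)) =
      det (matrix (TD c0 c0 (\<lambda>h. ?g \<otimes> h) \<one>)) * det (matrix (TD c0 c0 (tr (inv ?g) ?g) \<one>))"
    using det_matrix_compose by metis
  then have "\<bar>det (matrix (TD c0 c0 (\<lambda>h. h \<otimes> ?g) \<one>))\<bar> = \<bar>det (matrix (TD c0 c0 (\<lambda>h. ?g \<otimes> h) \<one>))\<bar> * modulus ?g"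
    by (simp add: abs_mult modulus_def)
  then show ?thesis unfolding R L mod1 by simp
qed

text \<open>\<open>L y\<close> and \<open>R y\<close> are the matrices, at the identity, of left and
  right translation by the point with coordinates \<open>y\<close>. Their determinants agree up to
  sign in the whole chart, so the derivatives at the identity have equal traces, and the difference
  of these traces is that of ad v.\<close>

theorem trace_lie_bracket:
  assumes mod1: "\<And>g. g \<in> carrier G \<Longrightarrow> modulus g = 1"
  shows "(\<Sum>i\<in>UNIV. lie_bracket A (left_field v) (left_field (axis i 1)) c0 a0 $ i) = 0"
proof -
  let ?D = "\<lambda>z. frechet_derivative (mul c0 c0 c0) (at z)"
  define R where "R y = matrix (\<lambda>u. ?D (a0, y) (u, 0))" for y
  define L where "L y = matrix (\<lambda>v. ?D (y, a0) (0, v))" for y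
  define R' where "R' h = matrix (\<lambda>u. D2 (u, 0) (0, h))" for h
  define L' where "L' h = matrix (\<lambda>u. D2 (0, u) (h, 0))" for h
  have dR: "((\<lambda>y. R y $ i $ j) has_derivative (\<lambda>h. R' h $ i $ j)) (at a0)" for i j
    using bounded_linear.has_derivative[OF bounded_linear_vec_nth
        has_derivative_slice(2)[OF D2_has_derivative[of "(axis j 1, 0)"]], of i]
    unfolding R_def R'_def matrix_def by simp
  have dL: "((\<lambda>y. L y $ i $ j) has_derivative (\<lambda>h. L' h $ i $ j)) (at a0)" for i j
    using bounded_linear.has_derivative[OF bounded_linear_vec_nth
        has_derivative_slice(1)[OF D2_has_derivative[of "(0, axis j 1)"]], of i]
    unfolding L_def L'_def matrix_def by simp
  have "TD c0 c0 (\<lambda>h. h) \<one> = TD c0 c0 (\<lambda>h. h \<otimes> \<one>) \<one>"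
    by (rule chart_diff_cong(2)[OF chart_diff_id _ c0 c0 one_c0 one_c0]) simp
  then have "(\<lambda>u. ?D (a0, a0) (u, 0)) = (\<lambda>u. u)"
    using TD_right[OF c0 c0 c0 one_c0 one_c0] TD_id[OF c0 one_c0] one_c0 by (simp add: fun_eq_iff a0_def)
  then have R1: "R a0 = mat 1" unfolding R_def by (simp only: matrix_id_mat_1[unfolded id_def])
  have "(\<lambda>u. ?D (a0, a0) (0, u)) = (\<lambda>u. u)"
    using left_field_mul[OF c0 a0_crange] left_field_base by (simp add: fun_eq_iff)
  then have L1: "L a0 = mat 1" unfolding L_def by (simp only: matrix_id_mat_1[unfolded id_def])
  note dR' = has_derivative_det_at_mat_1[OF dR R1] and dL' = has_derivative_det_at_mat_1[OF dL L1]
  \<comment> \<open>Squares remove the absolute values; both determinants are 1 at the identity,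
    whence the factor 2.\<close>
  have 1: "((\<lambda>y. det (R y) * det (R y)) has_derivative (\<lambda>h. 2 * trace (R' h))) (at a0)"
    using has_derivative_mult[OF dR' dR'] by (simp add: R1)
  have eq: "det (L y) * det (L y) = det (R y) * det (R y)" if y: "y \<in> crange c0" for y
  proof -
    have "modulus (icoord c0 y) = 1" by (rule mod1[OF cdom_carrier[OF c0 inv_chart(1)[OF y]]])
    from modulus_eq_one_det[OF y this] have "\<bar>det (R y)\<bar> = \<bar>det (L y)\<bar>" unfolding R_def L_def .
    then show ?thesis by (metis abs_mult_self_eq)
  qed
  have 2: "((\<lambda>y. det (L y) * det (L y)) has_derivative (\<lambda>h. 2 * trace (L' h))) (at a0)"
    using has_derivative_mult[OF dL' dL'] by (simp add: L1)
  from has_derivative_unique[OF 1 has_derivative_transform_within_open[OF 2 open_crange[OF c0] a0_crange eq]] have "2 * trace (R' v) = 2 * trace (L' v)" by (rule fun_cong)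
  moreover have "trace (R' v) = (\<Sum>i\<in>UNIV. D2 (0, v) (axis i 1, 0) $ i)"
    unfolding trace_def R'_def matrix_def by (simp add: D2_commute[of "(0, v)"])
  moreover have "trace (L' v) = (\<Sum>i\<in>UNIV. D2 (0, axis i 1) (v, 0) $ i)"
    unfolding trace_def L'_def matrix_def by simp
  ultimately show ?thesis by (simp add: lie_bracket_base sum_subtractf)
qed

end

section \<open>Quasi abelian Lie algebras and left-invariant forms\<close>

text \<open>The moving vector is expanded in a basis, so that only derivatives of \<open>F\<close>
  at constant arguments enter the product rule.\<close>

lemma has_derivative_linear_slot:
  fixes F :: "'a::real_normed_vector \<Rightarrow> 'e::euclidean_space \<Rightarrow> real"
  assumes S: "open S" "x \<in> S" and lin: "\<And>y. y \<in> S \<Longrightarrow> linear (F y)"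
    and F: "\<And>v. ((\<lambda>y. F y v) has_derivative F' v) (at x)" and X: "(X has_derivative X') (at x)"
  shows "((\<lambda>y. F y (X y)) has_derivative (\<lambda>u. F' (X x) u + F x (X' u))) (at x)"
proof -
  have ex: "(\<Sum>b\<in>Basis. (v \<bullet> b) * F y b) = F y v" if "y \<in> S" for y v
  proof -
    have "F y v = F y (\<Sum>b\<in>Basis. (v \<bullet> b) *\<^sub>R b)" by (simp add: euclidean_representation)
    then show ?thesis using lin[OF that] by (simp add: linear_sum linear_scale)
  qed
  have "((\<lambda>y. \<Sum>b\<in>Basis. (X x \<bullet> b) * F y b) has_derivative (\<lambda>u. \<Sum>b\<in>Basis. (X x \<bullet> b) * F' b u)) (at x)"
    by (intro has_derivative_sum has_derivative_mult_right F)
  then have "((\<lambda>y. F y (X x)) has_derivative (\<lambda>u. \<Sum>b\<in>Basis. (X x \<bullet> b) * F' b u)) (at x)"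
    by (rule has_derivative_transform_within_open[OF _ S]) (rule ex)
  \<comment> \<open>Uniqueness of derivatives forces F' to be linear in its vector argument.\<close>
  then have e: "F' (X x) = (\<lambda>u. \<Sum>b\<in>Basis. (X x \<bullet> b) * F' b u)"
    by (rule has_derivative_unique[OF F])
  have "((\<lambda>y. \<Sum>b\<in>Basis. (X y \<bullet> b) * F y b) has_derivative
      (\<lambda>u. \<Sum>b\<in>Basis. (X x \<bullet> b) * F' b u + (X' u \<bullet> b) * F x b)) (at x)"
    by (intro has_derivative_sum has_derivative_mult F has_derivative_inner_left X)
  also have "(\<lambda>u. \<Sum>b\<in>Basis. (X x \<bullet> b) * F' b u + (X' u \<bullet> b) * F x b) = (\<lambda>u. F' (X x) u + F x (X' u))"
    unfolding e sum.distrib ex[OF S(2)] ..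
  finally show ?thesis by (rule has_derivative_transform_within_open[OF _ S]) (rule ex)
qed

lemma alternating_form_4_linear:
  assumes "alternating_form 4 \<alpha>"
  shows "linear (\<lambda>v. \<alpha> [v, b, c, d])" "linear (\<lambda>v. \<alpha> [a, v, c, d])"
    "linear (\<lambda>v. \<alpha> [a, b, v, d])" "linear (\<lambda>v. \<alpha> [a, b, c, v])"
proof -
  have *: "linear (\<lambda>v. \<alpha> (vs[i := v]))" if "length vs = 4" "i < 4" for vs i
    using assms that by (simp add: alternating_form_def)
  show "linear (\<lambda>v. \<alpha> [v, b, c, d])" "linear (\<lambda>v. \<alpha> [a, v, c, d])"
    "linear (\<lambda>v. \<alpha> [a, b, v, d])" "linear (\<lambda>v. \<alpha> [a, b, c, v])"
    using *[of "[a,b,c,d]" 0] *[of "[a,b,c,d]" 1] *[of "[a,b,c,d]" 2] *[of "[a,b,c,d]" 3]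
    by (simp_all add: numeral_2_eq_2 numeral_3_eq_3)
qed

context lie_grp_base
begin

section \<open>The Lie algebra transported to the identity\<close>

lemma left_field_add: "left_field (v + w) c x = left_field v c x + left_field w c x"
proof (cases "c \<in> A \<and> x \<in> crange c")
  case True
  then show ?thesis using linear_add[OF left_field_linear] by blast
next
  case False
  then show ?thesis unfolding left_field_def if_not_P[OF False] by simp
qed

lemma left_field_scale: "left_field (r *\<^sub>R v) c x = r *\<^sub>R left_field v c x"
proof (cases "c \<in> A \<and> x \<in> crange c")
  case True
  then show ?thesis using linear_scale[OF left_field_linear] by blast
next
  case False
  then show ?thesis unfolding left_field_def if_not_P[OF False] by simp
qed

lemma linear_left_field: "linear left_field"
  by (rule linearI) (auto simp: fun_eq_iff left_field_add left_field_scale plus_fun_def scaleR_fun_def)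

lemma inj_left_field: "inj left_field"
  by (rule inj_on_inverseI[of _ "\<lambda>X. X c0 a0"]) (rule left_field_base)

lemma lie_algebra_eq: "lie_algebra G A = range left_field"
  using lie_algebra_left_field left_field_in_lie_algebra by blast

text \<open>The flat connection of the chart applied to left-invariant fields: \<open>u\<close> is a
  vector at \<open>x\<close>, while \<open>w\<close> is the value of the field at the
  identity.\<close>

definition conn :: "('a, 'c) chart \<Rightarrow> 'c \<Rightarrow> 'c \<Rightarrow> 'c \<Rightarrow> 'c" where
  "conn c x u w = frechet_derivative (left_field w c) (at x) u"

lemma conn_has_derivative:
  "c \<in> A \<Longrightarrow> x \<in> crange c \<Longrightarrow> (left_field w c has_derivative (\<lambda>u. conn c x u w)) (at x)"
  unfolding conn_def by (rule smooth_on_has_derivative[OF left_field_smooth])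

lemma conn_linear_left: "c \<in> A \<Longrightarrow> x \<in> crange c \<Longrightarrow> linear (\<lambda>u. conn c x u w)"
  by (rule has_derivative_linear[OF conn_has_derivative])

lemma conn_linear_right:
  assumes "c \<in> A" "x \<in> crange c" shows "linear (\<lambda>w. conn c x u w)"
proof (rule linearI)
  fix v w
  have "left_field (v + w) c = (\<lambda>x. left_field v c x + left_field w c x)"
    by (simp add: fun_eq_iff left_field_add)
  then have "(left_field (v + w) c has_derivative (\<lambda>u. conn c x u v + conn c x u w)) (at x)"
    using has_derivative_add[OF conn_has_derivative[OF assms] conn_has_derivative[OF assms]] by simp
  from has_derivative_unique[OF conn_has_derivative[OF assms] this]
  show "conn c x u (v + w) = conn c x u v + conn c x u w" by (rule fun_cong)
next
  fix r w
  have "left_field (r *\<^sub>R w) c = (\<lambda>x. r *\<^sub>R left_field w c x)"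
    by (simp add: fun_eq_iff left_field_scale)
  then have "(left_field (r *\<^sub>R w) c has_derivative (\<lambda>u. r *\<^sub>R conn c x u w)) (at x)"
    using has_derivative_scaleR_right[OF conn_has_derivative[OF assms]] by simp
  from has_derivative_unique[OF conn_has_derivative[OF assms] this]
  show "conn c x u (r *\<^sub>R w) = r *\<^sub>R conn c x u w" by (rule fun_cong)
qed

definition br :: "('a, 'c) chart \<Rightarrow> 'c \<Rightarrow> 'c \<Rightarrow> 'c \<Rightarrow> 'c" where
  "br c x v w = lie_bracket A (left_field v) (left_field w) c x"

lemma br_conn:
  "c \<in> A \<Longrightarrow> x \<in> crange c \<Longrightarrow>
    br c x v w = conn c x (left_field v c x) w - conn c x (left_field w c x) v"
  by (simp add: br_def lie_bracket_def conn_def)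

lemma br_antisym: "c \<in> A \<Longrightarrow> x \<in> crange c \<Longrightarrow> br c x w v = - br c x v w"
  by (simp add: br_conn)

lemma br_linear:
  assumes "c \<in> A" "x \<in> crange c" shows "linear (\<lambda>w. br c x v w)"
proof -
  have "linear (\<lambda>w. conn c x (left_field w c x) v)"
    using linear_compose[OF left_field_linear[OF assms] conn_linear_left[OF assms]] by (simp add: o_def)
  then show ?thesis
    unfolding br_conn[OF assms] by (rule linear_compose_sub[OF conn_linear_right[OF assms]])
qed

text \<open>The isomorphism \<open>left_field\<close> pulls the ideal back to a hyperplane of the
  model space. Its normal \<nu> refers to the Euclidean product of coordinates, not yet to the
  metric of the structure.\<close>

lemma quasi_abelian_hyperplane:
  assumes "quasi_abelian (lie_algebra G A) (lie_bracket A)"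
  obtains \<nu> where "\<nu> \<noteq> 0"
    "\<And>v w. \<nu> \<bullet> w = 0 \<Longrightarrow> \<exists>u. \<nu> \<bullet> u = 0 \<and> lie_bracket A (left_field v) (left_field w) = left_field u"
    "\<And>v w. \<nu> \<bullet> v = 0 \<Longrightarrow> \<nu> \<bullet> w = 0 \<Longrightarrow> lie_bracket A (left_field v) (left_field w) = 0"
proof -
  obtain I where I: "I \<subseteq> range left_field" "subspace I" "dim I + 1 = dim (range left_field)"
    "\<And>X Y. X \<in> range left_field \<Longrightarrow> Y \<in> I \<Longrightarrow> lie_bracket A X Y \<in> I"
    "\<And>X Y. X \<in> I \<Longrightarrow> Y \<in> I \<Longrightarrow> lie_bracket A X Y = 0"
    using assms unfolding quasi_abelian_def lie_algebra_eq by blast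
  define J where "J = left_field -` I"
  have J: "I = left_field ` J" unfolding J_def using I(1) by blast
  have sJ: "subspace J" unfolding J_def by (rule linear_subspace_vimage[OF linear_left_field I(2)])
  have d: "dim (left_field ` S) = dim S" for S
    by (rule dim_image_eq[OF linear_left_field inj_on_subset[OF inj_left_field subset_UNIV]])
  have dJ: "dim J + 1 = DIM('c)" using I(3) unfolding J d by simp
  then have "dim J < DIM('c)" by simp
  then obtain \<nu> where \<nu>: "\<nu> \<noteq> 0" "span J \<subseteq> {x. \<nu> \<bullet> x = 0}" using lowdim_subset_hyperplane by blast
  have "J = {x. \<nu> \<bullet> x = 0}"
  proof (rule subspace_dim_equal[OF sJ subspace_hyperplane])
    show "J \<subseteq> {x. \<nu> \<bullet> x = 0}" using \<nu>(2) span_superset by blast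
    show "dim {x. \<nu> \<bullet> x = 0} \<le> dim J" using dJ dim_hyperplane[OF \<nu>(1)] by simp
  qed
  then have mem: "\<nu> \<bullet> w = 0 \<longleftrightarrow> left_field w \<in> I" for w unfolding J_def by blast
  show ?thesis
  proof (rule that[OF \<nu>(1)])
    fix v w assume "\<nu> \<bullet> w = 0"
    then have "lie_bracket A (left_field v) (left_field w) \<in> I" using mem I(4) by blast
    then show "\<exists>u. \<nu> \<bullet> u = 0 \<and> lie_bracket A (left_field v) (left_field w) = left_field u"
      using mem J unfolding J_def by blast
  next
    fix v w assume "\<nu> \<bullet> v = 0" "\<nu> \<bullet> w = 0"
    then show "lie_bracket A (left_field v) (left_field w) = 0" using mem I(5) by blast
  qed
qed

text \<open>The ideal property settles brackets with an entry in the hyperplane. Codimension one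
  reduces the rest to these: split both entries along \<open>n\<close>, whose bracket with itself is
  0.\<close>

lemma br_hyperplane:
  assumes "\<nu> \<noteq> 0"
    and 1: "\<And>v w. \<nu> \<bullet> w = 0 \<Longrightarrow> \<exists>u. \<nu> \<bullet> u = 0 \<and> lie_bracket A (left_field v) (left_field w) = left_field u"
    and c: "c \<in> A" "x \<in> crange c"
  shows "br c x v w = left_field (br c0 a0 v w) c x" and "\<nu> \<bullet> br c0 a0 v w = 0"
proof -
  have b: "a0 \<in> crange c0" using one_c0 by (simp add: a0_def)
  have *: "br c x v w = left_field (br c0 a0 v w) c x" "\<nu> \<bullet> br c0 a0 v w = 0" if "\<nu> \<bullet> w = 0" for v w
  proof -
    obtain u where u: "\<nu> \<bullet> u = 0" "lie_bracket A (left_field v) (left_field w) = left_field u"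
      using 1[OF \<open>\<nu> \<bullet> w = 0\<close>] by blast
    then have "br c0 a0 v w = u" by (simp add: br_def left_field_base)
    then show "br c x v w = left_field (br c0 a0 v w) c x" "\<nu> \<bullet> br c0 a0 v w = 0"
      using u by (simp_all add: br_def)
  qed
  \<comment> \<open>Scaled so that \<nu> \<bullet> n = 1.\<close>
  define n where "n = \<nu> /\<^sub>R (\<nu> \<bullet> \<nu>)"
  define v' where "v' = v - (\<nu> \<bullet> v) *\<^sub>R n"
  define w' where "w' = w - (\<nu> \<bullet> w) *\<^sub>R n"
  have z: "\<nu> \<bullet> v' = 0" "\<nu> \<bullet> w' = 0" using assms(1) by (simp_all add: v'_def w'_def n_def inner_diff_right)
  have split: "br c x v w = br c x v w' - (\<nu> \<bullet> w) *\<^sub>R br c x n v'" if c: "c \<in> A" "x \<in> crange c" for c x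
  proof -
    have nn: "br c x n n = 0" by (simp add: br_conn[OF c])
    have "br c x v w = br c x v (w' + (\<nu> \<bullet> w) *\<^sub>R n)" by (simp add: w'_def)
    also have "\<dots> = br c x v w' + (\<nu> \<bullet> w) *\<^sub>R br c x v n"
      using br_linear[OF c] by (simp add: linear_add linear_scale)
    also have "br c x v n = - br c x n (v' + (\<nu> \<bullet> v) *\<^sub>R n)" by (simp add: v'_def br_antisym[OF c, of n v])
    also have "\<dots> = - br c x n v'"
      using br_linear[OF c, of n] nn by (simp add: linear_add linear_scale)
    finally show ?thesis by simp
  qed
  show "br c x v w = left_field (br c0 a0 v w) c x"
    unfolding split[OF c] split[OF c0 b] *(1)[OF z(2)] *(1)[OF z(1)]
    by (simp only: linear_diff[OF left_field_linear[OF c]] linear_scale[OF left_field_linear[OF c]])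
  show "\<nu> \<bullet> br c0 a0 v w = 0"
    unfolding split[OF c0 b] using *(2) z by (simp add: inner_diff_right)
qed

text \<open>Pull back along left translation by the point itself; its tangent map at the identity
  sends \<open>v\<close> to the value of the left-invariant field.\<close>

lemma left_invariant_form_constant:
  assumes "\<forall>g\<in>carrier G. is_pullback A A (\<lambda>h. g \<otimes> h) \<omega> \<omega>" "c \<in> A" "x \<in> crange c"
  shows "\<omega> c x (map (\<lambda>v. left_field v c x) vs) = \<omega> c0 a0 vs"
proof -
  let ?p = "icoord c x"
  have p: "?p \<in> cdom c" "coord c ?p = x" by (rule inv_chart[OF assms(3)])+
  have pc: "?p \<in> carrier G" by (rule cdom_carrier[OF assms(2) p(1)])
  have "is_pullback A A (\<lambda>h. ?p \<otimes> h) \<omega> \<omega>" using assms(1) pc by blast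
  from this[unfolded is_pullback_def, rule_format, of c0 c \<one> vs]
  have "\<omega> c0 a0 vs = \<omega> c x (map (TD c0 c (\<lambda>h. ?p \<otimes> h) \<one>) vs)"
    using c0 assms(2) one_c0 p pc by (simp add: a0_def TD_def)
  moreover have "TD c0 c (\<lambda>h. ?p \<otimes> h) \<one> = (\<lambda>v. left_field v c x)"
    using assms(2,3) by (simp add: left_field_def fun_eq_iff)
  ultimately show ?thesis by simp
qed

text \<open>The form is constant on left-invariant fields. The product rule, applied slot by slot,
  trades its derivative on frozen arguments for derivatives of the fields.\<close>

lemma left_invariant_form_derivative:
  assumes form: "differential_form 4 A \<omega>"
    and inv: "\<forall>g\<in>carrier G. is_pullback A A (\<lambda>h. g \<otimes> h) \<omega> \<omega>" and c: "c \<in> A" "x \<in> crange c"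
  defines "X \<equiv> \<lambda>v. left_field v c x"
  shows "frechet_derivative (\<lambda>y. \<omega> c y [X v1, X v2, X v3, X v4]) (at x) u =
     - (\<omega> c x [conn c x u v1, X v2, X v3, X v4] + \<omega> c x [X v1, conn c x u v2, X v3, X v4]
        + \<omega> c x [X v1, X v2, conn c x u v3, X v4] + \<omega> c x [X v1, X v2, X v3, conn c x u v4])"
proof -
  note S = open_crange[OF c(1)] c(2)
  have alt: "alternating_form 4 (\<omega> c y)" if "y \<in> crange c" for y
    using form c(1) that by (simp add: differential_form_def)
  note lin = alternating_form_4_linear[OF alt]
  note d = conn_has_derivative[OF c]
  define T where "T vs = frechet_derivative (\<lambda>y. \<omega> c y vs) (at x)" for vs
  have T: "((\<lambda>y. \<omega> c y vs) has_derivative T vs) (at x)" for vs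
    unfolding T_def using form c by (intro smooth_on_has_derivative[of "crange c"]) (simp_all add: differential_form_def)
  let ?Y = "\<lambda>v y. left_field v c y"
  have 1: "((\<lambda>y. \<omega> c y [?Y v1 y, a2, a3, a4]) has_derivative
      (\<lambda>u. T [X v1, a2, a3, a4] u + \<omega> c x [conn c x u v1, a2, a3, a4])) (at x)" for a2 a3 a4
    unfolding X_def by (rule has_derivative_linear_slot[OF S lin(1) T d])
  have 2: "((\<lambda>y. \<omega> c y [?Y v1 y, ?Y v2 y, a3, a4]) has_derivative
      (\<lambda>u. T [X v1, X v2, a3, a4] u + \<omega> c x [conn c x u v1, X v2, a3, a4]
         + \<omega> c x [X v1, conn c x u v2, a3, a4])) (at x)" for a3 a4
    using has_derivative_linear_slot[OF S lin(2) 1 d] unfolding X_def by simp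
  have 3: "((\<lambda>y. \<omega> c y [?Y v1 y, ?Y v2 y, ?Y v3 y, a4]) has_derivative
      (\<lambda>u. T [X v1, X v2, X v3, a4] u + \<omega> c x [conn c x u v1, X v2, X v3, a4]
         + \<omega> c x [X v1, conn c x u v2, X v3, a4] + \<omega> c x [X v1, X v2, conn c x u v3, a4])) (at x)" for a4
    using has_derivative_linear_slot[OF S lin(3) 2 d] unfolding X_def by simp
  have 4: "((\<lambda>y. \<omega> c y [?Y v1 y, ?Y v2 y, ?Y v3 y, ?Y v4 y]) has_derivative
      (\<lambda>u. T [X v1, X v2, X v3, X v4] u + \<omega> c x [conn c x u v1, X v2, X v3, X v4]
         + \<omega> c x [X v1, conn c x u v2, X v3, X v4] + \<omega> c x [X v1, X v2, conn c x u v3, X v4]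
         + \<omega> c x [X v1, X v2, X v3, conn c x u v4])) (at x)"
    using has_derivative_linear_slot[OF S lin(4) 3 d] unfolding X_def by simp
  have const: "\<omega> c y [?Y v1 y, ?Y v2 y, ?Y v3 y, ?Y v4 y] = \<omega> c0 a0 [v1, v2, v3, v4]" if "y \<in> crange c" for y
    using left_invariant_form_constant[OF inv c(1) that, of "[v1, v2, v3, v4]"] by simp
  have "((\<lambda>y. \<omega> c y [?Y v1 y, ?Y v2 y, ?Y v3 y, ?Y v4 y]) has_derivative (\<lambda>u. 0)) (at x)"
    by (rule has_derivative_transform_within_open[OF has_derivative_const S]) (rule const[symmetric])
  from fun_cong[OF has_derivative_unique[OF 4 this], of u] show ?thesis
    unfolding T_def by simp
qed

end

section \<open>Locally conformally parallel structures\<close>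

lemma linear_inv:
  fixes f :: "'a::real_vector \<Rightarrow> 'b::real_vector"
  assumes "linear f" "bij f" shows "linear (inv_into UNIV f)"
proof (rule linearI)
  let ?g = "inv_into UNIV f"
  have fg: "f (?g y) = y" for y using assms(2) by (simp add: bij_def surj_f_inv_f)
  have gf: "?g (f x) = x" for x using assms(2) by (simp add: bij_def)
  show "?g (x + y) = ?g x + ?g y" for x y
    using gf[of "?g x + ?g y"] linear_add[OF assms(1), of "?g x" "?g y"] by (simp add: fg)
  show "?g (r *\<^sub>R x) = r *\<^sub>R ?g x" for r x
    using gf[of "r *\<^sub>R ?g x"] linear_scale[OF assms(1), of r "?g x"] by (simp add: fg)
qed

text \<open>Only the antisymmetric part of a torsion-free connection \<open>\<sigma>\<close> enters \<open>d\<Omega>\<close>: the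
  part of \<open>\<sigma>(u, w) - (\<nu> \<bullet> u) D w\<close> is symmetric and cancels in the alternating sum.\<close>

lemma spin7_form_connection_alternation:
  assumes lin: "\<And>b c d. linear (\<lambda>v. spin7_form [v, b, c, d])"
    and sym: "\<And>u w. \<sigma> u w - \<sigma> w u = (\<nu> \<bullet> u) *\<^sub>R D w - (\<nu> \<bullet> w) *\<^sub>R D u"
  shows "derivation4 (\<sigma> a) spin7_form b c d e - derivation4 (\<sigma> b) spin7_form a c d e
       + derivation4 (\<sigma> c) spin7_form a b d e - derivation4 (\<sigma> d) spin7_form a b c e
       + derivation4 (\<sigma> e) spin7_form a b c d =
       (\<nu> \<bullet> a) * derivation4 D spin7_form b c d e
        - (\<nu> \<bullet> b) * derivation4 D spin7_form a c d e + (\<nu> \<bullet> c) * derivation4 D spin7_form a b d e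
        - (\<nu> \<bullet> d) * derivation4 D spin7_form a b c e + (\<nu> \<bullet> e) * derivation4 D spin7_form a b c d"
proof -
  have t: "spin7_form [\<sigma> u w, x, y, z] - (\<nu> \<bullet> u) * spin7_form [D w, x, y, z] =
      spin7_form [\<sigma> w u, x, y, z] - (\<nu> \<bullet> w) * spin7_form [D u, x, y, z]" for u w x y z
  proof -
    have "spin7_form [\<sigma> u w - \<sigma> w u, x, y, z] =
        spin7_form [(\<nu> \<bullet> u) *\<^sub>R D w - (\<nu> \<bullet> w) *\<^sub>R D u, x, y, z]" unfolding sym ..
    then show ?thesis by (simp add: linear_diff[OF lin] linear_scale[OF lin])
  qed
  show ?thesis unfolding derivation4_spin7_form
    using t[of a b c d e] t[of a c b d e] t[of a d b c e] t[of a e b c d] t[of b c a d e]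
      t[of b d a c e] t[of b e a c d] t[of c d a b e] t[of c e a b d] t[of d e a b c]
    by (simp add: algebra_simps)
qed

locale lie_grp_8 = lie_grp_vec G T A c0
  for G (structure) and T :: "'g topology" and A :: "('g, real^8) chart set" and c0
begin

text \<open>Everything at the point is carried to an adapted frame: \<open>M\<close> sends a vector
  at the identity to the frame coordinates of its left-invariant field at \<open>x\<close>. There
  the conormal, the bracket and \<theta> satisfy \<open>spin7_frame_equations\<close>.\<close>

lemma lcp_vector_zero:
  assumes qa: "quasi_abelian (lie_algebra G A) (lie_bracket A)"
    and mod1: "\<And>g. g \<in> carrier G \<Longrightarrow> modulus g = 1"
    and sp: "spin7_structure A \<omega>" and inv: "\<forall>g\<in>carrier G. is_pullback A A (\<lambda>h. g \<otimes> h) \<omega> \<omega>"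
    and c: "c \<in> A" "x \<in> crange c"
    and lcp: "spin7_hodge (\<omega> c x) 5 (ext_deriv \<omega> c x) = (\<lambda>ws. \<omega> c x (\<theta> # ws))"
  shows "\<theta> = 0"
proof -
  have form: "differential_form 4 A \<omega>" using sp by (simp add: spin7_structure_def)
  have alt: "alternating_form 4 (\<omega> c x)" using form c by (simp add: differential_form_def)
  define L where "L = (SOME L. spin7_frame (\<omega> c x) L)"
  have "\<exists>L. spin7_frame (\<omega> c x) L" using sp c by (simp add: spin7_structure_def)
  then have "spin7_frame (\<omega> c x) L" unfolding L_def by (rule someI_ex)
  then have L: "linear L" "bij L" "\<And>vs. length vs = 4 \<Longrightarrow> \<omega> c x (map L vs) = spin7_form vs"
    unfolding spin7_frame_def by blast+
  define Li where "Li = inv_into UNIV L"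
  have Li: "linear Li" unfolding Li_def by (rule linear_inv[OF L(1,2)])
  have LLi [simp]: "L (Li v) = v" "Li (L v) = v" for v
    unfolding Li_def using L(2) by (simp_all add: bij_def surj_f_inv_f)
  define X where "X v = left_field v c x" for v
  have X: "linear X" unfolding X_def by (rule left_field_linear[OF c])
  have injX: "inj X" unfolding X_def by (rule left_field_inj[OF c])
  have bijX: "bij X" unfolding bij_def using injX linear_injective_imp_surjective[OF X injX] by blast
  define Xi where "Xi = inv_into UNIV X"
  have Xi: "linear Xi" unfolding Xi_def by (rule linear_inv[OF X bijX])
  have XXi [simp]: "X (Xi v) = v" "Xi (X v) = v" for v
    unfolding Xi_def using bijX by (simp_all add: bij_def surj_f_inv_f)
  define M where "M v = Li (X v)" for v
  define Mi where "Mi v = Xi (L v)" for v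
  have M: "linear M" "linear Mi" unfolding M_def Mi_def
    using linear_compose[OF X Li] linear_compose[OF L(1) Xi] by (simp_all add: o_def)
  have MMi [simp]: "M (Mi v) = v" "Mi (M v) = v" for v by (simp_all add: M_def Mi_def)
  have XMi [simp]: "X (Mi v) = L v" for v by (simp add: Mi_def)

  obtain \<nu>\<^sub>0 where \<nu>\<^sub>0: "\<nu>\<^sub>0 \<noteq> 0"
    "\<And>v w. \<nu>\<^sub>0 \<bullet> w = 0 \<Longrightarrow> \<exists>u. \<nu>\<^sub>0 \<bullet> u = 0 \<and> lie_bracket A (left_field v) (left_field w) = left_field u"
    "\<And>v w. \<nu>\<^sub>0 \<bullet> v = 0 \<Longrightarrow> \<nu>\<^sub>0 \<bullet> w = 0 \<Longrightarrow> lie_bracket A (left_field v) (left_field w) = 0"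
    using quasi_abelian_hyperplane[OF qa] by blast
  note hyp = br_hyperplane[OF \<nu>\<^sub>0(1,2) c]
  define \<nu>\<^sub>1 where "\<nu>\<^sub>1 = adjoint Mi \<nu>\<^sub>0"
  have \<nu>\<^sub>1: "\<nu>\<^sub>1 \<bullet> u = \<nu>\<^sub>0 \<bullet> Mi u" for u
    using adjoint_works[OF M(2), of u \<nu>\<^sub>0] by (simp add: \<nu>\<^sub>1_def inner_commute)
  have "\<nu>\<^sub>1 \<noteq> 0" using \<nu>\<^sub>1[of "M \<nu>\<^sub>0"] \<nu>\<^sub>0(1) by auto
  \<comment> \<open>A conormal transforms by the transpose, hence the adjoint of \<open>Mi\<close>.
    Dividing by the norm makes it a unit conormal for the metric of the structure.\<close>
  define \<nu> where "\<nu> = \<nu>\<^sub>1 /\<^sub>R norm \<nu>\<^sub>1"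
  have n1: "norm \<nu> = 1" using \<open>\<nu>\<^sub>1 \<noteq> 0\<close> by (simp add: \<nu>_def)
  have \<nu>: "\<nu> \<bullet> u = (\<nu>\<^sub>0 \<bullet> Mi u) / norm \<nu>\<^sub>1" for u by (simp add: \<nu>_def \<nu>\<^sub>1 field_simps)
  have \<nu>0: "\<nu>\<^sub>0 \<bullet> Mi u = 0" if "\<nu> \<bullet> u = 0" for u using that \<open>\<nu>\<^sub>1 \<noteq> 0\<close> by (simp add: \<nu>)

  have b0: "a0 \<in> crange c0" by (rule a0_crange)
  define \<beta> where "\<beta> u w = M (br c0 a0 (Mi u) (Mi w))" for u w
  have \<beta>lin: "linear (\<beta> u)" for u
    unfolding \<beta>_def using linear_compose[OF linear_compose[OF M(2) br_linear[OF c0 b0]] M(1)] by (simp add: o_def)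
  have \<beta>anti: "\<beta> w u = - \<beta> u w" for u w
    unfolding \<beta>_def br_antisym[OF c0 b0, of "Mi w" "Mi u"] by (rule linear_neg[OF M(1)])
  have \<beta>\<nu>: "\<nu> \<bullet> \<beta> u w = 0" for u w unfolding \<nu> \<beta>_def by (simp add: hyp(2))
  have \<beta>0: "\<beta> u w = 0" if "\<nu> \<bullet> u = 0" "\<nu> \<bullet> w = 0" for u w
    unfolding \<beta>_def br_def \<nu>\<^sub>0(3)[OF \<nu>0[OF that(1)] \<nu>0[OF that(2)]] using linear_0[OF M(1)] by (simp add: zero_fun_def)
  define D where "D w = \<beta> \<nu> w" for w
  have \<beta>D: "\<beta> u w = (\<nu> \<bullet> u) *\<^sub>R D w - (\<nu> \<bullet> w) *\<^sub>R D u" for u w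
  proof -
    have nn: "\<nu> \<bullet> \<nu> = 1" using n1 by (simp add: norm_eq_1)
    have "\<beta> \<nu> \<nu> = - \<beta> \<nu> \<nu>" by (rule \<beta>anti)
    then have \<nu>\<nu>: "\<beta> \<nu> \<nu> = 0" by (metis add.right_inverse double_zero scaleR_2 scaleR_left_distrib scaleR_one scaleR_eq_0_iff one_neq_zero zero_neq_numeral)
    \<comment> \<open>Components along the normal are split off; the bracket of the remaining parts
      vanishes because the ideal is abelian.\<close>
    define u' where "u' = u - (\<nu> \<bullet> u) *\<^sub>R \<nu>"
    define w' where "w' = w - (\<nu> \<bullet> w) *\<^sub>R \<nu>"
    have z: "\<nu> \<bullet> u' = 0" "\<nu> \<bullet> w' = 0" using nn by (simp_all add: u'_def w'_def inner_diff_right)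
    have w: "\<beta> v w = \<beta> v w' + (\<nu> \<bullet> w) *\<^sub>R \<beta> v \<nu>" for v
      using linear_add[OF \<beta>lin, of v w' "(\<nu> \<bullet> w) *\<^sub>R \<nu>"] linear_scale[OF \<beta>lin, of v "\<nu> \<bullet> w" \<nu>] by (simp add: w'_def)
    have u: "\<beta> v u = \<beta> v u' + (\<nu> \<bullet> u) *\<^sub>R \<beta> v \<nu>" for v
      using linear_add[OF \<beta>lin, of v u' "(\<nu> \<bullet> u) *\<^sub>R \<nu>"] linear_scale[OF \<beta>lin, of v "\<nu> \<bullet> u" \<nu>] by (simp add: u'_def)
    have "\<beta> u w' = (\<nu> \<bullet> u) *\<^sub>R D w'"
      using u[of w'] \<beta>0[OF z(2,1)] \<beta>anti[of u w'] \<beta>anti[of w' \<nu>] by (simp add: D_def)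
    moreover have "D w' = D w" using w[of \<nu>] \<nu>\<nu> by (simp add: D_def)
    moreover have "\<beta> u \<nu> = - D u" unfolding D_def by (rule \<beta>anti)
    ultimately show ?thesis using w[of u] by simp
  qed
  \<comment> \<open>\<open>D\<close> is conjugate by \<open>M\<close> to an adjoint map at the
    identity, which is traceless by \<open>trace_lie_bracket\<close>; the trace is cyclic.\<close>
  have trD: "(\<Sum>i\<in>UNIV. D (axis i 1) $ i) = 0"
  proof -
    define f where "f v = br c0 a0 (Mi \<nu>) v" for v
    have f: "linear f" unfolding f_def by (rule br_linear[OF c0 b0])
    have tf: "trace (matrix f) = 0"
      using trace_lie_bracket[OF mod1, of "Mi \<nu>"] by (simp add: trace_def matrix_def f_def br_def)
    have "matrix D = matrix M ** (matrix f ** matrix Mi)"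
    proof -
      have "D = M \<circ> (f \<circ> Mi)" by (simp add: fun_eq_iff D_def \<beta>_def f_def)
      then show ?thesis using matrix_compose[OF linear_compose[OF M(2) f] M(1)] matrix_compose[OF M(2) f] by simp
    qed
    then have "trace (matrix D) = trace ((matrix f ** matrix Mi) ** matrix M)" using trace_mul_sym by metis
    also have "\<dots> = trace (matrix f ** (matrix Mi ** matrix M))" by (simp only: matrix_mul_assoc)
    also have "matrix Mi ** matrix M = matrix (Mi \<circ> M)" by (rule matrix_compose[OF M, symmetric])
    also have "Mi \<circ> M = id" by (simp add: fun_eq_iff)
    finally have "trace (matrix D) = 0" using tf by (simp only: matrix_id_mat_1 matrix_mul_rid)
    then show ?thesis by (simp add: trace_def matrix_def)
  qed

  \<comment> \<open>The derivative of left-invariant fields in frame coordinates; its antisymmetric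
    part is the bracket.\<close>
  define \<sigma> where "\<sigma> u w = Li (conn c x (L u) (Mi w))" for u w
  have L\<sigma>: "L (\<sigma> u w) = conn c x (L u) (Mi w)" for u w by (simp add: \<sigma>_def)
  have \<sigma>\<beta>: "\<sigma> u w - \<sigma> w u = (\<nu> \<bullet> u) *\<^sub>R D w - (\<nu> \<bullet> w) *\<^sub>R D u" for u w
  proof -
    have "\<sigma> u w - \<sigma> w u = Li (br c x (Mi u) (Mi w))"
      unfolding br_conn[OF c] \<sigma>_def using linear_diff[OF Li] XMi by (simp add: X_def)
    also have "\<dots> = \<beta> u w" using hyp(1)[where v = "Mi u" and w = "Mi w"] by (simp only: \<beta>_def M_def X_def)
    finally show ?thesis using \<beta>D by simp
  qed
  have lin: "linear (\<lambda>v. spin7_form [v, b, c', d])" for b c' d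
  proof -
    have "spin7_form [v, b, c', d] = \<omega> c x [L v, L b, L c', L d]" for v
      using L(3)[of "[v, b, c', d]"] by simp
    then show ?thesis
      using linear_compose[OF L(1) alternating_form_4_linear(1)[OF alt]] by (simp add: o_def)
  qed
  define \<alpha> where "\<alpha> vs = ext_deriv \<omega> c x (map L vs)" for vs
  \<comment> \<open>The left-invariant fields of \<open>Mi v1\<close>, ..., \<open>Mi v4\<close>
    take the values \<open>L v1\<close>, ..., \<open>L v4\<close> at the point.\<close>
  have deriv: "frechet_derivative (\<lambda>y. \<omega> c y [L v1, L v2, L v3, L v4]) (at x) (L u) =
      - derivation4 (\<sigma> u) spin7_form v1 v2 v3 v4" for v1 v2 v3 v4 u
  proof -
    have m: "\<omega> c x [L a, L b, L c', L d] = spin7_form [a, b, c', d]" for a b c' d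
      using L(3)[of "[a, b, c', d]"] by simp
    show ?thesis
      using left_invariant_form_derivative[OF form inv c, of "Mi v1" "Mi v2" "Mi v3" "Mi v4" "L u"]
      by (simp add: X_def[symmetric] L\<sigma>[symmetric] m derivation4_def)
  qed
  interpret spin7_frame_equations \<nu> "Li \<theta>" D \<alpha>
  proof
    fix a b c' d e :: "real^8"
    have "\<alpha> [a,b,c',d,e] = - (derivation4 (\<sigma> a) spin7_form b c' d e - derivation4 (\<sigma> b) spin7_form a c' d e
       + derivation4 (\<sigma> c') spin7_form a b d e - derivation4 (\<sigma> d) spin7_form a b c' e
       + derivation4 (\<sigma> e) spin7_form a b c' d)"
      by (simp add: \<alpha>_def ext_deriv_def eval_nat_numeral lessThan_Suc deriv)
    then show "\<alpha> [a,b,c',d,e] = - ((\<nu> \<bullet> a) * derivation4 D spin7_form b c' d e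
        - (\<nu> \<bullet> b) * derivation4 D spin7_form a c' d e + (\<nu> \<bullet> c') * derivation4 D spin7_form a b d e
        - (\<nu> \<bullet> d) * derivation4 D spin7_form a b c' e + (\<nu> \<bullet> e) * derivation4 D spin7_form a b c' d)"
      unfolding spin7_form_connection_alternation[OF lin \<sigma>\<beta>] .
  next
    fix a b c' :: 8
    let ?es = "[axis a 1, axis b 1, axis c' 1] :: (real^8) list"
    have "hodge_std 5 \<alpha> ?es = spin7_hodge (\<omega> c x) 5 (ext_deriv \<omega> c x) (map L ?es)"
      unfolding spin7_hodge_def Let_def L_def[symmetric] Li_def[symmetric] by (simp add: \<alpha>_def[abs_def])
    also have "\<dots> = \<omega> c x (map L (Li \<theta> # ?es))" unfolding lcp by simp
    also have "\<dots> = spin7_form (Li \<theta> # ?es)" by (rule L(3)) simp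
    finally show "hodge_std 5 \<alpha> ?es = spin7_form (Li \<theta> # ?es)" .
  qed
  have "Li \<theta> = 0"
  proof (rule spin7_frame_equations_trivial[OF spin7_frame_equations_axioms n1 _ trD])
    show "\<nu> \<bullet> D w = 0" for w unfolding D_def by (rule \<beta>\<nu>)
  qed
  then show ?thesis using LLi(1)[of \<theta>] linear_0[OF L(1)] by simp
qed

end

text \<open>A quotient chart is a chart of the group composed with a local inverse of the
  projection. In these coordinates the projection is the identity, so pullback means equality of
  coordinate representations.\<close>

lemma coset_atlas_pullback:
  fixes G :: "'g monoid" and T :: "'g topology" and A :: "('g, real^8) chart set"
  assumes grp: "lie_group G T A"
    and pb: "is_pullback A (coset_atlas G T A \<Gamma>) (coset_proj G \<Gamma>) \<omega> \<Omega>"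
    and d: "d \<in> coset_atlas G T A \<Gamma>" and x: "x \<in> crange d"
  obtains c S where "c \<in> A" "open S" "x \<in> S" "S \<subseteq> crange c" "\<And>y. y \<in> S \<Longrightarrow> \<omega> c y = \<Omega> d y"
proof -
  interpret lie_grp G T A using grp by (rule lie_grp.intro)
  let ?f = "coset_proj G \<Gamma>"
  obtain U c where c: "d = (?f ` U, coord c \<circ> inv_into U ?f)" "c \<in> A" "openin T U" "U \<subseteq> cdom c" "inj_on ?f U"
    using d unfolding quotient_atlas_def by blast
  have dd: "cdom d = ?f ` U" "\<And>p. p \<in> U \<Longrightarrow> coord d (?f p) = coord c p"
    using c(1,5) by (simp_all add: cdom_def coord_def)
  have xS: "x \<in> coord c ` U" using x unfolding crange_def dd(1) using dd(2) by (auto simp: image_iff)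
  have S: "open (coord c ` U)" by (rule open_chart_image[OF chart[OF c(2)] c(3,4)])
  have eq: "\<omega> c y = \<Omega> d y" if y: "y \<in> coord c ` U" for y
  proof
    fix vs
    obtain p where p: "p \<in> U" "y = coord c p" using y by blast
    then have pc: "p \<in> cdom c" using c(4) by blast
    have "local_rep c d ?f z = z" if z: "z \<in> coord c ` U" for z
    proof -
      obtain q where q: "q \<in> U" "z = coord c q" using z by blast
      then have "q \<in> cdom c" using c(4) by blast
      then show ?thesis using q dd(2) icoord_coord[OF c(2)] by (simp add: local_rep_def)
    qed
    then have "(local_rep c d ?f has_derivative (\<lambda>v. v)) (at y)"
      using has_derivative_transform_within_open[OF has_derivative_ident S y] by metis
    from frechet_derivative_at[OF this] have id: "frechet_derivative (local_rep c d ?f) (at (coord c p)) = (\<lambda>v. v)"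
      using p(2) by simp
    have "?f p \<in> cdom d" using p(1) dd(1) by blast
    from pb[unfolded is_pullback_def, rule_format, OF c(2) d pc this, of vs]
    show "\<omega> c y vs = \<Omega> d y vs" using p dd(2) unfolding id by simp
  qed
  show ?thesis
    by (rule that[OF c(2) S xS _ eq]) (use c(4) in \<open>auto simp: crange_def\<close>)
qed

text \<open>Derivatives are local, so d\<Omega> on the quotient may be computed upstairs on the
  group.\<close>

lemma ext_deriv_cong:
  assumes "open S" "x \<in> S" "\<And>y. y \<in> S \<Longrightarrow> \<omega> c y = \<Omega> d y"
    and "\<And>vs. (\<lambda>y. \<omega> c y vs) differentiable (at x)"
  shows "ext_deriv \<omega> c x = ext_deriv \<Omega> d x"
proof -
  have "frechet_derivative (\<lambda>y. \<omega> c y vs) (at x) = frechet_derivative (\<lambda>y. \<Omega> d y vs) (at x)" for vs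
    by (rule frechet_derivative_transform_within_open[OF assms(4,1,2)]) (simp add: assms(3))
  then show ?thesis by (simp add: fun_eq_iff ext_deriv_def)
qed

theorem corollary7p8:
  "\<not> (\<exists>(G :: 'g monoid) (T :: 'g topology) (A :: ('g, real ^ 8) chart set) (\<Gamma> :: 'g set)
         (\<Omega> :: ('g set, real ^ 8) form).
        quasi_abelian_solvmanifold G T A \<Gamma> \<and>
        invariant_spin7 G T A \<Gamma> \<Omega> \<and>
        lcp_spin7 (coset_atlas G T A \<Gamma>) \<Omega> \<and>
        \<not> parallel_spin7 (coset_atlas G T A \<Gamma>) \<Omega>)"
proof (intro notI, elim exE conjE)
  fix G :: "'g monoid" and T :: "'g topology" and A :: "('g, real ^ 8) chart set" and \<Gamma> :: "'g set"
    and \<Omega> :: "('g set, real ^ 8) form"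
  assume *: "quasi_abelian_solvmanifold G T A \<Gamma>" "invariant_spin7 G T A \<Gamma> \<Omega>"
    "lcp_spin7 (coset_atlas G T A \<Gamma>) \<Omega>" "\<not> parallel_spin7 (coset_atlas G T A \<Gamma>) \<Omega>"
  have sol: "lie_group G T A" "subgroup \<Gamma> G" "subtopology T \<Gamma> = discrete_topology \<Gamma>"
    "compact_space (coset_topology G T \<Gamma>)" and qa: "quasi_abelian (lie_algebra G A) (lie_bracket A)"
    using *(1) unfolding quasi_abelian_solvmanifold_def solvmanifold_def by blast+
  obtain \<omega> where \<omega>: "spin7_structure A \<omega>" "\<forall>g\<in>carrier G. is_pullback A A (\<lambda>h. g \<otimes>\<^bsub>G\<^esub> h) \<omega> \<omega>"
    "is_pullback A (coset_atlas G T A \<Gamma>) (coset_proj G \<Gamma>) \<omega> \<Omega>"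
    using *(2) unfolding invariant_spin7_def by blast
  interpret lie_grp G T A using sol(1) by (rule lie_grp.intro)
  obtain c0 where c0: "c0 \<in> A" "\<one>\<^bsub>G\<^esub> \<in> cdom c0" using chart_at[OF one_closed] by blast
  interpret lie_grp_8 G T A c0 by unfold_locales (rule c0)+
  obtain d x where d: "d \<in> coset_atlas G T A \<Gamma>" "x \<in> crange d"
    "spin7_hodge (\<Omega> d x) 5 (ext_deriv \<Omega> d x) \<noteq> (\<lambda>ws. 0)"
    using *(4) unfolding parallel_spin7_def by blast
  obtain \<theta> where \<theta>: "spin7_hodge (\<Omega> d x) 5 (ext_deriv \<Omega> d x) = (\<lambda>ws. \<Omega> d x (\<theta> # ws))"
    using *(3) d(1,2) unfolding lcp_spin7_def by blast
  obtain c S where c: "c \<in> A" "open S" "x \<in> S" "S \<subseteq> crange c" "\<And>y. y \<in> S \<Longrightarrow> \<omega> c y = \<Omega> d y"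
    using coset_atlas_pullback[OF sol(1) \<omega>(3) d(1,2)] by blast
  have xc: "x \<in> crange c" using c(3,4) by blast
  have form: "differential_form 4 A \<omega>" using \<omega>(1) by (simp add: spin7_structure_def)
  have diff: "(\<lambda>y. \<omega> c y vs) differentiable (at x)" for vs
  proof -
    have "smooth_on (crange c) (\<lambda>y. \<omega> c y vs)" using form c(1) by (simp add: differential_form_def)
    from smooth_on_has_derivative[OF this xc] show ?thesis by (rule differentiableI)
  qed
  have ed: "ext_deriv \<omega> c x = ext_deriv \<Omega> d x"
    by (rule ext_deriv_cong[OF c(2,3)]) (simp_all add: c(5) diff)
  have lcp: "spin7_hodge (\<omega> c x) 5 (ext_deriv \<omega> c x) = (\<lambda>ws. \<omega> c x (\<theta> # ws))"
    unfolding ed c(5)[OF c(3)] by (rule \<theta>)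
  have "\<theta> = 0"
    by (rule lcp_vector_zero[OF qa unimodular[OF sol(2-4)] \<omega>(1,2) c(1) xc lcp])
  \<comment> \<open>Contraction with the zero vector vanishes by linearity in the first slot, or,
    for lists of the wrong length, by the convention in \<open>alternating_form\<close>.\<close>
  moreover have "\<omega> c x (0 # ws) = 0" for ws
  proof (cases "length ws = 3")
    case True
    have "alternating_form 4 (\<omega> c x)" using form c(1) xc by (simp add: differential_form_def)
    then have "\<forall>vs i. length vs = 4 \<and> i < 4 \<longrightarrow> linear (\<lambda>v. \<omega> c x (vs[i := v]))"
      unfolding alternating_form_def by blast
    from this[rule_format, of "0 # ws" 0] have "linear (\<lambda>v. \<omega> c x ((0 # ws)[0 := v]))" using True by simp
    from linear_0[OF this] show ?thesis by simp
  next
    case False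
    have "alternating_form 4 (\<omega> c x)" using form c(1) xc by (simp add: differential_form_def)
    then show ?thesis using False by (simp add: alternating_form_def)
  qed
  ultimately have "spin7_hodge (\<omega> c x) 5 (ext_deriv \<omega> c x) = (\<lambda>ws. 0)" unfolding lcp by simp
  then show False using d(3) unfolding ed c(5)[OF c(3)] by simp
qed

end
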